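(* Let $M/F$ be a Galois field extension of degree $n$ with non-trivial solvable $G=\mathrm{Aut}_F(M)$, and let $A$ be a central simple algebra of degree $n$ over $F$ with maximal subfield $M$. Fix a chain of subgroups $\{1\}=G_0\le G_1\le\dots\le G_k=G$ such that, for all $j\in\{0,\dots,k-1\}$, $G_j$ is normal in $G_{j+1}$ and $G_{j+1}/G_j$ is cyclic of prime order $q_j$, generated by the coset of $\sigma_{j+1}\in G_{j+1}$. Then $A$ is a $G$-crossed product algebra and there exists a chain of subalgebras $$M=A_0\subset A_1\subset\dots\subset A_k=M(G)=A$$ of $A$ such that the $A_i$ are generalized cyclic algebras of degree $\prod_{l=0}^{i-1}q_l$ over $Z_i=\mathrm{Fix}(G_i)$, of the type $$A_{i+1}\cong A_i[t_i;\tau_i]/A_i[t_i;\tau_i](t_i^{q_i}-c_i)$$ for all $i\in\{0,\dots,k-1\}$, where (i) $q_i$ is the prime order of the factor group $G_{i+1}/G_i$; (ii) $\tau_i$ is an $F$-automorphism of $A_i$ of inner order $q_i$ which restricts on $M$ to the automorphism $\sigma_{i+1}\in G_{i+1}$ generating $G_{i+1}/G_i$; (iii) $c_i\in\mathrm{Fix}(\tau_i)$ is invertible. Additionally, for all $i\in\{1,\dots,k\}$: (iv) $Z_{i-1}/Z_i$ has prime degree $q_{i-1}$.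
   Context: All algebras are unital, associative and finite-dimensional. A central simple algebra $A$ over $F$ has degree $n$ if $\dim_F A=n^2$; a maximal subfield of $A$ is a subfield $M\supseteq F$ of $A$ with $[M:F]=n$. For a group $H$ of automorphisms of $M$, $\mathrm{Fix}(H)$ is its fixed field in $M$; for an automorphism $\tau$ of a ring $S$, $\mathrm{Fix}(\tau)=\{s\in S:\tau(s)=s\}$. A central simple algebra over a field $Z$ is an $H$-crossed product algebra over $Z$ if it contains a maximal subfield that is Galois over $Z$ with Galois group $H$. $M(G)$: by Skolem–Noether, for each $\sigma\in G$ there is an invertible $x_\sigma\in A$ with $x_\sigma m x_\sigma^{-1}=\sigma(m)$ for all $m\in M$, unique up to left multiplication by $M^\times$; $M(G)$ is the left $M$-span of $\{x_\sigma:\sigma\in G\}$ in $A$. For a ring $S$ and an automorphism $\tau$ of $S$, $S[t;\tau]$ is the twisted polynomial ring with $ta=\tau(a)t$ for $a\in S$. For monic $f\in S[t;\tau]$ of degree $m$, $S[t;\tau]/S[t;\tau]f$ denotes the set of twisted polynomials of degree $<m$ with multiplication $g\circ h=$ remainder of $gh$ under right division by $f$; when $f$ is invariant (i.e. $S[t;\tau]f$ is a two-sided ideal) this is the usual quotient ring. If $S$ is a finite-dimensional simple algebra over its center $Z$, $\tau\in\mathrm{Aut}(S)$ is such that $\tau|_Z$ has finite order $m$, and $f=t^m-d$ with $d\in\mathrm{Fix}(\tau)^\times$ is invariant, then $(S,\tau,d)=S[t;\tau]/S[t;\tau](t^m-d)$ is called a generalized cyclic algebra. For $i=0$ the algebra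 $A_0=M$ is just the field $M$ (degree $1$ over $Z_0=M$). The inner order of an automorphism $\tau$ of $S$ is the smallest positive integer $m$ such that $\tau^m$ is an inner automorphism $z\mapsto uzu^{-1}$ of $S$. *)

theory Defs
  imports
    "HOL-Algebra.Embedded_Algebras"
    "HOL-Algebra.Solvable_Groups"
    "HOL-Algebra.UnivPoly"
    "HOL-Algebra.Bij"
    "HOL-Computational_Algebra.Primes"
begin

section \<open>Automorphisms and fixed points\<close>

text \<open>
  A subring \<open>S\<close> of \<open>R\<close> is regarded as a ring in its own right by passing to
  \<open>R\<lparr>carrier := S\<rparr>\<close>. Like the elements of \<^const>\<open>Bij\<close>, automorphisms are
  extensional functions on the carrier, so that each one is represented once.
\<close>

definition ring_auto :: "('a, 'm) ring_scheme \<Rightarrow> ('a \<Rightarrow> 'a) set"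
  where "ring_auto R = ring_hom R R \<inter> Bij (carrier R)"

definition alg_auto :: "'a set \<Rightarrow> ('a, 'm) ring_scheme \<Rightarrow> ('a \<Rightarrow> 'a) set"
  where "alg_auto K R = {h \<in> ring_auto R. \<forall>x \<in> K. h x = x}"

definition Fix :: "('a \<Rightarrow> 'a) set \<Rightarrow> 'a set \<Rightarrow> 'a set"
  where "Fix H S = {s \<in> S. \<forall>h \<in> H. h s = s}"

definition inner_auto :: "('a, 'm) ring_scheme \<Rightarrow> ('a \<Rightarrow> 'a) \<Rightarrow> bool"
  where "inner_auto R \<phi> \<longleftrightarrow>
    (\<exists>u \<in> Units R. \<forall>z \<in> carrier R. \<phi> z = u \<otimes>\<^bsub>R\<^esub> z \<otimes>\<^bsub>R\<^esub> inv\<^bsub>R\<^esub> u)"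

definition has_inner_order :: "('a, 'm) ring_scheme \<Rightarrow> ('a \<Rightarrow> 'a) \<Rightarrow> nat \<Rightarrow> bool"
  where "has_inner_order R \<tau> m \<longleftrightarrow>
    0 < m \<and> inner_auto R (\<tau> ^^ m) \<and> (\<forall>j. 0 < j \<and> j < m \<longrightarrow> \<not> inner_auto R (\<tau> ^^ j))"


section \<open>Galois extensions inside a ring\<close>

definition field_ext :: "('a, 'm) ring_scheme \<Rightarrow> 'a set \<Rightarrow> 'a set \<Rightarrow> bool"
  where "field_ext R K L \<longleftrightarrow> subfield K R \<and> subfield L R \<and> K \<subseteq> L"

definition Gal :: "('a, 'm) ring_scheme \<Rightarrow> 'a set \<Rightarrow> 'a set \<Rightarrow> ('a \<Rightarrow> 'a) monoid"
  where "Gal R K L = BijGroup L \<lparr>carrier := alg_auto K (R\<lparr>carrier := L\<rparr>)\<rparr>"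

definition galois_ext :: "('a, 'm) ring_scheme \<Rightarrow> 'a set \<Rightarrow> 'a set \<Rightarrow> bool"
  where "galois_ext R K L \<longleftrightarrow>
    field_ext R K L \<and> ring.finite_dimension R K L \<and> Fix (carrier (Gal R K L)) L = K"


section \<open>Central simple algebras and crossed products\<close>

definition center :: "('a, 'm) ring_scheme \<Rightarrow> 'a set"
  where "center R = {z \<in> carrier R. \<forall>x \<in> carrier R. z \<otimes>\<^bsub>R\<^esub> x = x \<otimes>\<^bsub>R\<^esub> z}"

definition simple_ring :: "('a, 'm) ring_scheme \<Rightarrow> bool"
  where "simple_ring R \<longleftrightarrow> ring R \<and> \<one>\<^bsub>R\<^esub> \<noteq> \<zero>\<^bsub>R\<^esub> \<and>
    (\<forall>I. ideal I R \<longrightarrow> I = {\<zero>\<^bsub>R\<^esub>} \<or> I = carrier R)"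

text \<open>The base field of an algebra is identified with its image in the algebra.\<close>

definition central_simple :: "('a, 'm) ring_scheme \<Rightarrow> 'a set \<Rightarrow> bool"
  where "central_simple R K \<longleftrightarrow>
    simple_ring R \<and> subfield K R \<and> center R = K \<and> ring.finite_dimension R K (carrier R)"

definition central_simple_degree :: "('a, 'm) ring_scheme \<Rightarrow> 'a set \<Rightarrow> nat \<Rightarrow> bool"
  where "central_simple_degree R K n \<longleftrightarrow>
    central_simple R K \<and> ring.dimension R (n ^ 2) K (carrier R)"

definition maximal_subfield :: "('a, 'm) ring_scheme \<Rightarrow> 'a set \<Rightarrow> 'a set \<Rightarrow> bool"
  where "maximal_subfield R K L \<longleftrightarrow>
    field_ext R K L \<and> (\<exists>n. central_simple_degree R K n \<and> ring.dimension R n K L)"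

definition crossed_product ::
    "('g, 'h) monoid_scheme \<Rightarrow> ('a, 'm) ring_scheme \<Rightarrow> 'a set \<Rightarrow> bool"
  where "crossed_product H R K \<longleftrightarrow> central_simple R K \<and>
    (\<exists>L. maximal_subfield R K L \<and> galois_ext R K L \<and> Gal R K L \<cong> H)"

text \<open>
  For a maximal subfield \<open>L\<close> of a central simple algebra over \<open>K\<close> and \<open>\<sigma> \<in> Gal R K L\<close>, the
  Skolem--Noether theorem provides an element as chosen below. It is unique up to left
  multiplication by a nonzero element of \<open>L\<close>, so the span does not depend on the choice.
\<close>

definition conj_elem :: "('a, 'm) ring_scheme \<Rightarrow> 'a set \<Rightarrow> ('a \<Rightarrow> 'a) \<Rightarrow> 'a"
  where "conj_elem R L \<sigma> =
    (SOME x. x \<in> Units R \<and> (\<forall>a \<in> L. x \<otimes>\<^bsub>R\<^esub> a \<otimes>\<^bsub>R\<^esub> inv\<^bsub>R\<^esub> x = \<sigma> a))"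

definition conj_span :: "('a, 'm) ring_scheme \<Rightarrow> 'a set \<Rightarrow> ('a \<Rightarrow> 'a) set \<Rightarrow> 'a set"
  where "conj_span R L H = (\<Union>Us \<in> lists (conj_elem R L ` H). ring.Span R L Us)"


section \<open>Twisted polynomials\<close>

text \<open>
  As in \<^theory>\<open>HOL-Algebra.UnivPoly\<close>, polynomials are their coefficient functions; coefficients
  stand to the left of the powers of \<open>t\<close>, and \<open>t\<^sup>i a = \<tau>\<^sup>i(a) t\<^sup>i\<close>.
\<close>

definition twisted_poly :: "('a, 'm) ring_scheme \<Rightarrow> ('a \<Rightarrow> 'a) \<Rightarrow> (nat \<Rightarrow> 'a) ring"
  where "twisted_poly R \<tau> =
    \<lparr>carrier = up R,
     monoid.mult = (\<lambda>p q n. \<Oplus>\<^bsub>R\<^esub>i \<in> {..n}. p i \<otimes>\<^bsub>R\<^esub> (\<tau> ^^ i) (q (n - i))),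
     one = (\<lambda>n. if n = 0 then \<one>\<^bsub>R\<^esub> else \<zero>\<^bsub>R\<^esub>),
     zero = (\<lambda>n. \<zero>\<^bsub>R\<^esub>),
     ring.add = (\<lambda>p q n. p n \<oplus>\<^bsub>R\<^esub> q n)\<rparr>"

definition tp_const :: "('a, 'm) ring_scheme \<Rightarrow> 'a \<Rightarrow> nat \<Rightarrow> 'a"
  where "tp_const R a = (\<lambda>n. if n = 0 then a else \<zero>\<^bsub>R\<^esub>)"

definition tp_var :: "('a, 'm) ring_scheme \<Rightarrow> nat \<Rightarrow> 'a"
  where "tp_var R = (\<lambda>n. if n = 1 then \<one>\<^bsub>R\<^esub> else \<zero>\<^bsub>R\<^esub>)"

definition tp_reduced :: "('a, 'm) ring_scheme \<Rightarrow> (nat \<Rightarrow> 'a) \<Rightarrow> (nat \<Rightarrow> 'a) set"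
  where "tp_reduced R f = {g \<in> up R. \<forall>n \<ge> deg R f. g n = \<zero>\<^bsub>R\<^esub>}"

text \<open>The remainder exists and is unique when \<open>f\<close> is monic.\<close>

definition tp_rem ::
    "('a, 'm) ring_scheme \<Rightarrow> ('a \<Rightarrow> 'a) \<Rightarrow> (nat \<Rightarrow> 'a) \<Rightarrow> (nat \<Rightarrow> 'a) \<Rightarrow> (nat \<Rightarrow> 'a)"
  where "tp_rem R \<tau> f g = (THE r. r \<in> tp_reduced R f \<and>
    (\<exists>q \<in> up R. g = (q \<otimes>\<^bsub>twisted_poly R \<tau>\<^esub> f) \<oplus>\<^bsub>twisted_poly R \<tau>\<^esub> r))"

definition tp_quot ::
    "('a, 'm) ring_scheme \<Rightarrow> ('a \<Rightarrow> 'a) \<Rightarrow> (nat \<Rightarrow> 'a) \<Rightarrow> (nat \<Rightarrow> 'a) ring"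
  where "tp_quot R \<tau> f =
    \<lparr>carrier = tp_reduced R f,
     monoid.mult = (\<lambda>g h. tp_rem R \<tau> f (g \<otimes>\<^bsub>twisted_poly R \<tau>\<^esub> h)),
     one = tp_rem R \<tau> f \<one>\<^bsub>twisted_poly R \<tau>\<^esub>,
     zero = \<zero>\<^bsub>twisted_poly R \<tau>\<^esub>,
     ring.add = ring.add (twisted_poly R \<tau>)\<rparr>"

definition tp_invariant :: "('a, 'm) ring_scheme \<Rightarrow> ('a \<Rightarrow> 'a) \<Rightarrow> (nat \<Rightarrow> 'a) \<Rightarrow> bool"
  where "tp_invariant R \<tau> f \<longleftrightarrow>
    ideal {g \<otimes>\<^bsub>twisted_poly R \<tau>\<^esub> f | g. g \<in> up R} (twisted_poly R \<tau>)"


section \<open>Generalized cyclic algebras\<close>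

definition tp_binomial ::
    "('a, 'm) ring_scheme \<Rightarrow> ('a \<Rightarrow> 'a) \<Rightarrow> nat \<Rightarrow> 'a \<Rightarrow> (nat \<Rightarrow> 'a)"
  where "tp_binomial R \<tau> m d =
    tp_var R [^]\<^bsub>twisted_poly R \<tau>\<^esub> m \<ominus>\<^bsub>twisted_poly R \<tau>\<^esub> tp_const R d"

text \<open>
  The conditions under which the quotient by \<open>t\<^sup>m - d\<close> is the generalized cyclic algebra
  \<open>(R, \<tau>, d)\<close>. Since \<^const>\<open>group.ord\<close> is \<open>0\<close> for elements of infinite order, \<open>0 < m\<close>
  expresses that the order of \<open>\<tau>\<close> on the center is finite.
\<close>

definition gen_cyclic_datum ::
    "('a, 'm) ring_scheme \<Rightarrow> ('a \<Rightarrow> 'a) \<Rightarrow> nat \<Rightarrow> 'a \<Rightarrow> bool"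
  where "gen_cyclic_datum R \<tau> m d \<longleftrightarrow>
    central_simple R (center R) \<and>
    \<tau> \<in> ring_auto R \<and>
    0 < m \<and> group.ord (BijGroup (center R)) (restrict \<tau> (center R)) = m \<and>
    d \<in> Units (R\<lparr>carrier := Fix {\<tau>} (carrier R)\<rparr>) \<and>
    tp_invariant R \<tau> (tp_binomial R \<tau> m d)"

definition gen_cyclic_algebra ::
    "('a, 'm) ring_scheme \<Rightarrow> ('a \<Rightarrow> 'a) \<Rightarrow> nat \<Rightarrow> 'a \<Rightarrow> (nat \<Rightarrow> 'a) ring"
  where "gen_cyclic_algebra R \<tau> m d = tp_quot R \<tau> (tp_binomial R \<tau> m d)"

end

theory Submission
  imports Defs
begin

text \<open>
  For \<open>\<sigma> \<in> Gal(M/F)\<close> let \<open>A\<^sub>\<sigma>\<close> be the set of \<open>x\<close> with \<open>x m = \<sigma>(m) x\<close> for all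
  \<open>m \<in> M\<close>. An element of \<open>M \<otimes> M\<close> that vanishes under \<open>a \<otimes> b \<mapsto> a \<rho>(b)\<close> for all \<open>\<rho> \<noteq> \<sigma>\<close>, but
  not for \<open>\<rho> = \<sigma>\<close>, acts on \<open>A\<close> by \<open>z \<mapsto> a z b\<close> as a projection onto \<open>A\<^sub>\<sigma>\<close>. As \<open>A\<close> is
  central simple, this projection followed by right multiplication by a nonzero element is not
  zero. So \<open>A\<^sub>\<sigma>\<close> contains a unit \<open>x\<^sub>\<sigma>\<close> (Skolem--Noether), and counting dimensions \<open>A\<close> is the
  direct sum of the \<open>M x\<^sub>\<sigma>\<close>.

  The algebra \<open>A\<^sub>i\<close> is the centralizer of the fixed field of \<open>G\<^sub>i\<close>, which is the sum of the
  \<open>M x\<^sub>\<sigma>\<close> with \<open>\<sigma> \<in> G\<^sub>i\<close>. For \<open>\<sigma> = \<sigma>\<^sub>i\<^sub>+\<^sub>1\<close> take \<open>\<tau>\<^sub>i\<close> to be conjugation by \<open>x = x\<^sub>\<sigma>\<close> and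
  \<open>c\<^sub>i = x\<^sup>q\<close>. The powers \<open>1, x, \<dots>, x\<^sup>q\<^sup>-\<^sup>1\<close> form a basis of \<open>A\<^sub>i\<^sub>+\<^sub>1\<close> over \<open>A\<^sub>i\<close>, so that
  evaluation at \<open>t = x\<close> is the required isomorphism.
\<close>

section \<open>Finite sums\<close>

text \<open>The dimension count needs the equality of [M:F] with the order of the group, and the
  treatment of A_i needs that an automorphism trivial on the fixed field of a subgroup H belongs to
  H. Both are drawn from A itself: the eigenspaces provide a left M-space in which two bases, one
  indexed by H and one by a basis of M over the fixed field of H, can be compared. Hence the
  existence of nonzero eigenvectors comes before any statement on degrees, and their invertibility
  only after it.

  Tensors in M \<otimes> M are never formed. A tensor is given by its coefficients against a basis
  of the second factor over a fixed field; two tensors coincide as soon as they agree under every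
  automorphism, which is Artin's independence argument.

  Uniqueness of the coefficients in powers of x is a second use of eigenvectors, now over the fixed
  field of G_i instead of M: its elements commute with A_i, and the powers of \<sigma> below q
  remain distinct on it.\<close>

lemma hom_finsum_ring:
  assumes "ring R" "ring S" "h \<in> ring_hom R S" "finite I" "f \<in> I \<rightarrow> carrier R"
  shows "h (finsum R f I) = finsum S (\<lambda>i. h (f i)) I"
proof -
  interpret R: ring R by fact
  interpret S: ring S by fact
  have [simp]: "h x \<in> carrier S" if "x \<in> carrier R" for x
    using ring_hom_closed[OF assms(3)] that .
  show ?thesis using assms(4,5)
  proof (induction I)
    case empty
    then show ?case using ring_hom_zero[OF assms(3,1,2)] by simp
  next
    case (insert i I)
    have "f \<in> I \<rightarrow> carrier R" "f i \<in> carrier R" "(\<lambda>i. h (f i)) \<in> I \<rightarrow> carrier S"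
      using insert.prems by (auto simp: Pi_iff)
    then show ?case
      using insert by (simp add: ring_hom_add[OF assms(3)])
  qed
qed

lemma (in ring) finsum_subring:
  assumes "subring B R" "finite I" "f \<in> I \<rightarrow> B"
  shows "finsum (R\<lparr>carrier := B\<rparr>) f I = finsum R f I"
proof -
  have "(\<lambda>x. x) \<in> ring_hom (R\<lparr>carrier := B\<rparr>) R"
    using subringE(1)[OF assms(1)] by (auto simp: ring_hom_def)
  from hom_finsum_ring[OF subring_is_ring[OF assms(1)] ring_axioms this assms(2)] assms(3)
  show ?thesis by simp
qed

context ring
begin

lemma finsum_in_additive:
  assumes "V \<subseteq> carrier R" "\<zero> \<in> V" "\<And>v w. v \<in> V \<Longrightarrow> w \<in> V \<Longrightarrow> v \<oplus> w \<in> V"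
    and "\<And>i. i \<in> I \<Longrightarrow> f i \<in> V"
  shows "finsum R f I \<in> V"
proof (cases "finite I")
  case True
  then show ?thesis using assms(4)
  proof (induction I)
    case (insert i I)
    moreover have "f \<in> I \<rightarrow> carrier R" "f i \<in> carrier R" using insert.prems assms(1) by auto
    ultimately show ?case using assms(3)[of "f i" "finsum R f I"] by simp
  qed (simp add: assms(2))
qed (simp add: assms(2) finsum_infinite)

lemma finsum_swap:
  assumes "finite I" "finite J" "\<And>i j. i \<in> I \<Longrightarrow> j \<in> J \<Longrightarrow> f i j \<in> carrier R"
  shows "(\<Oplus>i\<in>I. \<Oplus>j\<in>J. f i j) = (\<Oplus>j\<in>J. \<Oplus>i\<in>I. f i j)"
  using assms(1,3)
proof (induction I)
  case empty
  then show ?case by simp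
next
  case (insert i I)
  have "(\<Oplus>j\<in>J. \<Oplus>i\<in>insert i I. f i j) = (\<Oplus>j\<in>J. f i j \<oplus> (\<Oplus>i\<in>I. f i j))"
    using insert by (intro finsum_cong') (auto intro!: finsum_insert)
  also have "\<dots> = (\<Oplus>j\<in>J. f i j) \<oplus> (\<Oplus>j\<in>J. \<Oplus>i\<in>I. f i j)"
    using insert by (intro finsum_addf) auto
  also have "\<dots> = (\<Oplus>j\<in>J. f i j) \<oplus> (\<Oplus>i\<in>I. \<Oplus>j\<in>J. f i j)"
    using insert by simp
  also have "\<dots> = (\<Oplus>i\<in>insert i I. \<Oplus>j\<in>J. f i j)"
    using insert by (intro finsum_insert[symmetric]) auto
  finally show ?case by simp
qed

text \<open>Associativity of the twisted product and multiplicativity of evaluation both reduce to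
  this exchange of diagonals for rows. The induction adds one diagonal, which meets every row in a
  single term.\<close>

lemma finsum_triangle:
  assumes "\<And>i j. f i j \<in> carrier R"
  shows "(\<Oplus>n\<in>{..(k::nat)}. \<Oplus>i\<in>{..n}. f i (n - i)) = (\<Oplus>i\<in>{..k}. \<Oplus>j\<in>{..k - i}. f i j)"
proof (induction k)
  case 0
  then show ?case using assms by simp
next
  case (Suc k)
  have "(\<Oplus>i\<in>{..Suc k}. \<Oplus>j\<in>{..Suc k - i}. f i j)
      = (\<Oplus>j\<in>{..Suc k - Suc k}. f (Suc k) j) \<oplus> (\<Oplus>i\<in>{..k}. \<Oplus>j\<in>{..Suc k - i}. f i j)"
    using assms by (subst finsum_Suc) auto
  also have "(\<Oplus>i\<in>{..k}. \<Oplus>j\<in>{..Suc k - i}. f i j)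
      = (\<Oplus>i\<in>{..k}. f i (Suc k - i) \<oplus> (\<Oplus>j\<in>{..k - i}. f i j))"
    using assms by (intro finsum_cong') (auto simp: Suc_diff_le)
  also have "\<dots> = (\<Oplus>i\<in>{..k}. f i (Suc k - i)) \<oplus> (\<Oplus>i\<in>{..k}. \<Oplus>j\<in>{..k - i}. f i j)"
    using assms by (intro finsum_addf) auto
  finally show ?case using assms Suc by (simp add: a_ac)
qed

lemma finsum_minus:
  assumes "f \<in> I \<rightarrow> carrier R" "g \<in> I \<rightarrow> carrier R"
  shows "(\<Oplus>i\<in>I. f i \<ominus> g i) = (\<Oplus>i\<in>I. f i) \<ominus> (\<Oplus>i\<in>I. g i)"
proof -
  have g: "(\<lambda>i. \<ominus> g i) \<in> I \<rightarrow> carrier R" using assms by auto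
  have "(\<Oplus>i\<in>I. \<ominus> g i) = \<ominus> (\<Oplus>i\<in>I. g i)"
    using assms g finsum_addf[OF assms(2) g] by (intro minus_equality[symmetric])
      (auto simp: Pi_iff l_neg cong: finsum_cong' intro!: add.finprod_one_eqI
        trans[OF finsum_addf[symmetric]])
  then show ?thesis using finsum_addf[OF assms(1) g] by (simp add: a_minus_def)
qed

lemma finsum_insert_zero:
  assumes "finite I" "j \<notin> I" "f j = \<zero>" "\<And>i. i \<in> I \<Longrightarrow> f i \<in> carrier R"
  shows "finsum R f (insert j I) = finsum R f I"
  using assms by (subst finsum_insert) auto

lemma finsum_eq_single:
  assumes "finite I" "i \<in> I" "f i \<in> carrier R" "\<And>j. j \<in> I \<Longrightarrow> j \<noteq> i \<Longrightarrow> f j = \<zero>"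
  shows "finsum R f I = f i"
proof -
  have "finsum R f I = (\<Oplus>j\<in>I. if i = j then f j else \<zero>)"
    using assms by (intro finsum_cong') auto
  also have "\<dots> = f i" using assms by (intro finsum_singleton) (auto, metis zero_closed)
  finally show ?thesis .
qed

section \<open>Linearly independent families\<close>

text \<open>Families over an index set replace lists because the basis of interest is indexed by the
  Galois group. In \<open>lin_span\<close> the coefficients may be noncommutative: it is later used
  over a centralizer.\<close>

definition lin_indep :: "'a set \<Rightarrow> 'i set \<Rightarrow> ('i \<Rightarrow> 'a) \<Rightarrow> bool"
  where "lin_indep K I b \<longleftrightarrow>
    (\<forall>k \<in> I \<rightarrow> K. (\<Oplus>i\<in>I. k i \<otimes> b i) = \<zero> \<longrightarrow> (\<forall>i\<in>I. k i = \<zero>))"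

definition lin_span :: "'a set \<Rightarrow> 'i set \<Rightarrow> ('i \<Rightarrow> 'a) \<Rightarrow> 'a set"
  where "lin_span K I b = {\<Oplus>i\<in>I. k i \<otimes> b i | k. k \<in> I \<rightarrow> K}"

lemma lin_indepD:
  assumes "lin_indep K I b" "\<And>i. i \<in> I \<Longrightarrow> k i \<in> K" "(\<Oplus>i\<in>I. k i \<otimes> b i) = \<zero>" "i \<in> I"
  shows "k i = \<zero>"
  using assms unfolding lin_indep_def by blast

lemma combine_map_eq_finsum:
  assumes "distinct xs" "b \<in> set xs \<rightarrow> carrier R" "k \<in> set xs \<rightarrow> carrier R"
  shows "combine (map k xs) (map b xs) = (\<Oplus>i\<in>set xs. k i \<otimes> b i)"
  using assms
proof (induction xs)
  case (Cons x xs)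
  then have "(\<lambda>i. k i \<otimes> b i) \<in> set xs \<rightarrow> carrier R" by auto
  with Cons show ?case by simp
qed simp

lemma ex_map_eq:
  assumes "distinct xs" "length ks = length xs"
  shows "\<exists>k. ks = map k xs"
  using assms(2,1)
proof (induction rule: list_induct2)
  case (Cons k ks x xs)
  then obtain g where "ks = map g xs" by auto
  then have "k # ks = map (g(x := k)) (x # xs)" using Cons by auto
  then show ?case by (intro exI[of _ "g(x := k)"])
qed simp

lemma Span_map_eq:
  assumes "subfield K R" "distinct xs" "b \<in> set xs \<rightarrow> carrier R"
  shows "Span K (map b xs) = lin_span K (set xs) b"
proof -
  have K: "K \<subseteq> carrier R" using subfieldE(3)[OF assms(1)] .
  have us: "set (map b xs) \<subseteq> carrier R" using assms(3) by auto
  have "a \<in> Span K (map b xs) \<longleftrightarrow> a \<in> lin_span K (set xs) b" for a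
  proof
    assume "a \<in> Span K (map b xs)"
    then obtain Ks where Ks: "set Ks \<subseteq> K" "length Ks = length xs" "a = combine Ks (map b xs)"
      using Span_mem_iff_length_version[OF assms(1) us] by auto
    then obtain k where "Ks = map k xs" using ex_map_eq[OF assms(2)] by blast
    moreover from this have "k \<in> set xs \<rightarrow> K" "k \<in> set xs \<rightarrow> carrier R" using Ks(1) K by auto
    ultimately show "a \<in> lin_span K (set xs) b"
      unfolding lin_span_def using Ks(3) combine_map_eq_finsum[OF assms(2,3)] by auto
  next
    assume "a \<in> lin_span K (set xs) b"
    then obtain k where k: "k \<in> set xs \<rightarrow> K" "a = (\<Oplus>i\<in>set xs. k i \<otimes> b i)"
      unfolding lin_span_def by blast
    then have "k \<in> set xs \<rightarrow> carrier R" using K by auto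
    then have "a = combine (map k xs) (map b xs)"
      using k assms by (auto intro!: combine_map_eq_finsum[symmetric])
    with k show "a \<in> Span K (map b xs)"
      using Span_mem_iff_length_version[OF assms(1) us] by (auto intro!: exI[of _ "map k xs"])
  qed
  then show ?thesis by blast
qed

lemma independent_map_iff:
  assumes "subfield K R" "distinct xs" "b \<in> set xs \<rightarrow> carrier R"
  shows "independent K (map b xs) \<longleftrightarrow> lin_indep K (set xs) b"
proof
  have K: "K \<subseteq> carrier R" using subfieldE(3)[OF assms(1)] .
  have us: "set (map b xs) \<subseteq> carrier R" using assms(3) by auto
  {
    assume ind: "independent K (map b xs)"
    show "lin_indep K (set xs) b"
      unfolding lin_indep_def
    proof (intro ballI impI)
      fix k i assume k: "k \<in> set xs \<rightarrow> K" "(\<Oplus>i\<in>set xs. k i \<otimes> b i) = \<zero>" and i: "i \<in> set xs"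
      then have "k \<in> set xs \<rightarrow> carrier R" using K by auto
      then have "combine (map k xs) (map b xs) = \<zero>"
        using k assms by (subst combine_map_eq_finsum) auto
      from independent_imp_trivial_combine[OF assms(1) ind _ this] k i
      show "k i = \<zero>" by auto
    qed
  next
    assume ind: "lin_indep K (set xs) b"
    show "independent K (map b xs)"
    proof (rule trivial_combine_imp_independent[OF assms(1) us])
      fix Ks assume Ks: "set Ks \<subseteq> K" "combine Ks (map b xs) = \<zero>"
      \<comment> \<open>\<open>combine\<close> stops at the shorter of its two lists, so the
        coefficients are first cut or padded with zeros to the length of the family.\<close>
      obtain Ks' where Ks': "set (take (length xs) Ks) \<subseteq> set Ks'"
        "set Ks' \<subseteq> set (take (length xs) Ks) \<union> {\<zero>}" "length Ks' = length xs"
        "combine Ks' (map b xs) = \<zero>"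
        using combine_normalize[OF _ us Ks(2)] Ks K by auto
      have sub: "set Ks' \<subseteq> K"
        using Ks'(2) Ks(1) subringE(2)[OF subfieldE(1)[OF assms(1)]]
        set_take_subset[of "length xs" Ks] by auto
      obtain k where k: "Ks' = map k xs" using ex_map_eq[OF assms(2) Ks'(3)] by blast
      then have "(\<Oplus>i\<in>set xs. k i \<otimes> b i) = \<zero>"
        using Ks'(4) sub subset_trans[OF sub K] assms by (subst combine_map_eq_finsum[symmetric]) auto
      then have "k i = \<zero>" if "i \<in> set xs" for i
        using lin_indepD[OF ind _ _ that, of k] sub k by auto
      then show "set (take (length (map b xs)) Ks) \<subseteq> {\<zero>}" using Ks'(1) k by auto
    qed
  }
qed

lemma dimension_imp_basis:
  assumes "subfield K R" "dimension n K E"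
  obtains b :: "nat \<Rightarrow> 'a"
    where "b \<in> {..<n} \<rightarrow> E" "lin_indep K {..<n} b" "E = lin_span K {..<n} b"
proof -
  obtain Vs where Vs: "set Vs \<subseteq> carrier R" "independent K Vs" "length Vs = n" "Span K Vs = E"
    using exists_base[OF assms] by blast
  have eq: "Vs = map ((!) Vs) [0..<n]" using Vs(3) by (metis map_nth)
  have c: "(!) Vs \<in> set [0..<n] \<rightarrow> carrier R" using Vs by auto
  have s: "set [0..<n] = {..<n}" by auto
  show ?thesis
  proof (rule that[of "(!) Vs"])
    show "(!) Vs \<in> {..<n} \<rightarrow> E" using Span_base_incl[OF assms(1) Vs(1)] Vs(3,4) by auto
    show "lin_indep K {..<n} ((!) Vs)"
      using independent_map_iff[OF assms(1) _ c] Vs(2) eq s by simp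
    show "E = lin_span K {..<n} ((!) Vs)"
      using Span_map_eq[OF assms(1) _ c] Vs(4) eq s by simp
  qed
qed

lemma lin_indep_dimension:
  assumes "subfield K R" "finite I" "b \<in> I \<rightarrow> carrier R" "lin_indep K I b"
  shows "dimension (card I) K (lin_span K I b)"
proof -
  obtain xs where xs: "set xs = I" "distinct xs" using finite_distinct_list[OF assms(2)] by blast
  then have "independent K (map b xs)" using independent_map_iff[OF assms(1), of xs b] assms by simp
  from dimension_independent[OF this] show ?thesis
    using Span_map_eq[OF assms(1), of xs b] xs assms distinct_card[of xs] by simp
qed

lemma
  assumes "subfield K R" "finite I" "lin_indep K I b" "dimension n K E" "b \<in> I \<rightarrow> E"
  shows lin_indep_card_le: "card I \<le> n"
    and lin_indep_card_eq: "card I = n \<Longrightarrow> lin_span K I b = E"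
proof -
  have E: "E \<subseteq> carrier R" using space_subgroup_props(1)[OF assms(1,4)] .
  obtain xs where xs: "set xs = I" "distinct xs" using finite_distinct_list[OF assms(2)] by blast
  then have i: "independent K (map b xs)"
    using independent_map_iff[OF assms(1), of xs b] assms E by auto
  have l: "length (map b xs) = card I" using xs distinct_card[of xs] by simp
  have s: "set (map b xs) \<subseteq> E" using xs assms(5) by auto
  show "card I \<le> n" using independent_length_le_dimension[OF assms(1,4) i s] l by simp
  show "lin_span K I b = E" if "card I = n"
    using independent_length_eq_dimension[OF assms(1,4) i s] l that
      Span_map_eq[OF assms(1), of xs b] xs assms(5) E by auto
qed

text \<open>The algebras of the chain are rings on a restricted carrier, whereas dimensions are
  computed in the ambient ring. Spans agree in both, hence so does the independence of a
  basis.\<close>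

lemma dimension_subring:
  assumes "subring B R" "subfield K R" "dimension n K E" "E \<subseteq> B" "K \<subseteq> B"
  shows "ring.dimension (R\<lparr>carrier := B\<rparr>) n K E"
proof -
  interpret B: ring "R\<lparr>carrier := B\<rparr>" by (rule subring_is_ring[OF assms(1)])
  obtain Vs where Vs: "set Vs \<subseteq> carrier R" "independent K Vs" "length Vs = n" "Span K Vs = E"
    using exists_base[OF assms(2,3)] by blast
  have VB: "set Vs \<subseteq> B" using Span_base_incl[OF assms(2) Vs(1)] Vs(4) assms(4) by auto
  have i: "B.independent K Us" if "independent K Us" "set Us \<subseteq> B" for Us
    using that
  proof (induction Us rule: list.induct)
    case (Cons u Us)
    then show ?case
      using independent_backwards[OF Cons.prems(1)] Span_consistent[OF assms(1)]
      by (auto intro!: B.li_Cons)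
  qed simp
  from B.dimension_independent[OF i[OF Vs(2) VB]] Vs show ?thesis
    using Span_consistent[OF assms(1)] by simp
qed

end

section \<open>Twisted polynomials\<close>

locale twisted = ring R for R (structure) +
  fixes \<tau> :: "'a \<Rightarrow> 'a"
  assumes tau_hom: "\<tau> \<in> ring_hom R R"
begin

abbreviation P :: "(nat \<Rightarrow> 'a) ring" where "P \<equiv> twisted_poly R \<tau>"

abbreviation twisted_mult (infixl \<open>\<star>\<close> 70) where "p \<star> q \<equiv> p \<otimes>\<^bsub>P\<^esub> q"

lemma tau_pow_hom: "\<tau> ^^ i \<in> ring_hom R R"
proof (induction i)
  case (Suc i)
  then show ?case using ring_hom_trans[OF Suc tau_hom] by (simp add: comp_def)
qed (simp add: ring_hom_def)

lemma tau_pow [simp]: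
  shows "a \<in> carrier R \<Longrightarrow> (\<tau> ^^ i) a \<in> carrier R"
    and "a \<in> carrier R \<Longrightarrow> b \<in> carrier R \<Longrightarrow> (\<tau> ^^ i) (a \<otimes> b) = (\<tau> ^^ i) a \<otimes> (\<tau> ^^ i) b"
    and "a \<in> carrier R \<Longrightarrow> b \<in> carrier R \<Longrightarrow> (\<tau> ^^ i) (a \<oplus> b) = (\<tau> ^^ i) a \<oplus> (\<tau> ^^ i) b"
    and "(\<tau> ^^ i) \<one> = \<one>"
    and "(\<tau> ^^ i) \<zero> = \<zero>"
  by (fact ring_hom_closed[OF tau_pow_hom] ring_hom_mult[OF tau_pow_hom] ring_hom_add[OF tau_pow_hom]
    ring_hom_one[OF tau_pow_hom] ring_hom_zero[OF tau_pow_hom ring_axioms ring_axioms])+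

lemma tau_pow_finsum:
  assumes "finite I" "f \<in> I \<rightarrow> carrier R"
  shows "(\<tau> ^^ i) (finsum R f I) = (\<Oplus>j\<in>I. (\<tau> ^^ i) (f j))"
  using hom_finsum_ring[OF ring_axioms ring_axioms tau_pow_hom assms] .

lemma P_simps:
  shows "carrier P = up R"
    and "p \<star> q = (\<lambda>n. \<Oplus>i\<in>{..n}. p i \<otimes> (\<tau> ^^ i) (q (n - i)))"
    and "\<one>\<^bsub>P\<^esub> = (\<lambda>n. if n = 0 then \<one> else \<zero>)"
    and "\<zero>\<^bsub>P\<^esub> = (\<lambda>n. \<zero>)"
    and "p \<oplus>\<^bsub>P\<^esub> q = (\<lambda>n. p n \<oplus> q n)"
  by (simp_all add: twisted_poly_def)

lemma bound_zero_iff: "bound \<zero> n f \<longleftrightarrow> (\<forall>m>n. f m = \<zero>)"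
  by (auto simp: bound_def)

lemma up_mult_bound:
  assumes "p \<in> up R" "q \<in> up R" "\<forall>i>n. p i = \<zero>" "\<forall>i>m. q i = \<zero>" "n + m < k"
  shows "(p \<star> q) k = \<zero>"
proof -
  have "p i \<otimes> (\<tau> ^^ i) (q (k - i)) = \<zero>" for i
  proof (cases "i > n")
    case False
    then have "k - i > m" using assms(5) by linarith
    then show ?thesis using assms by (simp add: mem_upD)
  qed (use assms in \<open>simp add: mem_upD\<close>)
  then show ?thesis by (simp add: P_simps)
qed

lemma up_mult: 
  assumes "p \<in> up R" "q \<in> up R" shows "p \<star> q \<in> up R"
proof
  show "(p \<star> q) n \<in> carrier R" for n
    using assms by (auto simp: P_simps mem_upD intro!: finsum_closed)
  obtain n where n: "\<forall>i>n. p i = \<zero>"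
    using bound_upD[OF assms(1)] unfolding bound_zero_iff by (elim exE)
  obtain m where m: "\<forall>i>m. q i = \<zero>"
    using bound_upD[OF assms(2)] unfolding bound_zero_iff by (elim exE)
  have "bound \<zero> (n + m) (p \<star> q)"
    unfolding bound_zero_iff using up_mult_bound[OF assms n m] by simp
  then show "\<exists>k. bound \<zero> k (p \<star> q)" by (rule exI)
qed

text \<open>Both bracketings have as n-th coefficient the sum of p_i \<tau>^i(q_j) \<tau>^(i+j)(r_l)
  over i + j + l = n; they meet because \<tau>^i respects sums and products of the inner
  coefficients.\<close>

lemma twisted_mult_assoc:
  assumes p: "p \<in> up R" and q: "q \<in> up R" and r: "r \<in> up R"
  shows "(p \<star> q) \<star> r = p \<star> (q \<star> r)"
proof
  fix n
  have [simp]: "p i \<in> carrier R" "q i \<in> carrier R" "r i \<in> carrier R" for i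
    using p q r by auto
  let ?f = "\<lambda>i j. p i \<otimes> ((\<tau> ^^ i) (q j) \<otimes> (\<tau> ^^ (i + j)) (r (n - (i + j))))"
  have "((p \<star> q) \<star> r) n = (\<Oplus>k\<in>{..n}. \<Oplus>i\<in>{..k}. ?f i (k - i))"
    unfolding P_simps
    by (intro finsum_cong') (auto simp: finsum_ldistr m_assoc intro!: finsum_cong')
  also have "\<dots> = (\<Oplus>i\<in>{..n}. \<Oplus>j\<in>{..n - i}. ?f i j)"
    by (intro finsum_triangle) auto
  also have "\<dots> = (\<Oplus>i\<in>{..n}. p i \<otimes> (\<tau> ^^ i) (\<Oplus>j\<in>{..n - i}. q j \<otimes> (\<tau> ^^ j) (r (n - i - j))))"
    by (intro finsum_cong')
      (auto simp: tau_pow_finsum finsum_rdistr funpow_add intro!: finsum_cong')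
  finally show "((p \<star> q) \<star> r) n = (p \<star> (q \<star> r)) n"
    by (simp add: P_simps)
qed

lemma twisted_poly_ring: "ring P"
proof (rule ringI)
  show "abelian_group P"
  proof (rule abelian_groupI)
    fix p assume p: "p \<in> carrier P"
    then show "\<exists>q\<in>carrier P. q \<oplus>\<^bsub>P\<^esub> p = \<zero>\<^bsub>P\<^esub>"
      using up_a_inv_closed[of p] by (auto simp: P_simps mem_upD l_neg intro!: bexI[of _ "\<lambda>i. \<ominus> p i"])
  qed (auto simp: P_simps fun_eq_iff mem_upD a_ac intro: up_add_closed)
  show "Group.monoid P"
  proof (rule monoidI)
    fix p assume p: "p \<in> carrier P"
    show "\<one>\<^bsub>P\<^esub> \<star> p = p"
    proof
      fix n
      have "(\<one>\<^bsub>P\<^esub> \<star> p) n = (\<Oplus>i\<in>{..n}. (if i = 0 then \<one> else \<zero>) \<otimes> (\<tau> ^^ i) (p (n - i)))"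
        by (simp add: P_simps)
      also have "\<dots> = \<one> \<otimes> (\<tau> ^^ 0) (p (n - 0))"
        using p by (subst finsum_eq_single[of _ 0]) (auto simp: P_simps mem_upD)
      finally show "(\<one>\<^bsub>P\<^esub> \<star> p) n = p n" using p by (simp add: P_simps mem_upD)
    qed
    show "p \<star> \<one>\<^bsub>P\<^esub> = p"
    proof
      fix n
      have "(p \<star> \<one>\<^bsub>P\<^esub>) n = (\<Oplus>i\<in>{..n}. p i \<otimes> (\<tau> ^^ i) (if n - i = 0 then \<one> else \<zero>))"
        by (simp add: P_simps)
      also have "\<dots> = p n \<otimes> (\<tau> ^^ n) \<one>"
        using p by (subst finsum_eq_single[of _ n]) (auto simp: P_simps mem_upD)
      finally show "(p \<star> \<one>\<^bsub>P\<^esub>) n = p n" using p by (simp add: P_simps mem_upD)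
    qed
  qed (use twisted_mult_assoc up_mult up_one_closed in \<open>auto simp: P_simps\<close>)
next
  fix p q r assume *: "p \<in> carrier P" "q \<in> carrier P" "r \<in> carrier P"
  have [simp]: "p i \<in> carrier R" "q i \<in> carrier R" "r i \<in> carrier R" for i
    using * by (auto simp: P_simps)
  show "(p \<oplus>\<^bsub>P\<^esub> q) \<star> r = p \<star> r \<oplus>\<^bsub>P\<^esub> q \<star> r"
    by (auto simp: P_simps l_distr fun_eq_iff)
  show "r \<star> (p \<oplus>\<^bsub>P\<^esub> q) = r \<star> p \<oplus>\<^bsub>P\<^esub> r \<star> q"
    by (auto simp: P_simps r_distr fun_eq_iff)
qed

lemma twisted_a_inv:
  assumes "p \<in> up R" shows "\<ominus>\<^bsub>P\<^esub> p = (\<lambda>n. \<ominus> p n)"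
proof -
  interpret P: ring P by (rule twisted_poly_ring)
  show ?thesis using assms up_a_inv_closed[OF assms]
    by (intro P.minus_equality) (auto simp: P_simps mem_upD l_neg)
qed

text \<open>The monomial a t^k; \<open>tp_const\<close> and the powers of \<open>tp_var\<close> are
  special cases.\<close>

definition mon :: "'a \<Rightarrow> nat \<Rightarrow> nat \<Rightarrow> 'a" where
  "mon a k = (\<lambda>n. if n = k then a else \<zero>)"

lemma mon_apply: "mon a k n = (if n = k then a else \<zero>)"
  by (simp add: mon_def)

lemma mon_closed: "a \<in> carrier R \<Longrightarrow> mon a k \<in> up R"
  by (rule mem_upI) (auto simp: mon_def bound_zero_iff)

lemma mon_mult:
  assumes "a \<in> carrier R" "p \<in> up R"
  shows "(mon a k \<star> p) n = (if k \<le> n then a \<otimes> (\<tau> ^^ k) (p (n - k)) else \<zero>)"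
proof (cases "k \<le> n")
  case True
  have "(mon a k \<star> p) n = (\<Oplus>i\<in>{..n}. mon a k i \<otimes> (\<tau> ^^ i) (p (n - i)))"
    by (simp add: P_simps)
  also have "\<dots> = mon a k k \<otimes> (\<tau> ^^ k) (p (n - k))"
    using True assms by (subst finsum_eq_single[of _ k]) (auto simp: mem_upD mon_def)
  finally show ?thesis using True by (simp add: mon_def)
next
  case False
  then have "mon a k i \<otimes> (\<tau> ^^ i) (p (n - i)) = \<zero>" if "i \<le> n" for i
    using that assms by (auto simp: mon_def mem_upD)
  then show ?thesis using False by (auto simp: P_simps intro!: add.finprod_one_eqI)
qed

lemma tp_var_pow: "tp_var R [^]\<^bsub>P\<^esub> m = mon \<one> m"
proof -
  interpret P: ring P by (rule twisted_poly_ring)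
  show ?thesis
  proof (induction m)
    case 0
    then show ?case by (simp add: P_simps mon_def)
  next
    case (Suc m)
    have v: "tp_var R = mon \<one> 1" by (simp add: tp_var_def mon_def)
    have "tp_var R [^]\<^bsub>P\<^esub> Suc m = mon \<one> m \<star> mon \<one> 1" using Suc v by simp
    also have "\<dots> = mon \<one> (Suc m)"
      by (auto simp: mon_mult mon_closed fun_eq_iff mon_apply)
    finally show ?case .
  qed
qed

lemma tp_const_eq: "tp_const R a = mon a 0"
  by (simp add: tp_const_def mon_def)

lemma tp_binomial_eq:
  assumes "d \<in> carrier R" "0 < m"
  shows "tp_binomial R \<tau> m d = (\<lambda>n. if n = m then \<one> else if n = 0 then \<ominus> d else \<zero>)"
  using assms
  by (auto simp: tp_binomial_def a_minus_def tp_var_pow tp_const_eq twisted_a_inv mon_closed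
      P_simps(5) mon_apply fun_eq_iff)

text \<open>\<open>deg\<close> depends only on the coefficient function, so the degree of
  commutative polynomials serves for twisted ones. The coefficient
  \<open>\<one> \<noteq> \<zero>\<close> makes m the least bound.\<close>

lemma deg_monic:
  assumes "f \<in> up R" "f m = \<one>" "\<forall>n>m. f n = \<zero>" "\<one> \<noteq> \<zero>"
  shows "deg R f = m"
proof -
  have "deg R f = (LEAST n. bound \<zero> n f)" using assms(1) by (simp add: deg_def UP_def)
  also have "\<dots> = m"
    using assms by (intro Least_equality) (auto simp: bound_zero_iff not_less[symmetric])
  finally show ?thesis .
qed

text \<open>Multiplying f on the left by g_N t^(N-m) gives the leading coefficient g_N
  \<tau>^(N-m)(1) = g_N, so a monic f divides on the right without any inverse of \<tau>. The
  induction is on a number N from which on all coefficients of g vanish.\<close>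

lemma twisted_division:
  assumes f: "f \<in> up R" "f m = \<one>" "\<forall>n>m. f n = \<zero>" "0 < m" and g: "g \<in> up R"
  shows "\<exists>q\<in>up R. \<exists>r\<in>up R. (\<forall>n\<ge>m. r n = \<zero>) \<and> g = (q \<star> f) \<oplus>\<^bsub>P\<^esub> r"
proof -
  interpret P: ring P by (rule twisted_poly_ring)
  have triv: "\<exists>q\<in>up R. \<exists>r\<in>up R. (\<forall>n\<ge>m. r n = \<zero>) \<and> g = (q \<star> f) \<oplus>\<^bsub>P\<^esub> r"
    if g: "g \<in> up R" "\<forall>n\<ge>m. g n = \<zero>" for g
  proof (intro bexI conjI)
    show "g = (\<zero>\<^bsub>P\<^esub> \<star> f) \<oplus>\<^bsub>P\<^esub> g"
      using f(1) g(1) P.l_null[of f] P.l_zero[of g] by (simp add: P_simps(1))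
    show "\<zero>\<^bsub>P\<^esub> \<in> up R" using P.zero_closed by (simp add: P_simps(1))
  qed (use g in auto)
  have "\<exists>q\<in>up R. \<exists>r\<in>up R. (\<forall>n\<ge>m. r n = \<zero>) \<and> g = (q \<star> f) \<oplus>\<^bsub>P\<^esub> r"
    if "g \<in> up R" "\<forall>n\<ge>N. g n = \<zero>" for N g
    using that
  proof (induction N arbitrary: g)
    case 0
    then show ?case using triv[of g] by blast
  next
    case (Suc N)
    show ?case
    proof (cases "N < m")
      case True
      then have "\<forall>n\<ge>m. g n = \<zero>" using Suc.prems by auto
      then show ?thesis using triv Suc.prems(1) by blast
    next
      case False
      define u where "u = mon (g N) (N - m)"
      define g' where "g' = g \<ominus>\<^bsub>P\<^esub> (u \<star> f)"
      have gN: "g N \<in> carrier R" using Suc.prems by auto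
      have u: "u \<in> up R" "u \<star> f \<in> up R" using gN mon_closed f up_mult by (auto simp: u_def)
      have g': "g' \<in> up R" using P.minus_closed u Suc.prems by (simp add: g'_def P_simps(1))
      have g'n: "g' n = g n \<ominus> (u \<star> f) n" for n
        using u by (simp add: g'_def a_minus_def twisted_a_inv P_simps(5))
      have "g' n = \<zero>" if "n \<ge> N" for n
      proof (cases "n = N")
        case True
        then have "(u \<star> f) n = g N"
          using False gN f by (simp add: u_def mon_mult)
        then show ?thesis using g'n gN True by (simp add: r_neg a_minus_def)
      next
        case ne: False
        then have "n > N" using that by simp
        then have "f (n - (N - m)) = \<zero>" using f(3) False by auto
        then have "(u \<star> f) n = \<zero>" using gN f(1) by (simp add: u_def mon_mult)
        then show ?thesis using g'n \<open>n > N\<close> Suc.prems(2) by (simp add: a_minus_def)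
      qed
      then obtain q r where qr: "q \<in> up R" "r \<in> up R" "\<forall>n\<ge>m. r n = \<zero>" "g' = (q \<star> f) \<oplus>\<^bsub>P\<^esub> r"
        using Suc.IH[OF g'] by blast
      have "g = (u \<star> f) \<oplus>\<^bsub>P\<^esub> g'"
        using Suc.prems(1) u(2) unfolding g'_def a_minus_def
        by (metis P.a_assoc P.a_comm P.add.inv_closed P.l_neg P.r_zero P_simps(1))
      also have "\<dots> = ((u \<oplus>\<^bsub>P\<^esub> q) \<star> f) \<oplus>\<^bsub>P\<^esub> r"
        using qr u f by (simp add: P.l_distr P.a_assoc P_simps(1) up_mult)
      finally show ?thesis using qr u P.a_closed[of u q] by (auto simp: P_simps(1))
    qed
  qed
  moreover obtain N where "bound \<zero> N g" using g by blast
  \<comment> \<open>\<open>bound\<close> controls the indices above N, the induction those from its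
    bound on; hence the shift to \<open>Suc N\<close>.\<close>
  then have "\<forall>n\<ge>Suc N. g n = \<zero>" by (auto simp: bound_zero_iff)
  ultimately show ?thesis using g by blast
qed

end

subsection \<open>Evaluation\<close>

text \<open>The data of the universal property of the twisted polynomial ring: \<phi> extends to a
  ring homomorphism sending t to x because x satisfies the commutation rule of t.\<close>

locale twisted_eval = twisted R \<tau> + S: ring S for R (structure) and S (structure) and \<tau> +
  fixes \<phi> x
  assumes phi_hom: "\<phi> \<in> ring_hom R S"
    and x_closed [simp]: "x \<in> carrier S"
    and x_comm: "a \<in> carrier R \<Longrightarrow> x \<otimes>\<^bsub>S\<^esub> \<phi> a = \<phi> (\<tau> a) \<otimes>\<^bsub>S\<^esub> x"
begin

lemma phi [simp]:
  shows "a \<in> carrier R \<Longrightarrow> \<phi> a \<in> carrier S"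
    and "a \<in> carrier R \<Longrightarrow> b \<in> carrier R \<Longrightarrow> \<phi> (a \<otimes>\<^bsub>R\<^esub> b) = \<phi> a \<otimes>\<^bsub>S\<^esub> \<phi> b"
    and "a \<in> carrier R \<Longrightarrow> b \<in> carrier R \<Longrightarrow> \<phi> (a \<oplus>\<^bsub>R\<^esub> b) = \<phi> a \<oplus>\<^bsub>S\<^esub> \<phi> b"
    and "\<phi> \<one>\<^bsub>R\<^esub> = \<one>\<^bsub>S\<^esub>"
    and "\<phi> \<zero>\<^bsub>R\<^esub> = \<zero>\<^bsub>S\<^esub>"
  by (fact ring_hom_closed[OF phi_hom] ring_hom_mult[OF phi_hom] ring_hom_add[OF phi_hom]
    ring_hom_one[OF phi_hom] ring_hom_zero[OF phi_hom ring_axioms S.ring_axioms])+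

lemma x_pow_comm:
  assumes "a \<in> carrier R"
  shows "x [^]\<^bsub>S\<^esub> i \<otimes>\<^bsub>S\<^esub> \<phi> a = \<phi> ((\<tau> ^^ i) a) \<otimes>\<^bsub>S\<^esub> x [^]\<^bsub>S\<^esub> (i :: nat)"
  using assms
proof (induction i arbitrary: a)
  case (Suc i)
  have t: "\<tau> a \<in> carrier R" using tau_pow(1)[of a 1] Suc.prems by simp
  have "x [^]\<^bsub>S\<^esub> Suc i \<otimes>\<^bsub>S\<^esub> \<phi> a = x [^]\<^bsub>S\<^esub> i \<otimes>\<^bsub>S\<^esub> \<phi> (\<tau> a) \<otimes>\<^bsub>S\<^esub> x"
    using Suc.prems x_comm[OF Suc.prems] t by (simp add: S.m_assoc)
  also have "\<dots> = \<phi> ((\<tau> ^^ i) (\<tau> a)) \<otimes>\<^bsub>S\<^esub> x [^]\<^bsub>S\<^esub> Suc i"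
    using Suc.IH[OF t] t by (simp add: S.m_assoc)
  finally show ?case by (simp add: funpow_swap1)
qed simp

definition ev :: "(nat \<Rightarrow> 'a) \<Rightarrow> 'c" where
  "ev p = (\<Oplus>\<^bsub>S\<^esub>i\<in>{..deg R p}. \<phi> (p i) \<otimes>\<^bsub>S\<^esub> x [^]\<^bsub>S\<^esub> i)"

text \<open>The degree in the definition of \<open>ev\<close> is only a convenient choice of range.
  Any finite set containing the support will do, so that several polynomials can be evaluated over
  one common range.\<close>

lemma ev_eq:
  assumes "p \<in> up R" "finite I" "\<And>i. i \<notin> I \<Longrightarrow> p i = \<zero>\<^bsub>R\<^esub>"
  shows "ev p = (\<Oplus>\<^bsub>S\<^esub>i\<in>I. \<phi> (p i) \<otimes>\<^bsub>S\<^esub> x [^]\<^bsub>S\<^esub> i)"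
proof -
  have "deg R p = (LEAST n. bound \<zero>\<^bsub>R\<^esub> n p)" using assms(1) by (simp add: deg_def UP_def)
  then have "bound \<zero>\<^bsub>R\<^esub> (deg R p) p" using LeastI_ex[OF bound_upD[OF assms(1)]] by simp
  then have d: "p i = \<zero>\<^bsub>R\<^esub>" if "i > deg R p" for i using that by (rule bound.bound)
  let ?g = "\<lambda>i. \<phi> (p i) \<otimes>\<^bsub>S\<^esub> x [^]\<^bsub>S\<^esub> i"
  have [simp]: "?g i \<in> carrier S" for i using assms(1) by (simp add: mem_upD)
  show ?thesis unfolding ev_def
  proof (rule S.add.finprod_mono_neutral_cong)
    show "?g i = \<zero>\<^bsub>S\<^esub>" if "i \<in> I - {..deg R p}" for i using d that by simp
    show "?g i = \<zero>\<^bsub>S\<^esub>" if "i \<in> {..deg R p} - I" for i using assms(3) that by simp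
  qed (use assms(2) in simp_all)
qed

lemma ev_closed: "p \<in> up R \<Longrightarrow> ev p \<in> carrier S"
  unfolding ev_def by (intro S.finsum_closed) (auto simp: mem_upD)

lemma up_bounded:
  assumes "p \<in> up R"
  obtains N where "\<And>i. i > N \<Longrightarrow> p i = \<zero>\<^bsub>R\<^esub>"
  using bound_upD[OF assms] by (auto simp: bound_zero_iff)

lemma ev_hom: "ev \<in> ring_hom P S"
proof (rule ring_hom_memI)
  show "ev p \<in> carrier S" if "p \<in> carrier P" for p
    using that ev_closed by (simp add: P_simps)
next
  fix p q assume "p \<in> carrier P" "q \<in> carrier P"
  then have pq: "p \<in> up R" "q \<in> up R" by (auto simp: P_simps)
  have [simp]: "p i \<in> carrier R" "q i \<in> carrier R" for i using pq by auto
  obtain n m where n: "\<And>i. i > n \<Longrightarrow> p i = \<zero>\<^bsub>R\<^esub>" and m: "\<And>i. i > m \<Longrightarrow> q i = \<zero>\<^bsub>R\<^esub>"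
    using up_bounded[OF pq(1)] up_bounded[OF pq(2)] by metis
  let ?k = "n + m"
  let ?X = "\<lambda>i. x [^]\<^bsub>S\<^esub> (i :: nat)"
  have ep: "ev p = (\<Oplus>\<^bsub>S\<^esub>i\<in>{..?k}. \<phi> (p i) \<otimes>\<^bsub>S\<^esub> ?X i)" using n by (intro ev_eq pq) auto
  have eq: "ev q = (\<Oplus>\<^bsub>S\<^esub>i\<in>{..?k}. \<phi> (q i) \<otimes>\<^bsub>S\<^esub> ?X i)" using m by (intro ev_eq pq) auto
  have "p \<oplus>\<^bsub>P\<^esub> q \<in> up R" using up_add_closed[OF pq] by (simp add: P_simps)
  then have "ev (p \<oplus>\<^bsub>P\<^esub> q) = (\<Oplus>\<^bsub>S\<^esub>i\<in>{..?k}. \<phi> ((p \<oplus>\<^bsub>P\<^esub> q) i) \<otimes>\<^bsub>S\<^esub> ?X i)"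
    using n m by (intro ev_eq) (auto simp: P_simps)
  also have "\<dots> = (\<Oplus>\<^bsub>S\<^esub>i\<in>{..?k}. \<phi> (p i) \<otimes>\<^bsub>S\<^esub> ?X i \<oplus>\<^bsub>S\<^esub> \<phi> (q i) \<otimes>\<^bsub>S\<^esub> ?X i)"
    by (intro S.finsum_cong') (auto simp: P_simps S.l_distr)
  also have "\<dots> = ev p \<oplus>\<^bsub>S\<^esub> ev q" unfolding ep eq by (intro S.finsum_addf) auto
  finally show "ev (p \<oplus>\<^bsub>P\<^esub> q) = ev p \<oplus>\<^bsub>S\<^esub> ev q" .
  let ?f = "\<lambda>i j. \<phi> (p i) \<otimes>\<^bsub>S\<^esub> (\<phi> ((\<tau> ^^ i) (q j)) \<otimes>\<^bsub>S\<^esub> ?X (i + j))"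
  have "ev (p \<star> q) = (\<Oplus>\<^bsub>S\<^esub>k\<in>{..?k}. \<phi> ((p \<star> q) k) \<otimes>\<^bsub>S\<^esub> ?X k)"
    using up_mult_bound[OF pq, of n m] n m by (intro ev_eq up_mult pq) (auto simp: not_le)
  also have "\<dots> = (\<Oplus>\<^bsub>S\<^esub>k\<in>{..?k}. \<Oplus>\<^bsub>S\<^esub>i\<in>{..k}. ?f i (k - i))"
    unfolding P_simps
    by (intro S.finsum_cong')
      (auto simp: hom_finsum_ring[OF ring_axioms S.ring_axioms phi_hom] S.finsum_ldistr S.m_assoc
        intro!: S.finsum_cong')
  also have "\<dots> = (\<Oplus>\<^bsub>S\<^esub>i\<in>{..?k}. \<Oplus>\<^bsub>S\<^esub>j\<in>{..?k - i}. ?f i j)"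
    by (intro S.finsum_triangle) auto
  \<comment> \<open>Outside the triangle either i > n or j > m, so the added terms vanish; the sum
    over the square then factors.\<close>
  also have "\<dots> = (\<Oplus>\<^bsub>S\<^esub>i\<in>{..?k}. \<Oplus>\<^bsub>S\<^esub>j\<in>{..?k}. ?f i j)"
  proof (rule S.finsum_cong'[OF refl])
    fix i
    have z: "?f i j = \<zero>\<^bsub>S\<^esub>" if "j > ?k - i" for j
    proof (cases "i > n")
      case False
      then have "j > m" using that by linarith
      then show ?thesis using m by simp
    qed (simp add: n)
    show "(\<Oplus>\<^bsub>S\<^esub>j\<in>{..?k - i}. ?f i j) = (\<Oplus>\<^bsub>S\<^esub>j\<in>{..?k}. ?f i j)"
      using z by (intro S.add.finprod_mono_neutral_cong_left) (auto simp: not_le)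
  qed auto
  also have "\<dots> = (\<Oplus>\<^bsub>S\<^esub>i\<in>{..?k}. \<phi> (p i) \<otimes>\<^bsub>S\<^esub> ?X i \<otimes>\<^bsub>S\<^esub> ev q)"
  proof (intro S.finsum_cong' refl)
    fix i
    have "\<phi> (p i) \<otimes>\<^bsub>S\<^esub> ?X i \<otimes>\<^bsub>S\<^esub> (\<phi> (q j) \<otimes>\<^bsub>S\<^esub> ?X j) = ?f i j" for j
    proof -
      have "?X i \<otimes>\<^bsub>S\<^esub> (\<phi> (q j) \<otimes>\<^bsub>S\<^esub> ?X j) = (?X i \<otimes>\<^bsub>S\<^esub> \<phi> (q j)) \<otimes>\<^bsub>S\<^esub> ?X j"
        by (simp add: S.m_assoc)
      also have "\<dots> = \<phi> ((\<tau> ^^ i) (q j)) \<otimes>\<^bsub>S\<^esub> ?X (i + j)"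
        by (simp add: x_pow_comm S.m_assoc S.nat_pow_mult)
      finally show ?thesis by (simp add: S.m_assoc)
    qed
    then show "(\<Oplus>\<^bsub>S\<^esub>j\<in>{..?k}. ?f i j) = \<phi> (p i) \<otimes>\<^bsub>S\<^esub> ?X i \<otimes>\<^bsub>S\<^esub> ev q"
      unfolding eq by (subst S.finsum_rdistr) auto
  qed (auto simp: ev_closed pq)
  also have "\<dots> = ev p \<otimes>\<^bsub>S\<^esub> ev q"
    unfolding ep using ev_closed[OF pq(2)] by (intro S.finsum_ldistr[symmetric]) auto
  finally show "ev (p \<star> q) = ev p \<otimes>\<^bsub>S\<^esub> ev q" .
next
  have "ev \<one>\<^bsub>P\<^esub> = (\<Oplus>\<^bsub>S\<^esub>i\<in>{0}. \<phi> (\<one>\<^bsub>P\<^esub> i) \<otimes>\<^bsub>S\<^esub> x [^]\<^bsub>S\<^esub> i)"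
    using up_one_closed by (intro ev_eq) (auto simp: P_simps)
  then show "ev \<one>\<^bsub>P\<^esub> = \<one>\<^bsub>S\<^esub>" by (simp add: P_simps)
qed

lemma ev_const:
  assumes "a \<in> carrier R" shows "ev (tp_const R a) = \<phi> a"
proof -
  have "ev (tp_const R a) = (\<Oplus>\<^bsub>S\<^esub>i\<in>{0}. \<phi> (tp_const R a i) \<otimes>\<^bsub>S\<^esub> x [^]\<^bsub>S\<^esub> i)"
    using mon_closed[OF assms, of 0] by (intro ev_eq) (auto simp: tp_const_def mon_def)
  then show ?thesis using assms by (simp add: tp_const_def)
qed

text \<open>Since \<open>ev\<close> kills \<open>f\<close> and is injective on reduced polynomials, it determines remainders,
  and the left ideal generated by \<open>f\<close> is its kernel.\<close>

context
  fixes f m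
  assumes f: "f \<in> up R" "f m = \<one>\<^bsub>R\<^esub>" "\<forall>n>m. f n = \<zero>\<^bsub>R\<^esub>" "0 < m" "\<one>\<^bsub>R\<^esub> \<noteq> \<zero>\<^bsub>R\<^esub>"
    and ev_f: "ev f = \<zero>\<^bsub>S\<^esub>"
    and ev_bij: "bij_betw ev (tp_reduced R f) (carrier S)"
begin

lemma reduced_iff: "r \<in> tp_reduced R f \<longleftrightarrow> r \<in> up R \<and> (\<forall>n\<ge>m. r n = \<zero>\<^bsub>R\<^esub>)"
  unfolding tp_reduced_def deg_monic[OF f(1-3,5)] by simp

lemma ev_quotient_remainder:
  assumes "q \<in> up R" "r \<in> up R"
  shows "ev ((q \<star> f) \<oplus>\<^bsub>P\<^esub> r) = ev r"
  using assms f ev_closed up_mult ev_f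
  by (simp add: ring_hom_add[OF ev_hom] ring_hom_mult[OF ev_hom] P_simps(1))

lemma tp_rem_eqI:
  assumes "g \<in> up R" "r \<in> tp_reduced R f" "ev r = ev g"
  shows "tp_rem R \<tau> f g = r"
  unfolding tp_rem_def
proof (rule the_equality)
  obtain q r' where "q \<in> up R" "r' \<in> up R" "\<forall>n\<ge>m. r' n = \<zero>\<^bsub>R\<^esub>" and g: "g = (q \<star> f) \<oplus>\<^bsub>P\<^esub> r'"
    using twisted_division[OF f(1-4) assms(1)] by blast
  then have *: "q \<in> up R" "r' \<in> tp_reduced R f" by (auto simp: reduced_iff)
  then have "ev r = ev r'" using ev_quotient_remainder[of q r'] assms(3) g reduced_iff by simp
  then have "r = r'" using ev_bij assms(2) * by (auto simp: bij_betw_def inj_on_def)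
  with * g show "r \<in> tp_reduced R f \<and> (\<exists>q\<in>up R. g = (q \<star> f) \<oplus>\<^bsub>P\<^esub> r)" by blast
next
  fix r' assume r': "r' \<in> tp_reduced R f \<and> (\<exists>q\<in>up R. g = (q \<star> f) \<oplus>\<^bsub>P\<^esub> r')"
  then have "ev r' = ev r" using ev_quotient_remainder assms(3) reduced_iff by metis
  then show "r' = r" using ev_bij assms(2) r' by (auto simp: bij_betw_def inj_on_def)
qed

text \<open>Product and unit of the quotient are remainders, and \<open>tp_rem_eqI\<close>
  recognises a remainder by its value under \<open>ev\<close>. So each homomorphism law for the
  inverse of \<open>ev\<close> is checked on values in S.\<close>

lemma inv_ev_ring_iso: "inv_into (tp_reduced R f) ev \<in> ring_iso S (tp_quot R \<tau> f)"
proof -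
  interpret P: ring P by (rule twisted_poly_ring)
  let ?h = "inv_into (tp_reduced R f) ev"
  have h: "?h a \<in> tp_reduced R f" "ev (?h a) = a" "?h a \<in> up R" if "a \<in> carrier S" for a
  proof -
    have a: "a \<in> ev ` tp_reduced R f" using that ev_bij by (simp add: bij_betw_def)
    show "?h a \<in> tp_reduced R f" "ev (?h a) = a"
      using inv_into_into[OF a] f_inv_into_f[OF a] by auto
    then show "?h a \<in> up R" using reduced_iff by simp
  qed
  show ?thesis
  proof (rule ring_iso_memI)
    show "bij_betw ?h (carrier S) (carrier (tp_quot R \<tau> f))"
      using bij_betw_inv_into[OF ev_bij] by (simp add: tp_quot_def)
    show "?h a \<in> carrier (tp_quot R \<tau> f)" if "a \<in> carrier S" for a
      using h that by (simp add: tp_quot_def)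
    show "?h \<one>\<^bsub>S\<^esub> = \<one>\<^bsub>tp_quot R \<tau> f\<^esub>"
      using tp_rem_eqI[of "\<one>\<^bsub>P\<^esub>" "?h \<one>\<^bsub>S\<^esub>"] h[of "\<one>\<^bsub>S\<^esub>"] ring_hom_one[OF ev_hom] P.one_closed
      by (simp add: tp_quot_def P_simps(1))
    fix a b assume ab: "a \<in> carrier S" "b \<in> carrier S"
    have "tp_rem R \<tau> f (?h a \<star> ?h b) = ?h (a \<otimes>\<^bsub>S\<^esub> b)"
      using ab h by (intro tp_rem_eqI) (auto simp: up_mult ring_hom_mult[OF ev_hom] P_simps(1))
    then show "?h (a \<otimes>\<^bsub>S\<^esub> b) = ?h a \<otimes>\<^bsub>tp_quot R \<tau> f\<^esub> ?h b" by (simp add: tp_quot_def)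
    have s: "?h a \<oplus>\<^bsub>P\<^esub> ?h b \<in> up R" using h ab P.a_closed by (simp add: P_simps(1))
    moreover have "(?h a \<oplus>\<^bsub>P\<^esub> ?h b) n = \<zero>\<^bsub>R\<^esub>" if "n \<ge> m" for n
      using h(1)[OF ab(1)] h(1)[OF ab(2)] that by (simp add: reduced_iff P_simps(5))
    ultimately have "?h a \<oplus>\<^bsub>P\<^esub> ?h b \<in> tp_reduced R f" by (simp add: reduced_iff)
    moreover have "ev (?h a \<oplus>\<^bsub>P\<^esub> ?h b) = a \<oplus>\<^bsub>S\<^esub> b"
      using h ab by (simp add: ring_hom_add[OF ev_hom] P_simps(1))
    ultimately have "?h (a \<oplus>\<^bsub>S\<^esub> b) = ?h a \<oplus>\<^bsub>P\<^esub> ?h b"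
      using ev_bij by (metis bij_betw_def inv_into_f_f)
    then show "?h (a \<oplus>\<^bsub>S\<^esub> b) = ?h a \<oplus>\<^bsub>tp_quot R \<tau> f\<^esub> ?h b" by (simp add: tp_quot_def)
  qed
qed

text \<open>Supplies the compatibility of the isomorphism with the embedded base field in the cyclic
  step.\<close>

lemma inv_ev_const:
  assumes "a \<in> carrier R"
  shows "inv_into (tp_reduced R f) ev (\<phi> a) = tp_const R a"
proof -
  have "tp_const R a \<in> tp_reduced R f"
    using mon_closed[OF assms, of 0] f(4) by (auto simp: reduced_iff tp_const_def mon_def)
  then show ?thesis using ev_const[OF assms] ev_bij by (metis bij_betw_def inv_into_f_f)
qed

text \<open>A kernel is two-sided, so invariance follows once f is seen to generate it as a left
  ideal: the remainder of a kernel element is reduced and of value zero, hence zero.\<close>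

lemma tp_invariant_kernel: "tp_invariant R \<tau> f"
proof -
  interpret P: ring P by (rule twisted_poly_ring)
  interpret ev: ring_hom_ring P S ev
    using ev_hom by (intro ring_hom_ringI2 P.ring_axioms S.ring_axioms)
  have "{g \<star> f | g. g \<in> up R} = a_kernel P S ev"
  proof (intro equalityI subsetI)
    fix p assume "p \<in> {g \<star> f | g. g \<in> up R}"
    then obtain g where g: "g \<in> up R" "p = g \<star> f" by blast
    then have "ev p = \<zero>\<^bsub>S\<^esub>"
      using f(1) ev_f ev_closed by (simp add: P_simps(1) ring_hom_mult[OF ev_hom])
    moreover have "p \<in> up R" unfolding g(2) by (rule up_mult[OF g(1) f(1)])
    ultimately show "p \<in> a_kernel P S ev" unfolding a_kernel_def' P_simps(1) by blast
  next
    fix p assume "p \<in> a_kernel P S ev"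
    then have p: "p \<in> up R" "ev p = \<zero>\<^bsub>S\<^esub>" unfolding a_kernel_def' P_simps(1) by blast+
    obtain q r where qr: "q \<in> up R" "r \<in> up R" "\<forall>n\<ge>m. r n = \<zero>\<^bsub>R\<^esub>" "p = (q \<star> f) \<oplus>\<^bsub>P\<^esub> r"
      using twisted_division[OF f(1-4) p(1)] by blast
    have z: "\<zero>\<^bsub>P\<^esub> \<in> tp_reduced R f" "ev \<zero>\<^bsub>P\<^esub> = \<zero>\<^bsub>S\<^esub>"
    proof -
      have "\<zero>\<^bsub>P\<^esub> \<in> up R" using P.zero_closed unfolding P_simps(1) .
      then show "\<zero>\<^bsub>P\<^esub> \<in> tp_reduced R f" unfolding reduced_iff P_simps(4) by simp
    qed (rule ev.hom_zero)
    have "ev r = ev \<zero>\<^bsub>P\<^esub>"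
      unfolding ev_quotient_remainder[OF qr(1,2), symmetric] qr(4)[symmetric] p(2) z(2) ..
    moreover have "r \<in> tp_reduced R f" using qr(2,3) reduced_iff by simp
    ultimately have r: "r = \<zero>\<^bsub>P\<^esub>"
      using z(1) by (rule inj_onD[OF bij_betw_imp_inj_on[OF ev_bij]])
    have "q \<star> f \<in> carrier P" unfolding P_simps(1) by (rule up_mult[OF qr(1) f(1)])
    from P.r_zero[OF this] have "p = q \<star> f" unfolding qr(4) r .
    then show "p \<in> {g \<star> f | g. g \<in> up R}" using qr(1) by blast
  qed
  then show ?thesis unfolding tp_invariant_def using ev.kernel_is_ideal by simp
qed

end

end

section \<open>Density and independence of eigenvectors\<close>

context ring
begin

lemma subring_add_subgroup: "subring K R \<Longrightarrow> subgroup K (add_monoid R)"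
  by (simp add: subring.axioms(1))

lemma subring_finsum_closed:
  "subring K R \<Longrightarrow> (\<And>i. i \<in> I \<Longrightarrow> f i \<in> K) \<Longrightarrow> finsum R f I \<in> K"
  using finsum_in_additive[OF subringE(1,2,7)] by blast

text \<open>Stated for additive maps because projections and left multiplications are not ring
  homomorphisms; \<open>\<theta> \<zero> = \<zero>\<close> follows by cancelling in \<open>\<theta>
  \<zero> = \<theta> \<zero> \<oplus> \<theta> \<zero>\<close>.\<close>

lemma additive_finsum:
  assumes "subring K R" "finite I" "f \<in> I \<rightarrow> K"
    and "\<And>x. x \<in> K \<Longrightarrow> \<theta> x \<in> carrier R"
    and "\<And>x y. x \<in> K \<Longrightarrow> y \<in> K \<Longrightarrow> \<theta> (x \<oplus> y) = \<theta> x \<oplus> \<theta> y"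
  shows "\<theta> (finsum R f I) = (\<Oplus>i\<in>I. \<theta> (f i))"
  using assms(2,3)
proof (induction I)
  case empty
  have z: "\<zero> \<in> K" using subringE(2)[OF assms(1)] .
  then have "\<theta> \<zero> = \<theta> \<zero> \<oplus> \<theta> \<zero>" using assms(5)[of \<zero> \<zero>] by simp
  then have "\<theta> \<zero> = \<zero>" using assms(4)[OF z] by (metis add.r_cancel_one')
  then show ?case by simp
next
  case (insert i I)
  have K: "K \<subseteq> carrier R" using subringE(1)[OF assms(1)] .
  have f: "f i \<in> K" "f \<in> I \<rightarrow> K" using insert.prems by auto
  then have c: "f i \<in> carrier R" "f \<in> I \<rightarrow> carrier R" "(\<lambda>i. \<theta> (f i)) \<in> I \<rightarrow> carrier R"
    using K assms(4) by (auto simp: Pi_iff)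
  have "finsum R f I \<in> K" using f(2) by (intro subring_finsum_closed[OF assms(1)]) auto
  then show ?case using insert f c assms(4,5) by simp
qed

lemma lin_indep_subset:
  assumes "lin_indep K I b" "J \<subseteq> I" "finite I" "\<zero> \<in> K" "K \<subseteq> carrier R" "b \<in> I \<rightarrow> carrier R"
  shows "lin_indep K J b"
  unfolding lin_indep_def
proof (intro ballI impI)
  fix k j assume k: "k \<in> J \<rightarrow> K" "(\<Oplus>i\<in>J. k i \<otimes> b i) = \<zero>" and j: "j \<in> J"
  let ?k = "\<lambda>i. if i \<in> J then k i else \<zero>"
  have c: "?k i \<otimes> b i \<in> carrier R" if "i \<in> I" for i
    using that k(1) assms(5,6) by (auto simp: Pi_iff subset_iff)
  have "(\<Oplus>i\<in>I. ?k i \<otimes> b i) = (\<Oplus>i\<in>J. k i \<otimes> b i)"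
    using assms(2,3,6) c by (intro add.finprod_mono_neutral_cong_right) (auto simp: Pi_iff)
  then have "?k j = \<zero>"
    using k j assms(2,4) by (intro lin_indepD[OF assms(1), of ?k j]) auto
  then show "k j = \<zero>" using j by simp
qed

text \<open>The possible values of a single coefficient \<open>a j\<close> form a two-sided ideal. If it is everything,
  normalise \<open>a j = 1\<close>; commutators with \<open>y\<close> then kill that coefficient, so all \<open>a i\<close> are
  central and \<open>z = 1\<close> contradicts independence.\<close>

lemma central_simple_density:
  assumes simple: "simple_ring R" and Z: "center R = Z"
    and fin: "finite I" and b: "b \<in> I \<rightarrow> carrier R" and indep: "lin_indep Z I b"
    and a: "a \<in> I \<rightarrow> carrier R" and zero: "\<And>z. z \<in> carrier R \<Longrightarrow> (\<Oplus>i\<in>I. a i \<otimes> (z \<otimes> b i)) = \<zero>"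
    and i: "i \<in> I"
  shows "a i = \<zero>"
proof -
  have Zc: "Z \<subseteq> carrier R" "\<zero> \<in> Z" using Z by (auto simp: center_def)
  have "\<forall>i\<in>I. a i = \<zero>"
    using fin b indep a zero
  proof (induction I arbitrary: a)
    case empty
    then show ?case by simp
  next
    case (insert j I)
    let ?J = "insert j I"
    have b: "b i \<in> carrier R" if "i \<in> ?J" for i using insert.prems(1) that by auto
    have indI: "lin_indep Z I b"
      by (rule lin_indep_subset[OF insert.prems(2) _ _ Zc(2,1) insert.prems(1)])
        (simp_all add: insert.hyps subset_insertI)
    define s where "s c z = (\<Oplus>i\<in>?J. c i \<otimes> (z \<otimes> b i))" for c z
    have s_cl: "s c z \<in> carrier R" if "c \<in> ?J \<rightarrow> carrier R" "z \<in> carrier R" for c z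
      unfolding s_def using that b by (intro finsum_closed) auto
    have s_l: "s (\<lambda>i. y \<otimes> c i) z = y \<otimes> s c z"
      if "c \<in> ?J \<rightarrow> carrier R" "z \<in> carrier R" "y \<in> carrier R" for c z y
    proof -
      have "s (\<lambda>i. y \<otimes> c i) z = (\<Oplus>i\<in>?J. y \<otimes> (c i \<otimes> (z \<otimes> b i)))"
        unfolding s_def using that b by (intro finsum_cong') (auto simp: m_assoc Pi_iff)
      also have "\<dots> = y \<otimes> s c z"
        unfolding s_def using that b insert.hyps by (intro finsum_rdistr[symmetric]) auto
      finally show ?thesis .
    qed
    \<comment> \<open>Multiplying the coefficients by y on the right amounts to replacing z by y z.
      Since the relation is demanded for every z, this makes \<open>Q\<close> closed under right
      multiplication.\<close>
    have s_r: "s (\<lambda>i. c i \<otimes> y) z = s c (y \<otimes> z)"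
      if "c \<in> ?J \<rightarrow> carrier R" "z \<in> carrier R" "y \<in> carrier R" for c z y
      unfolding s_def using that b by (intro finsum_cong') (auto simp: m_assoc Pi_iff)
    have s_add: "s (\<lambda>i. c i \<oplus> d i) z = s c z \<oplus> s d z"
      if "c \<in> ?J \<rightarrow> carrier R" "d \<in> ?J \<rightarrow> carrier R" "z \<in> carrier R" for c d z
    proof -
      have "s (\<lambda>i. c i \<oplus> d i) z = (\<Oplus>i\<in>?J. c i \<otimes> (z \<otimes> b i) \<oplus> d i \<otimes> (z \<otimes> b i))"
        unfolding s_def using that b by (intro finsum_cong') (auto simp: l_distr Pi_iff)
      then show ?thesis unfolding s_def using that b by (subst (asm) finsum_addf) auto
    qed
    define Q where "Q = {c j | c. c \<in> ?J \<rightarrow> carrier R \<and> (\<forall>z\<in>carrier R. s c z = \<zero>)}"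
    have Q_l: "y \<otimes> q \<in> Q" if q: "q \<in> Q" and y: "y \<in> carrier R" for q y
    proof -
      obtain c where c: "q = c j" "c \<in> ?J \<rightarrow> carrier R" "\<forall>z\<in>carrier R. s c z = \<zero>"
        using q unfolding Q_def by blast
      then show ?thesis unfolding Q_def using y s_l
        by (intro CollectI exI[of _ "\<lambda>i. y \<otimes> c i"]) (auto simp: Pi_iff)
    qed
    have Q_r: "q \<otimes> y \<in> Q" if q: "q \<in> Q" and y: "y \<in> carrier R" for q y
    proof -
      obtain c where c: "q = c j" "c \<in> ?J \<rightarrow> carrier R" "\<forall>z\<in>carrier R. s c z = \<zero>"
        using q unfolding Q_def by blast
      then show ?thesis unfolding Q_def using y s_r
        by (intro CollectI exI[of _ "\<lambda>i. c i \<otimes> y"]) (auto simp: Pi_iff)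
    qed
    have Qc: "Q \<subseteq> carrier R" unfolding Q_def by auto
    have aQ: "a j \<in> Q" unfolding Q_def s_def using insert.prems(3,4) by blast
    have Q: "ideal Q R"
    proof (rule idealI[OF ring_axioms])
      show "subgroup Q (add_monoid R)"
      proof (rule add.subgroupI)
        show "Q \<noteq> {}" using aQ by blast
        show "\<ominus> q \<in> Q" if "q \<in> Q" for q
        proof -
          have "\<ominus> q = (\<ominus> \<one>) \<otimes> q" using that Qc by (auto simp: l_minus)
          then show ?thesis using Q_l[OF that, of "\<ominus> \<one>"] by simp
        qed
        show "q \<oplus> q' \<in> Q" if q: "q \<in> Q" and q': "q' \<in> Q" for q q'
        proof -
          obtain c where c: "q = c j" "c \<in> ?J \<rightarrow> carrier R" "\<forall>z\<in>carrier R. s c z = \<zero>"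
            using q unfolding Q_def by blast
          obtain d where d: "q' = d j" "d \<in> ?J \<rightarrow> carrier R" "\<forall>z\<in>carrier R. s d z = \<zero>"
            using q' unfolding Q_def by blast
          show ?thesis unfolding Q_def using c d s_add[OF c(2) d(2)]
            by (intro CollectI exI[of _ "\<lambda>i. c i \<oplus> d i"]) (auto simp: Pi_iff)
        qed
      qed (use Qc in auto)
    qed (use Q_l Q_r in auto)
    have "\<one> \<notin> Q"
    proof
      assume "\<one> \<in> Q"
      then obtain c where c: "c j = \<one>" "c \<in> ?J \<rightarrow> carrier R" "\<forall>z\<in>carrier R. s c z = \<zero>"
        unfolding Q_def by (auto simp: eq_commute)
      have cc: "c i \<in> carrier R" if "i \<in> ?J" for i using c(2) that by blast
      have "c i \<otimes> y = y \<otimes> c i" if i: "i \<in> ?J" and y: "y \<in> carrier R" for i y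
      proof -
        let ?d = "\<lambda>i. y \<otimes> c i \<oplus> c i \<otimes> (\<ominus> y)"
        have d: "?d \<in> ?J \<rightarrow> carrier R" using cc y by auto
        have dj: "?d j = \<zero>" using c(1) y by (simp add: r_neg)
        have sd: "s ?d z = \<zero>" if z: "z \<in> carrier R" for z
        proof -
          have "s ?d z = s (\<lambda>i. y \<otimes> c i) z \<oplus> s (\<lambda>i. c i \<otimes> (\<ominus> y)) z"
            using cc y z by (intro s_add) auto
          also have "\<dots> = y \<otimes> s c z \<oplus> s c ((\<ominus> y) \<otimes> z)"
            using s_l[OF c(2) z y] s_r[OF c(2) z, of "\<ominus> y"] y by simp
          finally show ?thesis using c(3) y z by simp
        qed
        have "(\<Oplus>i\<in>I. ?d i \<otimes> (z \<otimes> b i)) = \<zero>" if "z \<in> carrier R" for z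
          using sd[OF that] that unfolding s_def using insert.hyps d dj b by (subst (asm) finsum_insert) (auto simp: Pi_iff)
        then have "\<forall>i\<in>I. ?d i = \<zero>"
          using d b by (intro insert.IH[OF _ indI]) auto
        then have "y \<otimes> c i \<oplus> c i \<otimes> (\<ominus> y) = \<zero>" using dj i by blast
        then show ?thesis using cc[OF i] y by (metis m_closed minus_equality minus_minus r_minus a_inv_closed)
      qed
      then have "c \<in> ?J \<rightarrow> Z" using cc Z by (auto simp: center_def)
      moreover have "(\<Oplus>i\<in>?J. c i \<otimes> b i) = \<zero>"
      proof -
        have "(\<Oplus>i\<in>?J. c i \<otimes> b i) = s c \<one>"
          unfolding s_def using cc b by (intro finsum_cong') auto
        then show ?thesis using c(3) by simp
      qed
      ultimately have "c j = \<zero>" using insert.prems(2) unfolding lin_indep_def by blast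
      then show False using c(1) simple unfolding simple_ring_def by simp
    qed
    then have "Q = {\<zero>}" using Q simple unfolding simple_ring_def by auto
    then have aj: "a j = \<zero>" using aQ by simp
    have "(\<Oplus>i\<in>I. a i \<otimes> (z \<otimes> b i)) = \<zero>" if "z \<in> carrier R" for z
      using insert.prems(4)[OF that] that aj insert.hyps insert.prems(3) b
      by (subst (asm) finsum_insert) (auto simp: Pi_iff)
    then have "\<forall>i\<in>I. a i = \<zero>" using insert.prems b by (intro insert.IH[OF _ indI]) auto
    then show ?case using aj by simp
  qed
  then show ?thesis using i by blast
qed

text \<open>Dedekind's argument: compare \<open>(\<Sum> y l) k\<close> with \<open>\<chi> l\<^sub>0 k (\<Sum> y l)\<close>.\<close>

lemma eigenvectors_independent:
  assumes K: "subfield K R" and fin: "finite L"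
    and chi: "\<And>l k. l \<in> L \<Longrightarrow> k \<in> K \<Longrightarrow> \<chi> l k \<in> K"
    and dist: "\<And>l l'. l \<in> L \<Longrightarrow> l' \<in> L \<Longrightarrow> l \<noteq> l' \<Longrightarrow> \<exists>k\<in>K. \<chi> l k \<noteq> \<chi> l' k"
    and y: "\<And>l. l \<in> L \<Longrightarrow> y l \<in> carrier R"
    and eig: "\<And>l k. l \<in> L \<Longrightarrow> k \<in> K \<Longrightarrow> y l \<otimes> k = \<chi> l k \<otimes> y l"
    and sum: "(\<Oplus>l\<in>L. y l) = \<zero>" and l: "l \<in> L"
  shows "y l = \<zero>"
proof -
  have Kc: "K \<subseteq> carrier R" using subfieldE(3)[OF K] .
  have comm: "k \<otimes> k' = k' \<otimes> k" if "k \<in> K" "k' \<in> K" for k k'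
    using subcring.sub_m_comm[OF subfieldE(2)[OF K]] that .
  have "\<forall>l\<in>L. y l = \<zero>"
    using fin chi dist y eig sum
  proof (induction L arbitrary: y)
    case empty
    then show ?case by simp
  next
    case (insert a L)
    have c: "k \<in> carrier R" if "k \<in> K" for k using that Kc by auto
    have yc: "y l \<in> carrier R" if "l \<in> insert a L" for l using insert.prems(3) that .
    have chc: "\<chi> l k \<in> carrier R" if "l \<in> insert a L" "k \<in> K" for l k
      using insert.prems(1) that Kc by blast
    have yL: "y \<in> L \<rightarrow> carrier R" using yc by auto
    have sL: "(\<Oplus>l\<in>L. y l) = \<ominus> y a"
      using insert.prems(5) insert.hyps yc yL by (metis finsum_closed finsum_insert insertI1 minus_equality minus_minus)
    have z: "(\<chi> l k \<ominus> \<chi> a k) \<otimes> y l = \<zero>" if k: "k \<in> K" and l: "l \<in> L" for k l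
    proof -
      let ?y = "\<lambda>l. (\<chi> l k \<ominus> \<chi> a k) \<otimes> y l"
      have d: "\<chi> l k \<ominus> \<chi> a k \<in> K" if "l \<in> L" for l
        using insert.prems(1) k that subringE(3,5,7)[OF subfieldE(1)[OF K]] by (simp add: a_minus_def)
      have "(\<Oplus>l\<in>L. ?y l) = (\<Oplus>l\<in>L. y l \<otimes> k \<ominus> \<chi> a k \<otimes> y l)"
        using yc chc k insert.prems(4) c
        by (intro finsum_cong') (auto simp: a_minus_def l_distr l_minus)
      also have "\<dots> = (\<Oplus>l\<in>L. y l \<otimes> k) \<ominus> (\<Oplus>l\<in>L. \<chi> a k \<otimes> y l)"
        using yc chc k c by (intro finsum_minus) auto
      also have "\<dots> = (\<Oplus>l\<in>L. y l) \<otimes> k \<ominus> \<chi> a k \<otimes> (\<Oplus>l\<in>L. y l)"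
        using yL chc k c insert.hyps by (simp add: finsum_ldistr finsum_rdistr)
      also have "\<dots> = \<zero>"
        unfolding sL using insert.prems(4)[of a k] k yc[of a] chc[of a k] c[OF k]
        by (simp add: l_minus r_minus a_minus_def r_neg l_neg)
      finally have s: "(\<Oplus>l\<in>L. ?y l) = \<zero>" .
      have "\<forall>l\<in>L. ?y l = \<zero>"
      proof (rule insert.IH)
        \<comment> \<open>Scaling by \<open>\<chi> l k \<ominus> \<chi> a k\<close> preserves the
          eigenvalue because K is commutative, so the shortened relation falls under the induction
          hypothesis.\<close>
        fix l k' assume lk: "l \<in> L" "k' \<in> K"
        have dl: "\<chi> l k \<ominus> \<chi> a k \<in> carrier R" using d[OF lk(1)] c by blast
        have "?y l \<otimes> k' = (\<chi> l k \<ominus> \<chi> a k) \<otimes> (\<chi> l k' \<otimes> y l)"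
          using lk dl yc c insert.prems(4)[of l k'] by (simp add: m_assoc)
        also have "\<dots> = \<chi> l k' \<otimes> ?y l"
          using comm[OF d[OF lk(1)], of "\<chi> l k'"] insert.prems(1)[of l k'] lk dl yc chc[of l k']
          by (simp add: m_assoc[symmetric])
        finally show "?y l \<otimes> k' = \<chi> l k' \<otimes> ?y l" .
      qed (use insert.prems s d c yc in auto)
      then show ?thesis using l by blast
    qed
    have yl: "y l = \<zero>" if l: "l \<in> L" for l
    proof -
      have "l \<noteq> a" using insert.hyps l by blast
      then obtain k where k: "k \<in> K" "\<chi> l k \<noteq> \<chi> a k" using insert.prems(2)[of l a] l by blast
      let ?u = "\<chi> l k \<ominus> \<chi> a k"
      have cc: "\<chi> l k \<in> carrier R" "\<chi> a k \<in> carrier R" using chc k l by auto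
      have "?u \<in> K"
        using insert.prems(1) k l subringE(3,5,7)[OF subfieldE(1)[OF K]] by (simp add: a_minus_def)
      moreover have "?u \<noteq> \<zero>" using cc k(2) by simp
      ultimately have u: "?u \<in> K - {\<zero>}" by blast
      then have "inv ?u \<in> carrier R" "inv ?u \<otimes> ?u = \<one>" using subfield_m_inv[OF K u] Kc by auto
      then have "y l = inv ?u \<otimes> (?u \<otimes> y l)" using yc[of l] l u Kc
        by (simp add: m_assoc[symmetric] subset_iff)
      then show ?thesis using z[OF k(1) l] \<open>inv ?u \<in> carrier R\<close> by simp
    qed
    moreover have "y a = \<zero>"
    proof -
      have "(\<Oplus>l\<in>L. y l) = \<zero>" using yl by (intro add.finprod_one_eqI)
      then show ?thesis using sL yc[of a] by (metis a_inv_closed insertI1 minus_minus minus_zero)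
    qed
    ultimately show ?case by simp
  qed
  then show ?thesis using l by blast
qed

section \<open>Subfields and units of subrings\<close>

lemma subfield_subfield:
  assumes M: "subfield M R" and K: "subring K R" "K \<subseteq> M"
    and inv: "\<And>k. k \<in> K \<Longrightarrow> k \<noteq> \<zero> \<Longrightarrow> inv k \<in> K"
  shows "subfield K R"
proof -
  have Mc: "M \<subseteq> carrier R" using subfieldE(3)[OF M] .
  show ?thesis
  proof (rule subfieldI)
    show "subcring K R"
      using K(2) subcring.sub_m_comm[OF subfieldE(2)[OF M]]
      by (intro subcringI[OF K(1)]) (simp add: subset_iff)
    have "k \<in> Units (R\<lparr>carrier := K\<rparr>)" if k: "k \<in> K - {\<zero>}" for k
    proof -
      have "k \<in> M - {\<zero>}" using k K by blast
      from subfield_m_inv[OF M this] show ?thesis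
        using inv k unfolding Units_def by auto
    qed
    moreover have "k \<noteq> \<zero>" if k: "k \<in> Units (R\<lparr>carrier := K\<rparr>)" for k
    proof
      assume "k = \<zero>"
      then obtain k' where "k' \<in> K" "k' \<otimes> \<zero> = \<one>" using k unfolding Units_def by auto
      then have "\<one> = \<zero>" using K(2) Mc by auto
      then show False using subfieldE(6)[OF M] by simp
    qed
    ultimately show "Units (R\<lparr>carrier := K\<rparr>) = K - {\<zero>}"
      unfolding Units_def by auto
  qed
qed

lemma subalgebra_subfield:
  assumes "subfield K R" "subfield L R" "K \<subseteq> L" shows "subalgebra K L R"
  using subringE(6)[OF subfieldE(1)[OF assms(2)]] assms(3)
    subring_add_subgroup[OF subfieldE(1)[OF assms(2)]]
  by (auto simp: subalgebra_def subalgebra_axioms_def)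

lemma Units_subring_inv:
  assumes "subring B R" "u \<in> Units (R\<lparr>carrier := B\<rparr>)"
  shows "u \<in> Units R" "inv u \<in> B" "inv\<^bsub>R\<lparr>carrier := B\<rparr>\<^esub> u = inv u"
proof -
  interpret B: ring "R\<lparr>carrier := B\<rparr>" by (rule subring_is_ring[OF assms(1)])
  show "u \<in> Units R" using assms(2) subringE(1)[OF assms(1)] by (auto simp: Units_def)
  show i: "inv\<^bsub>R\<lparr>carrier := B\<rparr>\<^esub> u = inv u"
    using m_inv_monoid_consistent[OF assms(2) subring.axioms(2)[OF assms(1)]] .
  show "inv u \<in> B" using B.Units_inv_closed[OF assms(2)] i by simp
qed

lemma Units_subringI:
  assumes "u \<in> Units R" "u \<in> B" "inv u \<in> B" shows "u \<in> Units (R\<lparr>carrier := B\<rparr>)"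
  using assms(2,3) Units_l_inv[OF assms(1)] Units_r_inv[OF assms(1)] unfolding Units_def by auto

lemma conj_cancel:
  assumes "u \<in> Units R" "y \<in> carrier R" "z \<in> carrier R"
  shows "u \<otimes> y \<otimes> inv u = z \<longleftrightarrow> u \<otimes> y = z \<otimes> u"
proof
  assume "u \<otimes> y \<otimes> inv u = z"
  then have "z \<otimes> u = u \<otimes> y \<otimes> inv u \<otimes> u" by simp
  then show "u \<otimes> y = z \<otimes> u" using assms Units_closed[OF assms(1)] by (simp add: m_assoc)
next
  assume "u \<otimes> y = z \<otimes> u"
  then show "u \<otimes> y \<otimes> inv u = z" using assms Units_closed[OF assms(1)] by (simp add: m_assoc)
qed

lemma subfield_of_subring:
  assumes "subring B R" "subfield K R" "K \<subseteq> B" shows "subfield K (R\<lparr>carrier := B\<rparr>)"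
proof -
  interpret B: ring "R\<lparr>carrier := B\<rparr>" by (rule subring_is_ring[OF assms(1)])
  show ?thesis using B.subfield_iff(1)[of K] subfield_iff(2)[OF assms(2)] assms(3) by simp
qed

end

section \<open>Galois subfields of central simple algebras\<close>

text \<open>That the automorphisms form a finite group is an assumption of the locale; the final
  theorem reads both facts off the chain of subgroups.\<close>

locale galois_csa = ring A for A (structure) +
  fixes F M :: "'a set" and n :: nat
  assumes galois: "galois_ext A F M"
    and dim_M: "dimension n F M"
    and csa: "central_simple_degree A F n"
    and group_Gal: "group (Gal A F M)"
    and finite_Gal: "finite (carrier (Gal A F M))"
begin

abbreviation \<Gamma> where "\<Gamma> \<equiv> Gal A F M"

sublocale Gal: group \<Gamma> by (rule group_Gal)

lemma subfield_F: "subfield F A" and subfield_M: "subfield M A" and F_sub_M: "F \<subseteq> M"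
  and Fix_Gal: "Fix (carrier \<Gamma>) M = F"
  using galois by (auto simp: galois_ext_def field_ext_def)

lemma simple: "simple_ring A" and center_A: "center A = F" and dim_A: "dimension (n\<^sup>2) F (carrier A)"
  using csa by (auto simp: central_simple_degree_def central_simple_def)

lemma one_neq_zero: "\<one> \<noteq> \<zero>" using subfieldE(6)[OF subfield_M] .

lemma M_simps [simp]:
  shows "m \<in> M \<Longrightarrow> m \<in> carrier A"
    and "\<zero> \<in> M" and "\<one> \<in> M"
    and "m \<in> M \<Longrightarrow> m' \<in> M \<Longrightarrow> m \<oplus> m' \<in> M"
    and "m \<in> M \<Longrightarrow> m' \<in> M \<Longrightarrow> m \<otimes> m' \<in> M"
    and "m \<in> M \<Longrightarrow> \<ominus> m \<in> M"
    and "m \<in> M \<Longrightarrow> m' \<in> M \<Longrightarrow> m \<ominus> m' \<in> M"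
  using subringE[OF subfieldE(1)[OF subfield_M]] by (auto simp: a_minus_def)

lemma M_comm: "m \<in> M \<Longrightarrow> m' \<in> M \<Longrightarrow> m \<otimes> m' = m' \<otimes> m"
  using subfieldE(4)[OF subfield_M] by blast

lemma M_inv:
  assumes "m \<in> M" "m \<noteq> \<zero>"
  shows "inv m \<in> M" "inv m \<otimes> m = \<one>" "m \<otimes> inv m = \<one>" "inv m \<noteq> \<zero>"
  using subfield_m_inv[OF subfield_M, of m] assms by auto

lemma M_cancel: "m \<in> M \<Longrightarrow> m \<noteq> \<zero> \<Longrightarrow> y \<in> carrier A \<Longrightarrow> m \<otimes> y = \<zero> \<Longrightarrow> y = \<zero>"
  using M_inv by (metis M_simps(1) l_one m_assoc r_null)

lemma M_finsum: "(\<And>i. i \<in> I \<Longrightarrow> f i \<in> M) \<Longrightarrow> finsum A f I \<in> M"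
  using subring_finsum_closed[OF subfieldE(1)[OF subfield_M]] by blast

lemma F_center: "f \<in> F \<Longrightarrow> y \<in> carrier A \<Longrightarrow> f \<otimes> y = y \<otimes> f"
  using center_A by (auto simp: center_def)

lemma carrier_Gal: "carrier \<Gamma> = alg_auto F (A\<lparr>carrier := M\<rparr>)"
  by (simp add: Gal_def)

lemma
  assumes "\<sigma> \<in> carrier \<Gamma>"
  shows gal_hom: "\<sigma> \<in> ring_hom (A\<lparr>carrier := M\<rparr>) (A\<lparr>carrier := M\<rparr>)"
    and gal_Bij: "\<sigma> \<in> Bij M"
    and gal_F: "f \<in> F \<Longrightarrow> \<sigma> f = f"
  using assms by (auto simp: carrier_Gal alg_auto_def ring_auto_def)

lemma gal_simps [simp]:
  assumes "\<sigma> \<in> carrier \<Gamma>"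
  shows "m \<in> M \<Longrightarrow> \<sigma> m \<in> M"
    and "m \<in> M \<Longrightarrow> m' \<in> M \<Longrightarrow> \<sigma> (m \<oplus> m') = \<sigma> m \<oplus> \<sigma> m'"
    and "m \<in> M \<Longrightarrow> m' \<in> M \<Longrightarrow> \<sigma> (m \<otimes> m') = \<sigma> m \<otimes> \<sigma> m'"
    and "\<sigma> \<one> = \<one>" and "\<sigma> \<zero> = \<zero>"
proof -
  let ?M = "A\<lparr>carrier := M\<rparr>"
  have M: "ring ?M" using subring_is_ring subfieldE(1)[OF subfield_M] by blast
  note h = gal_hom[OF assms]
  show "m \<in> M \<Longrightarrow> \<sigma> m \<in> M" using ring_hom_closed[OF h] by simp
  show "m \<in> M \<Longrightarrow> m' \<in> M \<Longrightarrow> \<sigma> (m \<oplus> m') = \<sigma> m \<oplus> \<sigma> m'" using ring_hom_add[OF h] by simp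
  show "m \<in> M \<Longrightarrow> m' \<in> M \<Longrightarrow> \<sigma> (m \<otimes> m') = \<sigma> m \<otimes> \<sigma> m'" using ring_hom_mult[OF h] by simp
  show "\<sigma> \<one> = \<one>" using ring_hom_one[OF h] by simp
  show "\<sigma> \<zero> = \<zero>" using ring_hom_zero[OF h M M] by simp
qed

lemma gal_closed: "\<sigma> \<in> carrier \<Gamma> \<Longrightarrow> m \<in> M \<Longrightarrow> \<sigma> m \<in> carrier A"
  by simp

lemma gal_finsum:
  assumes "\<sigma> \<in> carrier \<Gamma>" "finite I" "f \<in> I \<rightarrow> M"
  shows "\<sigma> (finsum A f I) = (\<Oplus>i\<in>I. \<sigma> (f i))"
  using additive_finsum[OF subfieldE(1)[OF subfield_M] assms(2,3), of \<sigma>] assms(1) by simp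

lemma gal_mult: "\<sigma> \<in> carrier \<Gamma> \<Longrightarrow> \<rho> \<in> carrier \<Gamma> \<Longrightarrow> m \<in> M \<Longrightarrow> (\<sigma> \<otimes>\<^bsub>\<Gamma>\<^esub> \<rho>) m = \<sigma> (\<rho> m)"
  using gal_Bij[of \<sigma>] gal_Bij[of \<rho>] by (simp add: Gal_def BijGroup_def compose_eq)

lemma gal_one: "m \<in> M \<Longrightarrow> \<one>\<^bsub>\<Gamma>\<^esub> m = m"
  by (simp add: Gal_def BijGroup_def)

lemma gal_inv:
  assumes "\<sigma> \<in> carrier \<Gamma>" "m \<in> M"
  shows "\<sigma> ((inv\<^bsub>\<Gamma>\<^esub> \<sigma>) m) = m" "(inv\<^bsub>\<Gamma>\<^esub> \<sigma>) (\<sigma> m) = m"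
  using assms gal_mult[of \<sigma> "inv\<^bsub>\<Gamma>\<^esub> \<sigma>" m] gal_mult[of "inv\<^bsub>\<Gamma>\<^esub> \<sigma>" \<sigma> m] gal_one by simp_all

lemma gal_eqI:
  assumes "\<sigma> \<in> carrier \<Gamma>" "\<rho> \<in> carrier \<Gamma>" "\<And>m. m \<in> M \<Longrightarrow> \<sigma> m = \<rho> m"
  shows "\<sigma> = \<rho>"
  using gal_Bij[OF assms(1)] gal_Bij[OF assms(2)] assms(3)
  by (auto simp: Bij_def intro: extensionalityI)

lemma gal_minus:
  assumes "\<sigma> \<in> carrier \<Gamma>" "m \<in> M" "m' \<in> M"
  shows "\<sigma> (m \<ominus> m') = \<sigma> m \<ominus> \<sigma> m'"
proof -
  have "\<sigma> (\<ominus> m') \<oplus> \<sigma> m' = \<sigma> (\<ominus> m' \<oplus> m')" using assms by (intro gal_simps(2)[symmetric]) auto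
  also have "\<dots> = \<zero>" using assms by (simp add: l_neg)
  finally have "\<ominus> \<sigma> m' = \<sigma> (\<ominus> m')" using assms by (intro minus_equality) auto
  then show ?thesis using assms by (simp add: a_minus_def)
qed

lemma gal_m_inv:
  assumes "\<sigma> \<in> carrier \<Gamma>" "m \<in> M" "m \<noteq> \<zero>" shows "\<sigma> (inv m) = inv (\<sigma> m)"
proof -
  note i = M_inv[OF assms(2,3)]
  have "\<sigma> m \<otimes> \<sigma> (inv m) = \<one>" "\<sigma> (inv m) \<otimes> \<sigma> m = \<one>"
    unfolding gal_simps(3)[OF assms(1,2) i(1), symmetric] gal_simps(3)[OF assms(1) i(1) assms(2), symmetric]
    using i(2,3) assms(1) by simp_all
  then show ?thesis using assms i by (intro inv_unique') auto
qed

section \<open>Fixed fields of subgroups and bases of M over them\<close>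

abbreviation Fx where "Fx H \<equiv> Fix H M"

lemma Fx_sub_M: "Fx H \<subseteq> M" by (auto simp: Fix_def)

lemma FxD:
  assumes "f \<in> Fx H" shows "f \<in> M" "f \<in> carrier A" "\<sigma> \<in> H \<Longrightarrow> \<sigma> f = f"
  using assms by (auto simp: Fix_def)

lemma FxI: "f \<in> M \<Longrightarrow> (\<And>\<sigma>. \<sigma> \<in> H \<Longrightarrow> \<sigma> f = f) \<Longrightarrow> f \<in> Fx H"
  by (simp add: Fix_def)

lemma subfield_Fx:
  assumes "H \<subseteq> carrier \<Gamma>" shows "subfield (Fx H) A"
proof (rule subfield_subfield[OF subfield_M _ Fx_sub_M])
  have [simp]: "\<sigma> \<in> carrier \<Gamma>" if "\<sigma> \<in> H" for \<sigma> using that assms by blast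
  show "subring (Fx H) A"
  proof (rule subringI)
    show "\<ominus> m \<in> Fx H" if m: "m \<in> Fx H" for m
    proof (rule FxI)
      show "\<sigma> (\<ominus> m) = \<ominus> m" if s: "\<sigma> \<in> H" for \<sigma>
        using gal_minus[of \<sigma> \<zero> m] FxD(1,2)[OF m] FxD(3)[OF m s] s by (simp add: a_minus_def)
    qed (use FxD[OF m] in simp)
    show "m \<oplus> m' \<in> Fx H" "m \<otimes> m' \<in> Fx H" if m: "m \<in> Fx H" "m' \<in> Fx H" for m m'
      using FxD(1)[OF m(1)] FxD(1)[OF m(2)] by (auto intro!: FxI simp: FxD(3)[OF m(1)] FxD(3)[OF m(2)])
  qed (auto intro: FxI dest: FxD)
  show "inv m \<in> Fx H" if "m \<in> Fx H" "m \<noteq> \<zero>" for m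
    using FxD(1)[OF that(1)] M_inv(1)[OF _ that(2)]
    by (auto intro!: FxI simp: gal_m_inv that(2) FxD(3)[OF that(1)])
qed

lemma F_sub_Fx: "H \<subseteq> carrier \<Gamma> \<Longrightarrow> F \<subseteq> Fx H"
  using F_sub_M gal_F by (auto simp: Fix_def)

text \<open>A list spanning E over F also spans it over the larger field Z, and its Z-span stays in
  E because E is stable under Z.\<close>

lemma finite_dimension_over:
  assumes "subfield Z A" "F \<subseteq> Z" "finite_dimension F E" "subalgebra Z E A"
  shows "finite_dimension Z E"
proof -
  obtain n where "dimension n F E" using assms(3) by blast
  then obtain Us where Us: "set Us \<subseteq> carrier A" "Span F Us = E"
    using exists_base[OF subfield_F] by blast
  have UE: "set Us \<subseteq> E" using Span_base_incl[OF subfield_F Us(1)] Us(2) by blast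
  have "E \<subseteq> Span Z Us"
  proof
    fix e assume "e \<in> E"
    then obtain Ks where "set Ks \<subseteq> F" "length Ks = length Us" "e = combine Ks Us"
      using Span_mem_iff_length_version[OF subfield_F Us(1)] Us(2) by blast
    then show "e \<in> Span Z Us"
      using Span_mem_iff_length_version[OF assms(1) Us(1)] assms(2) by blast
  qed
  moreover have "Span Z Us \<subseteq> E" using subalgebra_Span_incl[OF assms(1,4) UE] .
  ultimately show ?thesis using Span_finite_dimension[OF assms(1) Us(1)] by simp
qed

text \<open>The length r is kept as a parameter: that it equals the order of H is proved only in
  \<open>dimension_over_fixed_field\<close>, whose proof itself works with such a basis.\<close>

definition fix_basis :: "('a \<Rightarrow> 'a) set \<Rightarrow> nat \<Rightarrow> (nat \<Rightarrow> 'a) \<Rightarrow> bool" where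
  "fix_basis H r b \<longleftrightarrow>
    (\<forall>i<r. b i \<in> M) \<and> lin_indep (Fx H) {..<r} b \<and> M = lin_span (Fx H) {..<r} b"

lemma fix_basis_M: "fix_basis H r b \<Longrightarrow> i < r \<Longrightarrow> b i \<in> M"
  by (simp add: fix_basis_def)

lemma ex_fix_basis:
  assumes "H \<subseteq> carrier \<Gamma>"
  obtains r b where "fix_basis H r b" "dimension r (Fx H) M"
proof -
  note Z = subfield_Fx[OF assms]
  have "finite_dimension (Fx H) M"
    using finite_dimension_over[OF Z F_sub_Fx[OF assms] finite_dimensionI[OF dim_M]]
      subalgebra_subfield[OF Z subfield_M Fx_sub_M] .
  then obtain r where r: "dimension r (Fx H) M" by blast
  then obtain b where "b \<in> {..<r} \<rightarrow> M" "lin_indep (Fx H) {..<r} b" "M = lin_span (Fx H) {..<r} b"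
    using dimension_imp_basis[OF Z] by metis
  then show ?thesis using that[of r b] r by (auto simp: fix_basis_def)
qed

text \<open>Artin's argument: in a relation normalised at one coefficient, all coefficients are
  fixed by \<open>H\<close>.\<close>

lemma artin_independence:
  assumes H: "subgroup H \<Gamma>" and fin: "finite I" and b: "\<And>i. i \<in> I \<Longrightarrow> b i \<in> M"
    and indep: "lin_indep (Fx H) I b" and a: "\<And>i. i \<in> I \<Longrightarrow> a i \<in> M"
    and zero: "\<And>\<rho>. \<rho> \<in> H \<Longrightarrow> (\<Oplus>i\<in>I. a i \<otimes> \<rho> (b i)) = \<zero>"
    and i: "i \<in> I"
  shows "a i = \<zero>"
proof -
  have Hc: "H \<subseteq> carrier \<Gamma>" using subgroup.subset[OF H] .
  note Z = subfield_Fx[OF Hc]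
  have "\<forall>i\<in>I. a i = \<zero>"
    using fin b indep a zero
  proof (induction I arbitrary: a)
    case empty
    then show ?case by simp
  next
    case (insert j I)
    let ?J = "insert j I"
    note bM = insert.prems(1) and aM = insert.prems(3)
    have g [simp]: "\<rho> \<in> carrier \<Gamma>" if "\<rho> \<in> H" for \<rho> using that Hc by blast
    have indI: "lin_indep (Fx H) I b"
      using lin_indep_subset[OF insert.prems(2), of I] insert.hyps bM subfieldE(3)[OF Z]
        subringE(2)[OF subfieldE(1)[OF Z]] by auto
    have aj: "a j = \<zero>"
    proof (rule ccontr)
      assume aj: "a j \<noteq> \<zero>"
      note ui = M_inv[OF aM[of j, simplified] aj]
      define c where "c i = inv (a j) \<otimes> a i" for i
      have cM: "c i \<in> M" if "i \<in> ?J" for i using that ui aM[of i] by (simp add: c_def)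
      have cj: "c j = \<one>" using ui by (simp add: c_def)
      have cz: "(\<Oplus>i\<in>?J. c i \<otimes> \<rho> (b i)) = \<zero>" if "\<rho> \<in> H" for \<rho>
      proof -
        have "(\<Oplus>i\<in>?J. c i \<otimes> \<rho> (b i)) = (\<Oplus>i\<in>?J. inv (a j) \<otimes> (a i \<otimes> \<rho> (b i)))"
          using that ui aM bM unfolding c_def by (intro finsum_cong') (auto simp: m_assoc gal_closed)
        also have "\<dots> = inv (a j) \<otimes> (\<Oplus>i\<in>?J. a i \<otimes> \<rho> (b i))"
          using that ui aM bM insert.hyps by (intro finsum_rdistr[symmetric]) (auto simp: gal_closed)
        finally show ?thesis using insert.prems(4)[OF that] ui by simp
      qed
      have "c i \<in> Fx H" if i: "i \<in> ?J" for i
      proof -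
        have "\<tau> (c i) = c i" if t: "\<tau> \<in> H" for \<tau>
        proof -
          let ?d = "\<lambda>i. \<tau> (c i) \<ominus> c i"
          have dM: "?d i \<in> M" if "i \<in> ?J" for i using cM[OF that] t by simp
          have dj: "?d j = \<zero>" using cj t by (simp add: a_minus_def r_neg)
          have dz: "(\<Oplus>i\<in>?J. ?d i \<otimes> \<rho> (b i)) = \<zero>" if r: "\<rho> \<in> H" for \<rho>
          proof -
            \<comment> \<open>Applying \<tau> to the relation for \<tau>^(-1) \<rho> yields a
              relation for \<rho> with coefficients \<open>\<tau> (c i)\<close>. Its difference with
              the original relation has coefficient zero at j.\<close>
            let ?\<rho> = "inv\<^bsub>\<Gamma>\<^esub> \<tau> \<otimes>\<^bsub>\<Gamma>\<^esub> \<rho>"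
            have r': "?\<rho> \<in> H" using subgroup.m_closed[OF H subgroup.m_inv_closed[OF H t] r] .
            have e: "\<tau> (?\<rho> m) = \<rho> m" if "m \<in> M" for m
              using that t r gal_inv(1)[of \<tau> "\<rho> m"] by (simp add: gal_mult)
            have "(\<Oplus>i\<in>?J. \<tau> (c i) \<otimes> \<rho> (b i)) = (\<Oplus>i\<in>?J. \<tau> (c i \<otimes> ?\<rho> (b i)))"
              using t r r' cM bM e by (intro finsum_cong') (auto simp: gal_closed)
            also have "\<dots> = \<tau> (\<Oplus>i\<in>?J. c i \<otimes> ?\<rho> (b i))"
              using t r' cM bM insert.hyps by (intro gal_finsum[symmetric]) auto
            also have "\<dots> = \<zero>" using cz[OF r'] t by simp
            finally have z: "(\<Oplus>i\<in>?J. \<tau> (c i) \<otimes> \<rho> (b i)) = \<zero>" .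
            have "(\<Oplus>i\<in>?J. ?d i \<otimes> \<rho> (b i)) = (\<Oplus>i\<in>?J. \<tau> (c i) \<otimes> \<rho> (b i) \<ominus> c i \<otimes> \<rho> (b i))"
              using t r cM bM by (intro finsum_cong') (auto simp: a_minus_def l_distr l_minus gal_closed)
            also have "\<dots> = (\<Oplus>i\<in>?J. \<tau> (c i) \<otimes> \<rho> (b i)) \<ominus> (\<Oplus>i\<in>?J. c i \<otimes> \<rho> (b i))"
              using t r cM bM by (intro finsum_minus) (auto simp: gal_closed)
            finally show ?thesis using z cz[OF r] by (simp add: a_minus_def)
          qed
          have "(\<Oplus>i\<in>I. ?d i \<otimes> \<rho> (b i)) = \<zero>" if r: "\<rho> \<in> H" for \<rho>
            using finsum_insert_zero[OF insert.hyps(1,2), of "\<lambda>i. ?d i \<otimes> \<rho> (b i)"] dz[OF r] dj dM bM r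
            by (simp add: gal_closed)
          then have "\<forall>i\<in>I. ?d i = \<zero>" using dM bM by (intro insert.IH[OF _ indI]) auto
          then have "?d i = \<zero>" using dj i by blast
          then show ?thesis using cM[OF i] t by simp
        qed
        then show ?thesis using cM[OF i] by (simp add: Fix_def)
      qed
      moreover have "(\<Oplus>i\<in>?J. c i \<otimes> b i) = \<zero>"
      proof -
        have "(\<Oplus>i\<in>?J. c i \<otimes> b i) = (\<Oplus>i\<in>?J. c i \<otimes> \<one>\<^bsub>\<Gamma>\<^esub> (b i))"
          using cM bM by (intro finsum_cong') (auto simp: gal_one gal_closed)
        then show ?thesis using cz[OF subgroup.one_closed[OF H]] by simp
      qed
      ultimately have "c j = \<zero>" by (intro lin_indepD[OF insert.prems(2), of c j]) auto
      then show False using cj one_neq_zero by simp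
    qed
    have "(\<Oplus>i\<in>I. a i \<otimes> \<rho> (b i)) = \<zero>" if r: "\<rho> \<in> H" for \<rho>
      using finsum_insert_zero[OF insert.hyps(1,2), of "\<lambda>i. a i \<otimes> \<rho> (b i)"] insert.prems(4)[OF r]
        aj aM bM r by (simp add: gal_closed)
    then have "\<forall>i\<in>I. a i = \<zero>" using aM bM by (intro insert.IH[OF _ indI]) auto
    then show ?case using aj by simp
  qed
  then show ?thesis using i by blast
qed

definition linear_on_M :: "'a set \<Rightarrow> ('a \<Rightarrow> 'a) \<Rightarrow> bool" where
  "linear_on_M Z \<theta> \<longleftrightarrow> \<theta> \<in> M \<rightarrow> carrier A \<and>
    (\<forall>m\<in>M. (\<forall>m'\<in>M. \<theta> (m \<oplus> m') = \<theta> m \<oplus> \<theta> m') \<and> (\<forall>f\<in>Z. \<theta> (f \<otimes> m) = f \<otimes> \<theta> m))"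

text \<open>This expresses \<open>\<Sum> c j \<otimes> d j \<in> M \<otimes>\<^sub>Z M\<close> in the basis \<open>b\<close>; the maps \<open>\<theta>\<close> used are the
  elements of \<open>H\<close> and \<open>m \<mapsto> z m\<close>.\<close>

lemma expand_in_basis:
  assumes H: "H \<subseteq> carrier \<Gamma>" and b: "fix_basis H r b" and fin: "finite J"
    and c: "\<And>j. j \<in> J \<Longrightarrow> c j \<in> M" and d: "\<And>j. j \<in> J \<Longrightarrow> d j \<in> M"
  obtains a where "\<And>i. i < r \<Longrightarrow> a i \<in> M"
    and "\<And>\<theta>. linear_on_M (Fx H) \<theta> \<Longrightarrow> (\<Oplus>j\<in>J. c j \<otimes> \<theta> (d j)) = (\<Oplus>i\<in>{..<r}. a i \<otimes> \<theta> (b i))"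
proof -
  note bM = fix_basis_M[OF b]
  have "\<forall>j\<in>J. \<exists>f. f \<in> {..<r} \<rightarrow> Fx H \<and> d j = (\<Oplus>i\<in>{..<r}. f i \<otimes> b i)"
    using b d unfolding fix_basis_def lin_span_def by blast
  then obtain f where f: "\<And>j. j \<in> J \<Longrightarrow> f j \<in> {..<r} \<rightarrow> Fx H"
    "\<And>j. j \<in> J \<Longrightarrow> d j = (\<Oplus>i\<in>{..<r}. f j i \<otimes> b i)"
    by metis
  have fM: "f j i \<in> M" if "j \<in> J" "i < r" for i j using f(1)[OF that(1)] that(2) Fx_sub_M by blast
  show ?thesis
  proof (rule that[of "\<lambda>i. \<Oplus>j\<in>J. c j \<otimes> f j i"])
    show "(\<Oplus>j\<in>J. c j \<otimes> f j i) \<in> M" if "i < r" for i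
      using that c fM by (intro M_finsum) auto
    fix \<theta> assume "linear_on_M (Fx H) \<theta>"
    then have t: "\<And>m. m \<in> M \<Longrightarrow> \<theta> m \<in> carrier A"
      "\<And>m m'. m \<in> M \<Longrightarrow> m' \<in> M \<Longrightarrow> \<theta> (m \<oplus> m') = \<theta> m \<oplus> \<theta> m'"
      "\<And>f m. f \<in> Fx H \<Longrightarrow> m \<in> M \<Longrightarrow> \<theta> (f \<otimes> m) = f \<otimes> \<theta> m"
      unfolding linear_on_M_def by auto
    have td: "\<theta> (d j) = (\<Oplus>i\<in>{..<r}. f j i \<otimes> \<theta> (b i))" if j: "j \<in> J" for j
    proof -
      have "\<theta> (d j) = (\<Oplus>i\<in>{..<r}. \<theta> (f j i \<otimes> b i))"
        unfolding f(2)[OF j] using j fM bM t(1,2)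
        by (intro additive_finsum[OF subfieldE(1)[OF subfield_M]]) auto
      also have "\<dots> = (\<Oplus>i\<in>{..<r}. f j i \<otimes> \<theta> (b i))"
        using j f(1)[OF j] fM bM t(1) t(3)[OF funcset_mem[OF f(1)[OF j]]] by (intro finsum_cong') auto
      finally show ?thesis .
    qed
    have "(\<Oplus>j\<in>J. c j \<otimes> \<theta> (d j)) = (\<Oplus>j\<in>J. \<Oplus>i\<in>{..<r}. c j \<otimes> f j i \<otimes> \<theta> (b i))"
    proof (intro finsum_cong'[OF refl])
      fix j assume j: "j \<in> J"
      have "c j \<otimes> \<theta> (d j) = (\<Oplus>i\<in>{..<r}. c j \<otimes> (f j i \<otimes> \<theta> (b i)))"
        unfolding td[OF j] using j c fM bM t(1) by (intro finsum_rdistr) auto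
      also have "\<dots> = (\<Oplus>i\<in>{..<r}. c j \<otimes> f j i \<otimes> \<theta> (b i))"
        using j c fM bM t(1) by (intro finsum_cong') (auto simp: m_assoc)
      finally show "c j \<otimes> \<theta> (d j) = (\<Oplus>i\<in>{..<r}. c j \<otimes> f j i \<otimes> \<theta> (b i))" .
    qed (use c fM bM t(1) in \<open>auto intro!: finsum_closed\<close>)
    also have "\<dots> = (\<Oplus>i\<in>{..<r}. \<Oplus>j\<in>J. c j \<otimes> f j i \<otimes> \<theta> (b i))"
      using fin c fM bM t(1) by (intro finsum_swap) auto
    also have "\<dots> = (\<Oplus>i\<in>{..<r}. (\<Oplus>j\<in>J. c j \<otimes> f j i) \<otimes> \<theta> (b i))"
      using fin c fM bM t(1) by (intro finsum_cong'[OF refl]) (auto intro!: finsum_ldistr[symmetric] finsum_closed)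
    finally show "(\<Oplus>j\<in>J. c j \<otimes> \<theta> (d j)) = (\<Oplus>i\<in>{..<r}. (\<Oplus>j\<in>J. c j \<otimes> f j i) \<otimes> \<theta> (b i))" .
  qed
qed

lemma gal_linear:
  assumes "subgroup H \<Gamma>" "\<rho> \<in> H"
  shows "linear_on_M (Fx H) \<rho>"
proof -
  have "\<rho> \<in> carrier \<Gamma>" using assms subgroup.mem_carrier by metis
  then show ?thesis
    using Fx_sub_M assms(2) by (auto simp: linear_on_M_def FxD subset_iff)
qed

text \<open>The element of \<open>M \<otimes> M\<close> obtained as the normalised product of the
  \<open>1 \<otimes> m - \<tau>(m) \<otimes> 1\<close> over \<open>\<tau> \<noteq> \<sigma>\<close>.\<close>

lemma separating_coefficients:
  assumes H: "subgroup H \<Gamma>" and b: "fix_basis H r b" and s: "\<sigma> \<in> H"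
  obtains a where "\<And>i. i < r \<Longrightarrow> a i \<in> M"
    and "\<And>\<rho>. \<rho> \<in> H \<Longrightarrow> (\<Oplus>i\<in>{..<r}. a i \<otimes> \<rho> (b i)) = (if \<rho> = \<sigma> then \<one> else \<zero>)"
proof -
  have Hc: "H \<subseteq> carrier \<Gamma>" using subgroup.subset[OF H] .
  have g [simp]: "\<rho> \<in> carrier \<Gamma>" if "\<rho> \<in> H" for \<rho> using that Hc by blast
  note bM = fix_basis_M[OF b]
  have lin: "linear_on_M (Fx H) \<rho>" if "\<rho> \<in> H" for \<rho>
    using that gal_linear[OF H] by blast
  have "\<exists>a. (\<forall>i<r. a i \<in> M) \<and> (\<Oplus>i\<in>{..<r}. a i \<otimes> \<sigma> (b i)) = \<one> \<and>
      (\<forall>\<rho>\<in>S. (\<Oplus>i\<in>{..<r}. a i \<otimes> \<rho> (b i)) = \<zero>)"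
    if "finite S" "S \<subseteq> H - {\<sigma>}" for S
    using that
  proof (induction S)
    case empty
    \<comment> \<open>The empty product is 1 \<otimes> 1, expanded in the basis.\<close>
    obtain a where a: "\<And>i. i < r \<Longrightarrow> a i \<in> M"
      and e: "\<And>\<theta>. linear_on_M (Fx H) \<theta> \<Longrightarrow> (\<Oplus>j\<in>{0::nat}. \<one> \<otimes> \<theta> \<one>) = (\<Oplus>i\<in>{..<r}. a i \<otimes> \<theta> (b i))"
      using expand_in_basis[OF Hc b, of "{0::nat}" "\<lambda>_. \<one>" "\<lambda>_. \<one>"] by auto
    have "(\<Oplus>i\<in>{..<r}. a i \<otimes> \<sigma> (b i)) = \<one>" using e[OF lin[OF s]] s by simp
    then show ?case using a by auto
  next
    case (insert \<tau> S)
    then obtain a where a: "\<And>i. i < r \<Longrightarrow> a i \<in> M" "(\<Oplus>i\<in>{..<r}. a i \<otimes> \<sigma> (b i)) = \<one>"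
      "\<forall>\<rho>\<in>S. (\<Oplus>i\<in>{..<r}. a i \<otimes> \<rho> (b i)) = \<zero>"
      by auto
    have t: "\<tau> \<in> H" "\<tau> \<noteq> \<sigma>" using insert.prems by auto
    obtain m where m: "m \<in> M" "\<sigma> m \<noteq> \<tau> m" using gal_eqI[of \<sigma> \<tau>] s t by auto
    let ?u = "\<sigma> m \<ominus> \<tau> m"
    have u: "?u \<in> M" "?u \<noteq> \<zero>" using m s t by (auto simp: gal_closed)
    note ui = M_inv[OF u]
    \<comment> \<open>Coefficients of the previous tensor multiplied by 1 \<otimes> m.\<close>
    obtain a' where a': "\<And>i. i < r \<Longrightarrow> a' i \<in> M"
      and e: "\<And>\<theta>. linear_on_M (Fx H) \<theta> \<Longrightarrow> (\<Oplus>i\<in>{..<r}. a i \<otimes> \<theta> (b i \<otimes> m)) = (\<Oplus>i\<in>{..<r}. a' i \<otimes> \<theta> (b i))"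
      using expand_in_basis[OF Hc b, of "{..<r}" a "\<lambda>i. b i \<otimes> m"] a(1) bM m(1) by auto
    \<comment> \<open>The value \<open>\<rho> m \<ominus> \<tau> m\<close> of the new factor is zero
      at \<tau>; dividing by its value \<open>?u\<close> at \<sigma> keeps the
      normalisation.\<close>
    define a'' where "a'' i = inv ?u \<otimes> (a' i \<ominus> \<tau> m \<otimes> a i)" for i
    have val: "(\<Oplus>i\<in>{..<r}. a'' i \<otimes> \<rho> (b i)) = inv ?u \<otimes> ((\<Oplus>i\<in>{..<r}. a i \<otimes> \<rho> (b i)) \<otimes> (\<rho> m \<ominus> \<tau> m))"
      if r: "\<rho> \<in> H" for \<rho>
    proof -
      let ?w = "\<Oplus>i\<in>{..<r}. a i \<otimes> \<rho> (b i)"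
      have w: "?w \<in> M" using a bM r by (intro M_finsum) auto
      have "(\<Oplus>i\<in>{..<r}. a' i \<otimes> \<rho> (b i)) = (\<Oplus>i\<in>{..<r}. a i \<otimes> \<rho> (b i \<otimes> m))"
        using e[OF lin[OF r]] ..
      also have "\<dots> = (\<Oplus>i\<in>{..<r}. a i \<otimes> \<rho> (b i) \<otimes> \<rho> m)"
        using a bM m r by (intro finsum_cong') (auto simp: m_assoc gal_closed)
      also have "\<dots> = ?w \<otimes> \<rho> m"
        using a bM m r by (intro finsum_ldistr[symmetric]) (auto simp: gal_closed)
      finally have 1: "(\<Oplus>i\<in>{..<r}. a' i \<otimes> \<rho> (b i)) = ?w \<otimes> \<rho> m" .
      have 2: "(\<Oplus>i\<in>{..<r}. \<tau> m \<otimes> (a i \<otimes> \<rho> (b i))) = \<tau> m \<otimes> ?w"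
        using a bM m r t by (intro finsum_rdistr[symmetric]) (auto simp: gal_closed)
      have "(\<Oplus>i\<in>{..<r}. a'' i \<otimes> \<rho> (b i))
          = (\<Oplus>i\<in>{..<r}. inv ?u \<otimes> (a' i \<otimes> \<rho> (b i) \<ominus> \<tau> m \<otimes> (a i \<otimes> \<rho> (b i))))"
        unfolding a''_def using a a' bM m r t ui
        by (intro finsum_cong') (auto simp: m_assoc a_minus_def l_distr l_minus gal_closed)
      also have "\<dots> = inv ?u \<otimes> (\<Oplus>i\<in>{..<r}. a' i \<otimes> \<rho> (b i) \<ominus> \<tau> m \<otimes> (a i \<otimes> \<rho> (b i)))"
        using a a' bM m r t ui by (intro finsum_rdistr[symmetric]) (auto simp: gal_closed)
      also have "(\<Oplus>i\<in>{..<r}. a' i \<otimes> \<rho> (b i) \<ominus> \<tau> m \<otimes> (a i \<otimes> \<rho> (b i))) = ?w \<otimes> \<rho> m \<ominus> \<tau> m \<otimes> ?w"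
        unfolding 1[symmetric] 2[symmetric] using a a' bM m r t
        by (intro finsum_minus) (auto simp: gal_closed)
      also have "\<dots> = ?w \<otimes> (\<rho> m \<ominus> \<tau> m)"
        using w m r t M_comm[of "\<tau> m" ?w] by (simp add: a_minus_def r_distr r_minus gal_closed)
      finally show ?thesis .
    qed
    have "a'' i \<in> M" if "i < r" for i using that a a' ui m t by (simp add: a''_def)
    moreover have "(\<Oplus>i\<in>{..<r}. a'' i \<otimes> \<sigma> (b i)) = \<one>"
      using val[OF s] a(2) u ui by simp
    moreover have "(\<Oplus>i\<in>{..<r}. a'' i \<otimes> \<rho> (b i)) = \<zero>" if r: "\<rho> \<in> insert \<tau> S" for \<rho>
    proof -
      have rH: "\<rho> \<in> H" using r insert.prems by blast
      have "(\<Oplus>i\<in>{..<r}. a i \<otimes> \<rho> (b i)) \<otimes> (\<rho> m \<ominus> \<tau> m) = \<zero>"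
      proof (cases "\<rho> = \<tau>")
        case True
        have "(\<Oplus>i\<in>{..<r}. a i \<otimes> \<rho> (b i)) \<in> carrier A"
          using a bM rH by (intro finsum_closed) (auto simp: gal_closed)
        then show ?thesis using True m t by (simp add: a_minus_def r_neg gal_closed)
      next
        case False
        then show ?thesis using a(3) r rH m t by (simp add: gal_closed)
      qed
      then show ?thesis using val[OF rH] ui by simp
    qed
    ultimately show ?case by (intro exI[of _ a'']) auto
  qed
  from this[of "H - {\<sigma>}"] obtain a where "\<And>i. i < r \<Longrightarrow> a i \<in> M" "(\<Oplus>i\<in>{..<r}. a i \<otimes> \<sigma> (b i)) = \<one>"
    "\<forall>\<rho>\<in>H - {\<sigma>}. (\<Oplus>i\<in>{..<r}. a i \<otimes> \<rho> (b i)) = \<zero>"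
    using finite_subset[OF Hc finite_Gal] by auto
  then show ?thesis by (intro that[of a]) auto
qed

lemma in_Gal: "subgroup H \<Gamma> \<Longrightarrow> \<sigma> \<in> H \<Longrightarrow> \<sigma> \<in> carrier \<Gamma>"
  using subgroup.mem_carrier by metis

lemma finite_H: "subgroup H \<Gamma> \<Longrightarrow> finite H"
  using finite_subset[OF _ finite_Gal] subgroup.subset by metis

lemma subgroup_Gal: "subgroup (carrier \<Gamma>) \<Gamma>"
  by (rule Gal.subgroup_self)

section \<open>Eigenspaces of the Galois automorphisms\<close>

definition eig :: "('a \<Rightarrow> 'a) \<Rightarrow> 'a set" where
  "eig \<sigma> = {x \<in> carrier A. \<forall>m\<in>M. x \<otimes> m = \<sigma> m \<otimes> x}"

lemma eigD: "x \<in> eig \<sigma> \<Longrightarrow> x \<in> carrier A" "x \<in> eig \<sigma> \<Longrightarrow> m \<in> M \<Longrightarrow> x \<otimes> m = \<sigma> m \<otimes> x"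
  by (auto simp: eig_def)

lemma eig_scale:
  assumes "x \<in> eig \<sigma>" "m \<in> M" "\<sigma> \<in> carrier \<Gamma>" shows "m \<otimes> x \<in> eig \<sigma>"
proof -
  have "m \<otimes> x \<otimes> m' = \<sigma> m' \<otimes> (m \<otimes> x)" if "m' \<in> M" for m'
  proof -
    have "m \<otimes> x \<otimes> m' = m \<otimes> \<sigma> m' \<otimes> x" using assms that eigD[OF assms(1)] by (simp add: m_assoc)
    also have "\<dots> = \<sigma> m' \<otimes> m \<otimes> x" using M_comm[of m "\<sigma> m'"] assms that by simp
    finally show ?thesis using assms that eigD[OF assms(1)] by (simp add: m_assoc)
  qed
  then show ?thesis using assms eigD(1)[OF assms(1)] by (simp add: eig_def)
qed

lemma eig_mult:
  assumes "x \<in> eig \<sigma>" "y \<in> eig \<rho>" "\<sigma> \<in> carrier \<Gamma>" "\<rho> \<in> carrier \<Gamma>"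
  shows "x \<otimes> y \<in> eig (\<sigma> \<otimes>\<^bsub>\<Gamma>\<^esub> \<rho>)"
proof -
  have c: "x \<in> carrier A" "y \<in> carrier A" using assms eigD by blast+
  have "x \<otimes> y \<otimes> m = \<sigma> (\<rho> m) \<otimes> (x \<otimes> y)" if "m \<in> M" for m
  proof -
    have "x \<otimes> y \<otimes> m = x \<otimes> \<rho> m \<otimes> y" using c that assms eigD(2)[OF assms(2)] by (simp add: m_assoc)
    also have "\<dots> = \<sigma> (\<rho> m) \<otimes> x \<otimes> y" using that assms eigD(2)[OF assms(1)] by simp
    finally show ?thesis using c that assms by (simp add: m_assoc)
  qed
  then show ?thesis using c assms by (simp add: eig_def gal_mult)
qed

lemma eig_one: "m \<in> M \<Longrightarrow> m \<in> eig \<one>\<^bsub>\<Gamma>\<^esub>"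
  using M_comm by (auto simp: eig_def gal_one)

text \<open>Dedekind's argument with the automorphisms themselves as characters of M.\<close>

lemma eig_independent:
  assumes "H \<subseteq> carrier \<Gamma>" "\<And>\<sigma>. \<sigma> \<in> H \<Longrightarrow> y \<sigma> \<in> eig \<sigma>" "(\<Oplus>\<sigma>\<in>H. y \<sigma>) = \<zero>" "\<sigma> \<in> H"
  shows "y \<sigma> = \<zero>"
proof (rule eigenvectors_independent[OF subfield_M, of H "\<lambda>\<sigma>. \<sigma>" y \<sigma>])
  show "finite H" using assms(1) finite_Gal finite_subset by blast
  show "\<exists>k\<in>M. \<sigma> k \<noteq> \<tau> k" if "\<sigma> \<in> H" "\<tau> \<in> H" "\<sigma> \<noteq> \<tau>" for \<sigma> \<tau>
    using gal_eqI[of \<sigma> \<tau>] that assms(1) by blast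
  show "\<sigma> k \<in> M" if "\<sigma> \<in> H" "k \<in> M" for \<sigma> k using that assms(1) by auto
  show "y \<sigma> \<otimes> k = \<sigma> k \<otimes> y \<sigma>" if "\<sigma> \<in> H" "k \<in> M" for \<sigma> k using that assms(2) eigD by blast
  show "y \<sigma> \<in> carrier A" if "\<sigma> \<in> H" for \<sigma> using that assms(2) eigD by blast
qed (use assms in auto)

subsection \<open>Projections to the eigenspaces\<close>

text \<open>The action on the M-bimodule A of the tensor with coefficients \<open>a i\<close>
  against \<open>b i\<close>.\<close>

definition proj :: "nat \<Rightarrow> (nat \<Rightarrow> 'a) \<Rightarrow> (nat \<Rightarrow> 'a) \<Rightarrow> 'a \<Rightarrow> 'a" where
  "proj r a b z = (\<Oplus>i\<in>{..<r}. a i \<otimes> (z \<otimes> b i))"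

context
  fixes r b a \<sigma>
  assumes b: "fix_basis (carrier \<Gamma>) r b"
    and aM: "\<And>i. i < r \<Longrightarrow> a i \<in> M"
    and sep: "\<And>\<rho>. \<rho> \<in> carrier \<Gamma> \<Longrightarrow>
      (\<Oplus>i\<in>{..<r}. a i \<otimes> \<rho> (b i)) = (if \<rho> = \<sigma> then \<one> else \<zero>)"
    and s: "\<sigma> \<in> carrier \<Gamma>"
begin

lemmas basis_M = fix_basis_M[OF b]

text \<open>For the separating tensor T, the tensors T (1 \<otimes> m) and (\<sigma>(m) \<otimes> 1)
  T have equal values under every \<rho>, hence equal coefficients by Artin independence. Inserting
  the F-linear map that sends d to z d gives the eigenvector equation.\<close>

lemma proj_eig:
  assumes z: "z \<in> carrier A" shows "proj r a b z \<in> eig \<sigma>"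
proof -
  have pc: "proj r a b z \<in> carrier A"
    unfolding proj_def using aM basis_M z by (intro finsum_closed) auto
  have "proj r a b z \<otimes> m = \<sigma> m \<otimes> proj r a b z" if m: "m \<in> M" for m
  proof -
    obtain a' where a': "\<And>i. i < r \<Longrightarrow> a' i \<in> M"
      and e: "\<And>\<theta>. linear_on_M (Fx (carrier \<Gamma>)) \<theta> \<Longrightarrow>
        (\<Oplus>i\<in>{..<r}. a i \<otimes> \<theta> (b i \<otimes> m)) = (\<Oplus>i\<in>{..<r}. a' i \<otimes> \<theta> (b i))"
      using expand_in_basis[of "carrier \<Gamma>" r b "{..<r}" a "\<lambda>i. b i \<otimes> m"] b aM basis_M m by auto
    have a'_eq: "a' i = \<sigma> m \<otimes> a i" if i: "i < r" for i
    proof -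
      have "(\<Oplus>i\<in>{..<r}. (a' i \<ominus> \<sigma> m \<otimes> a i) \<otimes> \<rho> (b i)) = \<zero>" if r: "\<rho> \<in> carrier \<Gamma>" for \<rho>
      proof -
        have "(\<Oplus>i\<in>{..<r}. (a' i \<ominus> \<sigma> m \<otimes> a i) \<otimes> \<rho> (b i))
            = (\<Oplus>i\<in>{..<r}. a' i \<otimes> \<rho> (b i) \<ominus> \<sigma> m \<otimes> (a i \<otimes> \<rho> (b i)))"
          using a' aM basis_M m s r
          by (intro finsum_cong') (auto simp: a_minus_def l_distr l_minus m_assoc gal_closed)
        also have "\<dots> = (\<Oplus>i\<in>{..<r}. a' i \<otimes> \<rho> (b i)) \<ominus> (\<Oplus>i\<in>{..<r}. \<sigma> m \<otimes> (a i \<otimes> \<rho> (b i)))"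
          using a' aM basis_M m s r by (intro finsum_minus) (auto simp: gal_closed)
        also have "(\<Oplus>i\<in>{..<r}. a' i \<otimes> \<rho> (b i)) = (\<Oplus>i\<in>{..<r}. a i \<otimes> \<rho> (b i \<otimes> m))"
          using e[OF gal_linear[OF subgroup_Gal r]] ..
        also have "\<dots> = (\<Oplus>i\<in>{..<r}. a i \<otimes> \<rho> (b i) \<otimes> \<rho> m)"
          using aM basis_M m r by (intro finsum_cong') (auto simp: m_assoc gal_closed)
        also have "\<dots> = (\<Oplus>i\<in>{..<r}. a i \<otimes> \<rho> (b i)) \<otimes> \<rho> m"
          using aM basis_M m r by (intro finsum_ldistr[symmetric]) (auto simp: gal_closed)
        also have "(\<Oplus>i\<in>{..<r}. \<sigma> m \<otimes> (a i \<otimes> \<rho> (b i))) = \<sigma> m \<otimes> (\<Oplus>i\<in>{..<r}. a i \<otimes> \<rho> (b i))"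
          using aM basis_M m r s by (intro finsum_rdistr[symmetric]) (auto simp: gal_closed)
        finally show ?thesis using sep[OF r] m s r by (auto simp: a_minus_def r_neg gal_closed)
      qed
      then have "a' i \<ominus> \<sigma> m \<otimes> a i = \<zero>"
        using b basis_M aM a' m s i
        by (intro artin_independence[OF subgroup_Gal, of "{..<r}" b "\<lambda>i. a' i \<ominus> \<sigma> m \<otimes> a i"])
          (auto simp: fix_basis_def)
      then show ?thesis using a'[OF i] aM[OF i] m s by simp
    qed
    \<comment> \<open>The fixed field of the whole group is F, and F is central in A.\<close>
    have lz: "linear_on_M (Fx (carrier \<Gamma>)) (\<lambda>d. z \<otimes> d)"
    proof -
      have "z \<otimes> (f \<otimes> m) = f \<otimes> (z \<otimes> m)" if "f \<in> F" "m \<in> M" for f m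
      proof -
        have f: "f \<in> carrier A" using that(1) F_sub_M by auto
        have "z \<otimes> (f \<otimes> m) = z \<otimes> f \<otimes> m" using f that z by (simp add: m_assoc)
        also have "\<dots> = f \<otimes> z \<otimes> m" using F_center[OF that(1) z] by simp
        finally show ?thesis using f that z by (simp add: m_assoc)
      qed
      then show ?thesis using z Fix_Gal by (auto simp: linear_on_M_def r_distr)
    qed
    have "proj r a b z \<otimes> m = (\<Oplus>i\<in>{..<r}. a i \<otimes> (z \<otimes> b i) \<otimes> m)"
      unfolding proj_def using aM basis_M m z by (intro finsum_ldistr) auto
    also have "\<dots> = (\<Oplus>i\<in>{..<r}. a i \<otimes> (z \<otimes> (b i \<otimes> m)))"
      using aM basis_M m z by (intro finsum_cong') (auto simp: m_assoc)
    also have "\<dots> = (\<Oplus>i\<in>{..<r}. a' i \<otimes> (z \<otimes> b i))" using e[OF lz] .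
    also have "\<dots> = (\<Oplus>i\<in>{..<r}. \<sigma> m \<otimes> (a i \<otimes> (z \<otimes> b i)))"
      using aM basis_M m z s a'_eq by (intro finsum_cong') (auto simp: m_assoc gal_closed)
    also have "\<dots> = \<sigma> m \<otimes> proj r a b z"
      unfolding proj_def using aM basis_M m z s by (intro finsum_rdistr[symmetric]) (auto simp: gal_closed)
    finally show ?thesis .
  qed
  then show ?thesis using pc by (simp add: eig_def)
qed

lemma proj_of_eig:
  assumes "x \<in> eig \<rho>" "\<rho> \<in> carrier \<Gamma>"
  shows "proj r a b x = (if \<rho> = \<sigma> then x else \<zero>)"
proof -
  have x: "x \<in> carrier A" using eigD assms by blast
  have "proj r a b x = (\<Oplus>i\<in>{..<r}. a i \<otimes> \<rho> (b i) \<otimes> x)"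
    unfolding proj_def using aM basis_M x assms eigD(2)[OF assms(1)]
    by (intro finsum_cong') (auto simp: m_assoc gal_closed)
  also have "\<dots> = (\<Oplus>i\<in>{..<r}. a i \<otimes> \<rho> (b i)) \<otimes> x"
    using aM basis_M x assms by (intro finsum_ldistr[symmetric]) (auto simp: gal_closed)
  finally show ?thesis using sep[OF assms(2)] x by simp
qed

lemma proj_finsum:
  assumes "finite I" "f \<in> I \<rightarrow> carrier A"
  shows "proj r a b (finsum A f I) = (\<Oplus>i\<in>I. proj r a b (f i))"
proof (rule additive_finsum[OF carrier_is_subring assms])
  show "proj r a b x \<in> carrier A" if "x \<in> carrier A" for x
    using proj_eig[OF that] eigD by blast
  show "proj r a b (x \<oplus> y) = proj r a b x \<oplus> proj r a b y" if "x \<in> carrier A" "y \<in> carrier A" for x y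
  proof -
    have "proj r a b (x \<oplus> y) = (\<Oplus>i\<in>{..<r}. a i \<otimes> (x \<otimes> b i) \<oplus> a i \<otimes> (y \<otimes> b i))"
      unfolding proj_def using aM basis_M that by (intro finsum_cong') (auto simp: l_distr r_distr)
    then show ?thesis unfolding proj_def using aM basis_M that by (subst (asm) finsum_addf) auto
  qed
qed

lemma proj_decomposition:
  assumes "\<And>\<rho>. \<rho> \<in> carrier \<Gamma> \<Longrightarrow> y \<rho> \<in> eig \<rho>"
  shows "proj r a b (\<Oplus>\<rho>\<in>carrier \<Gamma>. y \<rho>) = y \<sigma>"
proof -
  have yc: "y \<rho> \<in> carrier A" if "\<rho> \<in> carrier \<Gamma>" for \<rho> using assms[OF that] eigD by blast
  have "proj r a b (\<Oplus>\<rho>\<in>carrier \<Gamma>. y \<rho>) = (\<Oplus>\<rho>\<in>carrier \<Gamma>. if \<rho> = \<sigma> then y \<rho> else \<zero>)"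
    using proj_finsum[OF finite_Gal, of y] yc assms proj_of_eig
    by (auto intro!: finsum_cong')
  also have "\<dots> = y \<sigma>"
    using finite_Gal s yc by (subst finsum_eq_single[of _ \<sigma>]) auto
  finally show ?thesis .
qed

text \<open>If every projected element killed y, density could be applied to the family
  \<open>b i \<otimes> y\<close>, which stays independent over F because nonzero elements of M are
  invertible. All \<open>a i\<close> would then vanish, contrary to the value \<one> at
  \<sigma>.\<close>

lemma eig_not_annihilating_aux:
  assumes y: "y \<in> carrier A" "y \<noteq> \<zero>"
  shows "\<exists>x\<in>eig \<sigma>. x \<otimes> y \<noteq> \<zero>"
proof (rule ccontr)
  assume "\<not> ?thesis"
  then have z: "proj r a b z \<otimes> y = \<zero>" if "z \<in> carrier A" for z using proj_eig[OF that] by blast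
  have s0: "(\<Oplus>i\<in>{..<r}. a i \<otimes> (z \<otimes> (b i \<otimes> y))) = \<zero>" if zc: "z \<in> carrier A" for z
  proof -
    have "proj r a b z \<otimes> y = (\<Oplus>i\<in>{..<r}. a i \<otimes> (z \<otimes> b i) \<otimes> y)"
      unfolding proj_def using aM basis_M y zc by (intro finsum_ldistr) auto
    also have "\<dots> = (\<Oplus>i\<in>{..<r}. a i \<otimes> (z \<otimes> (b i \<otimes> y)))"
      using aM basis_M y zc by (intro finsum_cong') (auto simp: m_assoc)
    finally show ?thesis using z[OF zc] by simp
  qed
  have "lin_indep F {..<r} (\<lambda>i. b i \<otimes> y)"
    unfolding lin_indep_def
  proof (intro ballI impI)
    fix k j assume k: "k \<in> {..<r} \<rightarrow> F" "(\<Oplus>i\<in>{..<r}. k i \<otimes> (b i \<otimes> y)) = \<zero>" and j: "j \<in> {..<r}"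
    have kM: "k i \<in> M" if "i < r" for i using that k(1) F_sub_M by blast
    have m: "(\<Oplus>i\<in>{..<r}. k i \<otimes> b i) \<in> M" using kM basis_M by (intro M_finsum) auto
    have "(\<Oplus>i\<in>{..<r}. k i \<otimes> b i) \<otimes> y = (\<Oplus>i\<in>{..<r}. k i \<otimes> b i \<otimes> y)"
      using kM basis_M y by (intro finsum_ldistr) auto
    also have "\<dots> = (\<Oplus>i\<in>{..<r}. k i \<otimes> (b i \<otimes> y))"
      using kM basis_M y by (intro finsum_cong') (auto simp: m_assoc)
    finally have "(\<Oplus>i\<in>{..<r}. k i \<otimes> b i) = \<zero>" using M_cancel[OF m _ y(1)] y(2) k(2) by auto
    then show "k j = \<zero>"
      using b k(1) j Fix_Gal unfolding fix_basis_def lin_indep_def by blast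
  qed
  then have "a i = \<zero>" if "i < r" for i
    using central_simple_density[OF simple center_A, of "{..<r}" "\<lambda>i. b i \<otimes> y" a i] that aM basis_M y s0
    by auto
  then have "(\<Oplus>i\<in>{..<r}. a i \<otimes> \<sigma> (b i)) = \<zero>"
    using basis_M s by (intro add.finprod_one_eqI) (auto simp: gal_closed)
  then show False using sep[OF s] one_neq_zero by simp
qed

end

lemma eig_not_annihilating:
  assumes s: "\<sigma> \<in> carrier \<Gamma>" and y: "y \<in> carrier A" "y \<noteq> \<zero>"
  obtains x where "x \<in> eig \<sigma>" "x \<otimes> y \<noteq> \<zero>"
proof -
  obtain r b where b: "fix_basis (carrier \<Gamma>) r b" using ex_fix_basis[OF order_refl] .
  obtain a where a: "\<And>i. i < r \<Longrightarrow> a i \<in> M" "\<And>\<rho>. \<rho> \<in> carrier \<Gamma> \<Longrightarrow>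
      (\<Oplus>i\<in>{..<r}. a i \<otimes> \<rho> (b i)) = (if \<rho> = \<sigma> then \<one> else \<zero>)"
    using separating_coefficients[OF subgroup_Gal b s] by blast
  show ?thesis using eig_not_annihilating_aux[OF b a s y] that by blast
qed

text \<open>The coefficients are hidden behind this predicate except for the fact that all
  \<open>a i\<close> and \<open>b i\<close> lie in M. That fact keeps ideals of the centralizers
  stable under the projection.\<close>

definition is_projection where
  "is_projection \<sigma> r a b \<longleftrightarrow> (\<forall>i<r. a i \<in> M \<and> b i \<in> M) \<and> (\<forall>x\<in>eig \<sigma>. proj r a b x = x) \<and>
    (\<forall>y. (\<forall>\<rho>\<in>carrier \<Gamma>. y \<rho> \<in> eig \<rho>) \<longrightarrow> proj r a b (\<Oplus>\<rho>\<in>carrier \<Gamma>. y \<rho>) = y \<sigma>)"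

lemma ex_projection:
  assumes s: "\<sigma> \<in> carrier \<Gamma>"
  obtains r a b where "is_projection \<sigma> r a b"
proof -
  obtain r b where b: "fix_basis (carrier \<Gamma>) r b" using ex_fix_basis[OF order_refl] .
  obtain a where a: "\<And>i. i < r \<Longrightarrow> a i \<in> M" "\<And>\<rho>. \<rho> \<in> carrier \<Gamma> \<Longrightarrow>
      (\<Oplus>i\<in>{..<r}. a i \<otimes> \<rho> (b i)) = (if \<rho> = \<sigma> then \<one> else \<zero>)"
    using separating_coefficients[OF subgroup_Gal b s] by blast
  have "is_projection \<sigma> r a b"
    unfolding is_projection_def
    using a(1) fix_basis_M[OF b] proj_of_eig[OF b a s _ s] proj_decomposition[OF b a s] by simp
  then show ?thesis by (rule that)
qed

text \<open>The case y = \<one>. That nonzero eigenvectors are units is shown later, in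
  \<open>eig_unit\<close>.\<close>

lemma ex_eig_nonzero: "\<sigma> \<in> carrier \<Gamma> \<Longrightarrow> \<exists>x. x \<in> eig \<sigma> \<and> x \<noteq> \<zero>"
  by (rule eig_not_annihilating[of \<sigma> \<one>]) (auto simp: one_neq_zero dest: eigD)

subsection \<open>Degrees of fixed fields\<close>

text \<open>The choice is left open so that one member may be replaced by a prescribed eigenvector,
  and so that the elements \<open>conj_elem\<close> are seen to form such a family.\<close>

definition eig_family :: "(('a \<Rightarrow> 'a) \<Rightarrow> 'a) \<Rightarrow> bool" where
  "eig_family z \<longleftrightarrow> (\<forall>\<sigma>\<in>carrier \<Gamma>. z \<sigma> \<in> eig \<sigma> \<and> z \<sigma> \<noteq> \<zero>)"

lemma ex_eig_family: "\<exists>z. eig_family z"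
  unfolding eig_family_def using ex_eig_nonzero by metis

lemma eig_family_carrier: "eig_family z \<Longrightarrow> \<sigma> \<in> carrier \<Gamma> \<Longrightarrow> z \<sigma> \<in> carrier A"
  using eigD by (auto simp: eig_family_def)

lemma eig_family_indep:
  assumes z: "eig_family z" and H: "H \<subseteq> carrier \<Gamma>" shows "lin_indep M H z"
  unfolding lin_indep_def
proof (intro ballI impI)
  fix k \<sigma> assume k: "k \<in> H \<rightarrow> M" "(\<Oplus>\<sigma>\<in>H. k \<sigma> \<otimes> z \<sigma>) = \<zero>" and s: "\<sigma> \<in> H"
  have "k \<sigma> \<otimes> z \<sigma> = \<zero>"
    using z k(1) H by (intro eig_independent[OF H _ k(2) s] eig_scale) (auto simp: eig_family_def)
  then show "k \<sigma> = \<zero>"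
    using M_cancel[of "k \<sigma>" "z \<sigma>"] z k(1) s H eig_family_carrier[OF z] by (auto simp: eig_family_def)
qed

text \<open>With \<open>s = \<Sum> z \<sigma>\<close> over \<open>\<sigma> \<in> H\<close> and a basis \<open>b\<close> of \<open>M\<close> over the fixed field of \<open>H\<close>,
  the elements \<open>w i = s b i\<close> form a second basis of the left \<open>M\<close>-space spanned by the \<open>z \<sigma>\<close>.\<close>

theorem dimension_over_fixed_field:
  assumes H: "subgroup H \<Gamma>" shows "dimension (card H) (Fx H) M"
proof -
  obtain z where z: "eig_family z" using ex_eig_family by blast
  have Hc: "H \<subseteq> carrier \<Gamma>" using subgroup.subset[OF H] .
  have fH: "finite H" using finite_H[OF H] .
  have zc: "z \<sigma> \<in> carrier A" if "\<sigma> \<in> H" for \<sigma> using eig_family_carrier[OF z] that Hc by blast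
  have g: "\<sigma> \<in> carrier \<Gamma>" if "\<sigma> \<in> H" for \<sigma> using that Hc by blast
  note zi = eig_family_indep[OF z Hc]
  obtain r b where b: "fix_basis H r b" and r: "dimension r (Fx H) M" using ex_fix_basis[OF Hc] .
  note bM = fix_basis_M[OF b]
  define w where "w i = (\<Oplus>\<sigma>\<in>H. \<sigma> (b i) \<otimes> z \<sigma>)" for i
  have wc: "w i \<in> carrier A" if "i < r" for i
    unfolding w_def using that bM zc g by (intro finsum_closed) (auto simp: gal_closed)
  have wsum: "(\<Oplus>i\<in>{..<r}. k i \<otimes> w i) = (\<Oplus>\<sigma>\<in>H. (\<Oplus>i\<in>{..<r}. k i \<otimes> \<sigma> (b i)) \<otimes> z \<sigma>)"
    if k: "\<And>i. i < r \<Longrightarrow> k i \<in> M" for k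
  proof -
    have "(\<Oplus>i\<in>{..<r}. k i \<otimes> w i) = (\<Oplus>i\<in>{..<r}. \<Oplus>\<sigma>\<in>H. k i \<otimes> \<sigma> (b i) \<otimes> z \<sigma>)"
    proof (intro finsum_cong'[OF refl])
      fix i assume i: "i \<in> {..<r}"
      have "k i \<otimes> w i = (\<Oplus>\<sigma>\<in>H. k i \<otimes> (\<sigma> (b i) \<otimes> z \<sigma>))"
        unfolding w_def using i k bM zc g fH by (intro finsum_rdistr) (auto simp: gal_closed)
      also have "\<dots> = (\<Oplus>\<sigma>\<in>H. k i \<otimes> \<sigma> (b i) \<otimes> z \<sigma>)"
        using i k bM zc g by (intro finsum_cong') (auto simp: gal_closed m_assoc)
      finally show "k i \<otimes> w i = (\<Oplus>\<sigma>\<in>H. k i \<otimes> \<sigma> (b i) \<otimes> z \<sigma>)" .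
    qed (use k bM zc g in \<open>auto intro!: finsum_closed simp: gal_closed\<close>)
    also have "\<dots> = (\<Oplus>\<sigma>\<in>H. \<Oplus>i\<in>{..<r}. k i \<otimes> \<sigma> (b i) \<otimes> z \<sigma>)"
      using fH k bM zc g by (intro finsum_swap) (auto simp: gal_closed)
    also have "\<dots> = (\<Oplus>\<sigma>\<in>H. (\<Oplus>i\<in>{..<r}. k i \<otimes> \<sigma> (b i)) \<otimes> z \<sigma>)"
      using k bM zc g
      by (intro finsum_cong'[OF refl]) (auto intro!: finsum_ldistr[symmetric] finsum_closed simp: gal_closed)
    finally show ?thesis .
  qed
  have wi: "lin_indep M {..<r} w"
    unfolding lin_indep_def
  proof (intro ballI impI)
    fix k j assume k: "k \<in> {..<r} \<rightarrow> M" "(\<Oplus>i\<in>{..<r}. k i \<otimes> w i) = \<zero>" and j: "j \<in> {..<r}"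
    have "(\<Oplus>\<sigma>\<in>H. (\<Oplus>i\<in>{..<r}. k i \<otimes> \<sigma> (b i)) \<otimes> z \<sigma>) = \<zero>" using wsum[of k] k(2) funcset_mem[OF k(1)] by simp
    moreover have "k i \<in> M" if "i < r" for i using k(1) that by auto
    ultimately have "(\<Oplus>i\<in>{..<r}. k i \<otimes> \<sigma> (b i)) = \<zero>" if "\<sigma> \<in> H" for \<sigma>
      using bM g that
      by (intro lin_indepD[OF zi, of "\<lambda>\<sigma>. \<Oplus>i\<in>{..<r}. k i \<otimes> \<sigma> (b i)"] M_finsum) auto
    then show "k j = \<zero>"
      using b k(1) j bM by (intro artin_independence[OF H, of "{..<r}" b k j]) (auto simp: fix_basis_def)
  qed
  have dz: "dimension (card H) M (lin_span M H z)"
    using zc by (intro lin_indep_dimension[OF subfield_M fH _ zi]) auto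
  have dw: "dimension r M (lin_span M {..<r} w)"
    using lin_indep_dimension[OF subfield_M _ _ wi] wc by auto
  have "w i \<in> lin_span M H z" if "i < r" for i
    unfolding lin_span_def w_def using that bM g by (intro CollectI exI[of _ "\<lambda>\<sigma>. \<sigma> (b i)"]) auto
  then have "r \<le> card H" using lin_indep_card_le[OF subfield_M _ wi dz] by auto
  \<comment> \<open>The separating coefficients invert the passage from \<open>z\<close> to
    \<open>w\<close>; this gives the inequality opposite to the one just proved.\<close>
  moreover have "z \<sigma> \<in> lin_span M {..<r} w" if s: "\<sigma> \<in> H" for \<sigma>
  proof -
    obtain a where a: "\<And>i. i < r \<Longrightarrow> a i \<in> M"
      and e: "\<And>\<rho>. \<rho> \<in> H \<Longrightarrow> (\<Oplus>i\<in>{..<r}. a i \<otimes> \<rho> (b i)) = (if \<rho> = \<sigma> then \<one> else \<zero>)"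
      using separating_coefficients[OF H b s] by blast
    have "(\<Oplus>i\<in>{..<r}. a i \<otimes> w i) = (\<Oplus>\<rho>\<in>H. (\<Oplus>i\<in>{..<r}. a i \<otimes> \<rho> (b i)) \<otimes> z \<rho>)"
      by (rule wsum) (rule a)
    also have "\<dots> = (\<Oplus>\<rho>\<in>H. (if \<rho> = \<sigma> then \<one> else \<zero>) \<otimes> z \<rho>)"
      using e zc by (intro finsum_cong') auto
    also have "\<dots> = z \<sigma>" using fH s zc by (subst finsum_eq_single[of _ \<sigma>]) auto
    finally show ?thesis unfolding lin_span_def using a by (intro CollectI exI[of _ a]) auto
  qed
  then have "card H \<le> r" using lin_indep_card_le[OF subfield_M fH zi dw] by auto
  ultimately show ?thesis using r by simp
qed

lemma card_Gal: "card (carrier \<Gamma>) = n"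
  using dimension_is_inj[OF subfield_F dim_M] dimension_over_fixed_field[OF subgroup_Gal] Fix_Gal by metis

lemma n_pos: "0 < n"
  using card_Gal finite_Gal Gal.one_closed card_gt_0_iff by blast

text \<open>The group \<open>H'\<close> of all automorphisms trivial on the fixed field of H
  contains H and has the same fixed field. By the dimension formula both groups have the same order,
  so they are equal.\<close>

lemma mem_of_fixing:
  assumes H: "subgroup H \<Gamma>" and s: "\<sigma> \<in> carrier \<Gamma>" and fixed: "\<And>f. f \<in> Fx H \<Longrightarrow> \<sigma> f = f"
  shows "\<sigma> \<in> H"
proof -
  define H' where "H' = {\<tau> \<in> carrier \<Gamma>. \<forall>f\<in>Fx H. \<tau> f = f}"
  have HH: "H \<subseteq> H'" using subgroup.subset[OF H] by (auto simp: H'_def FxD)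
  have H': "subgroup H' \<Gamma>"
  proof (rule Gal.subgroupI)
    show "H' \<noteq> {}" using HH subgroup.one_closed[OF H] by blast
    show "inv\<^bsub>\<Gamma>\<^esub> \<tau> \<in> H'" if "\<tau> \<in> H'" for \<tau>
      using that gal_inv(2)[of \<tau>] FxD(1) by (auto simp: H'_def) metis
    show "\<tau> \<otimes>\<^bsub>\<Gamma>\<^esub> \<rho> \<in> H'" if "\<tau> \<in> H'" "\<rho> \<in> H'" for \<tau> \<rho>
      using that FxD(1) by (auto simp: H'_def gal_mult)
  qed (auto simp: H'_def)
  have "Fx H' = Fx H"
  proof
    show "Fx H \<subseteq> Fx H'" using FxD(1) by (auto intro!: FxI simp: H'_def)
    show "Fx H' \<subseteq> Fx H" using HH by (auto simp: Fix_def)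
  qed
  then have "card H = card H'"
    using dimension_is_inj[OF subfield_Fx dimension_over_fixed_field[OF H]] subgroup.subset[OF H]
      dimension_over_fixed_field[OF H'] by simp
  then have "H = H'" using card_subset_eq[OF finite_H[OF H'] HH] by simp
  moreover have "\<sigma> \<in> H'" using s fixed by (simp add: H'_def)
  ultimately show ?thesis by simp
qed

subsection \<open>The crossed product decomposition\<close>

text \<open>In the tower F \<subseteq> M \<subseteq> A the dimensions satisfy n d = n^2.\<close>

lemma dimension_M_A: "dimension n M (carrier A)"
proof -
  have "subalgebra M (carrier A) A" using carrier_is_subalgebra M_simps(1) by blast
  then obtain d where d: "dimension d M (carrier A)"
    using finite_dimension_over[OF subfield_M F_sub_M finite_dimensionI[OF dim_A]] by blast
  have "n * d = n\<^sup>2"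
    using dimension_is_inj[OF subfield_F telescopic_base[OF subfield_F subfield_M dim_M d] dim_A] .
  then have "d = n" using n_pos by (simp add: power2_eq_square)
  then show ?thesis using d by simp
qed

lemma eig_family_span:
  assumes "eig_family z" shows "lin_span M (carrier \<Gamma>) z = carrier A"
  using lin_indep_card_eq[OF subfield_M finite_Gal eig_family_indep[OF assms] dimension_M_A]
    card_Gal eig_family_carrier[OF assms] by auto

lemma decompose:
  assumes "eig_family z" "y \<in> carrier A"
  obtains k where "\<And>\<sigma>. \<sigma> \<in> carrier \<Gamma> \<Longrightarrow> k \<sigma> \<in> M" "y = (\<Oplus>\<sigma>\<in>carrier \<Gamma>. k \<sigma> \<otimes> z \<sigma>)"
  using assms eig_family_span[OF assms(1)] unfolding lin_span_def by blast

text \<open>Put x into an eigenvector family at \<sigma>, expand y in that family and project to the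
  \<sigma>-component: all other terms disappear.\<close>

lemma eig_one_dimensional:
  assumes "\<sigma> \<in> carrier \<Gamma>" "x \<in> eig \<sigma>" "x \<noteq> \<zero>" "y \<in> eig \<sigma>"
  obtains m where "m \<in> M" "y = m \<otimes> x"
proof -
  obtain z0 where z0: "eig_family z0" using ex_eig_family by blast
  define z where "z = z0(\<sigma> := x)"
  have z: "eig_family z" using z0 assms by (auto simp: z_def eig_family_def)
  have yc: "y \<in> carrier A" using eigD assms(4) by blast
  obtain k where k: "\<And>\<sigma>. \<sigma> \<in> carrier \<Gamma> \<Longrightarrow> k \<sigma> \<in> M" "y = (\<Oplus>\<sigma>\<in>carrier \<Gamma>. k \<sigma> \<otimes> z \<sigma>)"
    using decompose[OF z yc] by blast
  have ke: "k \<rho> \<otimes> z \<rho> \<in> eig \<rho>" if "\<rho> \<in> carrier \<Gamma>" for \<rho>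
    using z that k(1) eig_scale by (auto simp: eig_family_def)
  have "y = k \<sigma> \<otimes> z \<sigma>"
  proof -
    obtain r a b where p: "is_projection \<sigma> r a b" using ex_projection[OF assms(1)] .
    then have "proj r a b (\<Oplus>\<rho>\<in>carrier \<Gamma>. k \<rho> \<otimes> z \<rho>) = k \<sigma> \<otimes> z \<sigma>"
      using ke by (simp add: is_projection_def)
    then show ?thesis using p assms(4) k(2) by (simp add: is_projection_def)
  qed
  then show ?thesis using that[of "k \<sigma>"] k(1) assms(1) by (simp add: z_def)
qed

lemma eig_Gal_one: "eig \<one>\<^bsub>\<Gamma>\<^esub> = M"
proof
  show "eig \<one>\<^bsub>\<Gamma>\<^esub> \<subseteq> M"
  proof
    fix y assume "y \<in> eig \<one>\<^bsub>\<Gamma>\<^esub>"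
    then obtain m where "m \<in> M" "y = m \<otimes> \<one>"
      using eig_one_dimensional[OF Gal.one_closed eig_one[OF M_simps(3)] one_neq_zero] by blast
    then show "y \<in> M" by simp
  qed
qed (use eig_one in blast)

text \<open>Some eigenvector x' of \<sigma> does not kill y, and x' is an M-multiple of x.\<close>

lemma eig_mult_nonzero:
  assumes "\<sigma> \<in> carrier \<Gamma>" "x \<in> eig \<sigma>" "x \<noteq> \<zero>" "y \<in> carrier A" "y \<noteq> \<zero>"
  shows "x \<otimes> y \<noteq> \<zero>"
proof
  assume z: "x \<otimes> y = \<zero>"
  obtain x' where x': "x' \<in> eig \<sigma>" "x' \<otimes> y \<noteq> \<zero>" using eig_not_annihilating[OF assms(1,4,5)] .
  obtain m where "m \<in> M" "x' = m \<otimes> x" using eig_one_dimensional[OF assms(1-3) x'(1)] .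
  then have "x' \<otimes> y = m \<otimes> (x \<otimes> y)" using assms eigD by (simp add: m_assoc)
  then show False using z x' \<open>m \<in> M\<close> by simp
qed

text \<open>For a nonzero eigenvector y of the inverse of \<sigma>, both x y and y x are nonzero
  elements of M, hence invertible. This gives a right and a left inverse of x, which then
  agree.\<close>

lemma eig_unit:
  assumes s: "\<sigma> \<in> carrier \<Gamma>" and x: "x \<in> eig \<sigma>" "x \<noteq> \<zero>"
  shows "x \<in> Units A"
proof -
  let ?\<tau> = "inv\<^bsub>\<Gamma>\<^esub> \<sigma>"
  have t: "?\<tau> \<in> carrier \<Gamma>" using s by simp
  obtain y where y: "y \<in> eig ?\<tau>" "y \<noteq> \<zero>" using ex_eig_nonzero[OF t] by blast
  have c: "x \<in> carrier A" "y \<in> carrier A" using x y eigD by blast+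
  have "x \<otimes> y \<in> M" "y \<otimes> x \<in> M"
    using eig_mult[OF x(1) y(1) s t] eig_mult[OF y(1) x(1) t s] s eig_Gal_one by auto
  moreover have "x \<otimes> y \<noteq> \<zero>" "y \<otimes> x \<noteq> \<zero>"
    using eig_mult_nonzero[OF s x c(2) y(2)] eig_mult_nonzero[OF t y c(1) x(2)] .
  ultimately have i: "x \<otimes> y \<otimes> inv (x \<otimes> y) = \<one>" "inv (y \<otimes> x) \<otimes> (y \<otimes> x) = \<one>"
    "inv (x \<otimes> y) \<in> carrier A" "inv (y \<otimes> x) \<in> carrier A"
    using M_inv by auto
  let ?r = "y \<otimes> inv (x \<otimes> y)" and ?l = "inv (y \<otimes> x) \<otimes> y"
  have rl: "x \<otimes> ?r = \<one>" "?l \<otimes> x = \<one>" "?r \<in> carrier A" "?l \<in> carrier A"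
    using i c by (simp_all add: m_assoc)
  have "?l = ?l \<otimes> (x \<otimes> ?r)" unfolding rl(1) using rl(4) by simp
  also have "\<dots> = ?l \<otimes> x \<otimes> ?r" by (rule m_assoc[symmetric]) (use rl c in auto)
  also have "\<dots> = ?r" unfolding rl(2) using rl(3) by simp
  finally have "?r \<otimes> x = \<one>" using rl(2) by simp
  then show ?thesis using rl c unfolding Units_def by blast
qed

lemma eig_conj:
  assumes "\<sigma> \<in> carrier \<Gamma>" "x \<in> eig \<sigma>" "x \<noteq> \<zero>" "m \<in> M"
  shows "x \<otimes> m \<otimes> inv x = \<sigma> m"
  using eigD(2)[OF assms(2,4)] eig_unit[OF assms(1-3)] assms eigD(1)[OF assms(2)]
  by (simp add: m_assoc)

lemma eig_inv:
  assumes s: "\<sigma> \<in> carrier \<Gamma>" and x: "x \<in> eig \<sigma>" "x \<noteq> \<zero>"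
  shows "inv x \<in> eig (inv\<^bsub>\<Gamma>\<^esub> \<sigma>)"
proof -
  have u: "x \<in> Units A" using eig_unit[OF assms] .
  have "inv x \<otimes> m = (inv\<^bsub>\<Gamma>\<^esub> \<sigma>) m \<otimes> inv x" if m: "m \<in> M" for m
  proof -
    let ?m = "(inv\<^bsub>\<Gamma>\<^esub> \<sigma>) m"
    have mM: "?m \<in> M" using s m by simp
    have "x \<otimes> ?m \<otimes> inv x = m" using eig_conj[OF assms mM] gal_inv(1)[OF s m] by simp
    then have "inv x \<otimes> m = inv x \<otimes> (x \<otimes> ?m \<otimes> inv x)" by simp
    also have "\<dots> = inv x \<otimes> x \<otimes> (?m \<otimes> inv x)"
      using Units_inv_closed[OF u] Units_closed[OF u] mM by (simp add: m_assoc del: Units_l_inv)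
    also have "\<dots> = ?m \<otimes> inv x" using u mM by simp
    finally show ?thesis .
  qed
  then show ?thesis using u by (simp add: eig_def)
qed

text \<open>The unit eigenvectors show that the choice in \<open>conj_elem\<close> is made from a
  nonempty set; the conjugation rule is then rewritten as the eigenvector equation.\<close>

lemma
  assumes "\<sigma> \<in> carrier \<Gamma>"
  shows conj_elem_eig: "conj_elem A M \<sigma> \<in> eig \<sigma>" and conj_elem_nonzero: "conj_elem A M \<sigma> \<noteq> \<zero>"
proof -
  let ?x = "conj_elem A M \<sigma>"
  obtain y where "y \<in> eig \<sigma>" "y \<noteq> \<zero>" using ex_eig_nonzero[OF assms] by blast
  then have "\<exists>x. x \<in> Units A \<and> (\<forall>a\<in>M. x \<otimes> a \<otimes> inv x = \<sigma> a)"
    using eig_unit[OF assms] eig_conj[OF assms] by blast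
  from someI_ex[OF this]
  have x: "?x \<in> Units A" "\<And>a. a \<in> M \<Longrightarrow> ?x \<otimes> a \<otimes> inv ?x = \<sigma> a"
    unfolding conj_elem_def by blast+
  have "?x \<otimes> a = \<sigma> a \<otimes> ?x" if a: "a \<in> M" for a
  proof -
    have "\<sigma> a \<otimes> ?x = ?x \<otimes> a \<otimes> inv ?x \<otimes> ?x" using x(2)[OF a] by simp
    also have "\<dots> = ?x \<otimes> a" using x(1) Units_closed[OF x(1)] a by (simp add: m_assoc)
    finally show ?thesis by simp
  qed
  then show "?x \<in> eig \<sigma>" using x(1) by (auto simp: eig_def)
  show "?x \<noteq> \<zero>"
  proof
    assume "?x = \<zero>"
    then have "\<zero> \<otimes> inv ?x = \<one>" using Units_r_inv[OF x(1)] by simp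
    then show False using Units_inv_closed[OF x(1)] one_neq_zero by simp
  qed
qed

lemma eig_family_conj_elem: "eig_family (conj_elem A M)"
  using conj_elem_eig conj_elem_nonzero by (simp add: eig_family_def)

lemma conj_span_eq: "conj_span A M (carrier \<Gamma>) = carrier A"
proof
  let ?x = "conj_elem A M"
  have xc: "?x ` carrier \<Gamma> \<subseteq> carrier A" using eig_family_carrier[OF eig_family_conj_elem] by auto
  show "conj_span A M (carrier \<Gamma>) \<subseteq> carrier A"
  proof -
    have "Span M Us \<subseteq> carrier A" if "Us \<in> lists (?x ` carrier \<Gamma>)" for Us
      using that xc subfieldE(3)[OF subfield_M] by (intro Span_in_carrier) auto
    then show ?thesis unfolding conj_span_def by blast
  qed
  obtain ss where ss: "set ss = carrier \<Gamma>" "distinct ss" using finite_distinct_list[OF finite_Gal] by blast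
  have "Span M (map ?x ss) = carrier A"
    using Span_map_eq[OF subfield_M ss(2), of ?x] xc ss(1) eig_family_span[OF eig_family_conj_elem] by auto
  moreover have "map ?x ss \<in> lists (?x ` carrier \<Gamma>)" using ss(1) by (auto simp: in_lists_conv_set)
  ultimately show "carrier A \<subseteq> conj_span A M (carrier \<Gamma>)" unfolding conj_span_def by blast
qed

section \<open>Centralizers of fixed fields\<close>

text \<open>As a centralizer the set is visibly a subring; that the eigenvectors of H span it over M
  is \<open>cent_span\<close>.\<close>

definition cent :: "('a \<Rightarrow> 'a) set \<Rightarrow> 'a set" where
  "cent H = {y \<in> carrier A. \<forall>f\<in>Fx H. y \<otimes> f = f \<otimes> y}"

lemma centD: "y \<in> cent H \<Longrightarrow> y \<in> carrier A" "y \<in> cent H \<Longrightarrow> f \<in> Fx H \<Longrightarrow> y \<otimes> f = f \<otimes> y"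
  by (auto simp: cent_def)

lemma centI: "y \<in> carrier A \<Longrightarrow> (\<And>f. f \<in> Fx H \<Longrightarrow> y \<otimes> f = f \<otimes> y) \<Longrightarrow> y \<in> cent H"
  by (simp add: cent_def)

lemma subring_cent: "subring (cent H) A"
proof (rule subringI)
  show "y \<otimes> y' \<in> cent H" if y: "y \<in> cent H" "y' \<in> cent H" for y y'
  proof -
    have "y \<otimes> y' \<otimes> f = f \<otimes> (y \<otimes> y')" if f: "f \<in> Fx H" for f
    proof -
      have "y \<otimes> y' \<otimes> f = y \<otimes> f \<otimes> y'"
        using centD(1)[OF y(1)] centD[OF y(2)] FxD(2)[OF f] f by (simp add: m_assoc)
      then show ?thesis
        using centD(1)[OF y(2)] centD[OF y(1)] FxD(2)[OF f] f by (simp add: m_assoc)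
    qed
    then show ?thesis using centD(1)[OF y(1)] centD(1)[OF y(2)] by (intro centI) simp_all
  qed
  show "\<ominus> y \<in> cent H" if y: "y \<in> cent H" for y
  proof (rule centI)
    show "\<ominus> y \<otimes> f = f \<otimes> \<ominus> y" if f: "f \<in> Fx H" for f
      using centD(2)[OF y f] centD(1)[OF y] FxD(2)[OF f] by (simp add: l_minus r_minus)
  qed (use centD(1)[OF y] in simp)
  show "y \<oplus> y' \<in> cent H" if y: "y \<in> cent H" "y' \<in> cent H" for y y'
  proof (rule centI)
    show "(y \<oplus> y') \<otimes> f = f \<otimes> (y \<oplus> y')" if f: "f \<in> Fx H" for f
      using centD(2)[OF y(1) f] centD(2)[OF y(2) f] centD(1)[OF y(1)] centD(1)[OF y(2)] FxD(2)[OF f]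
      by (simp add: l_distr r_distr)
  qed (use centD(1)[OF y(1)] centD(1)[OF y(2)] in simp)
  show "\<one> \<in> cent H" using FxD(2) by (intro centI) auto
qed (use centD(1) in blast)

lemma M_sub_cent: "M \<subseteq> cent H"
  using M_comm FxD(1) by (auto simp: cent_def)

lemma eig_sub_cent:
  assumes "\<sigma> \<in> H" "x \<in> eig \<sigma>" shows "x \<in> cent H"
  using eigD(1)[OF assms(2)] eigD(2)[OF assms(2) FxD(1)] FxD(3)[OF _ assms(1)] by (auto simp: cent_def)

lemma inv_in_cent:
  assumes "u \<in> Units A" "u \<in> cent H" shows "inv u \<in> cent H"
proof -
  have "inv u \<otimes> f = f \<otimes> inv u" if f: "f \<in> Fx H" for f
  proof -
    have fc: "f \<in> carrier A" using FxD(2)[OF f] .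
    have "u \<otimes> f \<otimes> inv u = f"
      using conj_cancel[OF assms(1) fc fc] centD(2)[OF assms(2) f] by simp
    then have "inv u \<otimes> f = inv u \<otimes> (u \<otimes> f \<otimes> inv u)" by simp
    also have "\<dots> = inv u \<otimes> u \<otimes> (f \<otimes> inv u)"
      using assms(1) Units_closed[OF assms(1)] fc by (simp add: m_assoc del: Units_l_inv)
    finally show ?thesis using assms(1) fc by simp
  qed
  then show ?thesis using assms(1) by (simp add: cent_def)
qed

text \<open>Taking the commutator with f in \<open>Fx H\<close> multiplies the coefficient at \<rho>
  by f - \<rho>(f). For \<sigma> outside H some such f is moved by \<sigma>, and independence over M
  forces the coefficient to vanish.\<close>

lemma cent_coeff_zero:
  assumes H: "subgroup H \<Gamma>" and z: "eig_family z" and k: "\<And>\<sigma>. \<sigma> \<in> carrier \<Gamma> \<Longrightarrow> k \<sigma> \<in> M"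
    and y: "(\<Oplus>\<sigma>\<in>carrier \<Gamma>. k \<sigma> \<otimes> z \<sigma>) \<in> cent H" and s: "\<sigma> \<in> carrier \<Gamma>" "\<sigma> \<notin> H"
  shows "k \<sigma> = \<zero>"
proof -
  obtain f where f: "f \<in> Fx H" "\<sigma> f \<noteq> f" using mem_of_fixing[OF H s(1)] s(2) by blast
  note fM = FxD(1)[OF f(1)]
  have zc: "z \<rho> \<in> carrier A" if "\<rho> \<in> carrier \<Gamma>" for \<rho> using eig_family_carrier[OF z that] .
  let ?S = "\<Oplus>\<sigma>\<in>carrier \<Gamma>. k \<sigma> \<otimes> z \<sigma>"
  have "(\<Oplus>\<rho>\<in>carrier \<Gamma>. (f \<ominus> \<rho> f) \<otimes> k \<rho> \<otimes> z \<rho>)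
      = (\<Oplus>\<rho>\<in>carrier \<Gamma>. f \<otimes> (k \<rho> \<otimes> z \<rho>) \<ominus> k \<rho> \<otimes> z \<rho> \<otimes> f)"
  proof (intro finsum_cong'[OF refl])
    fix \<rho> assume r: "\<rho> \<in> carrier \<Gamma>"
    have "z \<rho> \<otimes> f = \<rho> f \<otimes> z \<rho>" using z r eigD(2) fM by (simp add: eig_family_def)
    then have "k \<rho> \<otimes> z \<rho> \<otimes> f = \<rho> f \<otimes> k \<rho> \<otimes> z \<rho>"
    proof -
      have "k \<rho> \<otimes> z \<rho> \<otimes> f = k \<rho> \<otimes> (z \<rho> \<otimes> f)" using k[OF r] zc[OF r] fM by (simp add: m_assoc)
      also have "\<dots> = k \<rho> \<otimes> \<rho> f \<otimes> z \<rho>"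
        unfolding \<open>z \<rho> \<otimes> f = \<rho> f \<otimes> z \<rho>\<close> using k[OF r] zc[OF r] fM r by (simp add: m_assoc gal_closed)
      finally show ?thesis using M_comm[of "k \<rho>" "\<rho> f"] k[OF r] fM r by simp
    qed
    then show "(f \<ominus> \<rho> f) \<otimes> k \<rho> \<otimes> z \<rho> = f \<otimes> (k \<rho> \<otimes> z \<rho>) \<ominus> k \<rho> \<otimes> z \<rho> \<otimes> f"
      using k[OF r] zc[OF r] fM r by (simp add: a_minus_def l_distr l_minus m_assoc gal_closed)
  qed (use k zc fM in auto)
  also have "\<dots> = (\<Oplus>\<rho>\<in>carrier \<Gamma>. f \<otimes> (k \<rho> \<otimes> z \<rho>)) \<ominus> (\<Oplus>\<rho>\<in>carrier \<Gamma>. k \<rho> \<otimes> z \<rho> \<otimes> f)"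
    using k zc fM by (intro finsum_minus) auto
  also have "(\<Oplus>\<rho>\<in>carrier \<Gamma>. f \<otimes> (k \<rho> \<otimes> z \<rho>)) = f \<otimes> ?S"
    using k zc fM finite_Gal by (intro finsum_rdistr[symmetric]) auto
  also have "(\<Oplus>\<rho>\<in>carrier \<Gamma>. k \<rho> \<otimes> z \<rho> \<otimes> f) = ?S \<otimes> f"
    using k zc fM finite_Gal by (intro finsum_ldistr[symmetric]) auto
  also have "f \<otimes> ?S \<ominus> ?S \<otimes> f = \<zero>"
    using centD(2)[OF y f(1)] centD(1)[OF y] fM by (simp add: a_minus_def r_neg)
  finally have "(f \<ominus> \<sigma> f) \<otimes> k \<sigma> = \<zero>"
    using k fM s(1) by (intro lin_indepD[OF eig_family_indep[OF z order_refl],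
        of "\<lambda>\<rho>. (f \<ominus> \<rho> f) \<otimes> k \<rho>" \<sigma>]) auto
  moreover have "f \<ominus> \<sigma> f \<noteq> \<zero>"
    using f(2) fM s(1) by (metis M_simps(1) gal_closed r_right_minus_eq)
  ultimately show ?thesis using M_cancel[of "f \<ominus> \<sigma> f" "k \<sigma>"] k[OF s(1)] fM s(1) by auto
qed

text \<open>This takes the place of a double centralizer argument: an explicit M-basis of the
  centralizer yields its dimension at once.\<close>

lemma cent_span:
  assumes H: "subgroup H \<Gamma>" and z: "eig_family z" shows "lin_span M H z = cent H"
proof
  have Hc: "H \<subseteq> carrier \<Gamma>" using subgroup.subset[OF H] .
  have ze: "z \<sigma> \<in> cent H" if "\<sigma> \<in> H" for \<sigma>
    using z that Hc eig_sub_cent by (auto simp: eig_family_def)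
  have zc: "z \<sigma> \<in> carrier A" if "\<sigma> \<in> carrier \<Gamma>" for \<sigma> using eig_family_carrier[OF z that] .
  show "lin_span M H z \<subseteq> cent H"
  proof
    fix y assume "y \<in> lin_span M H z"
    then obtain k where k: "k \<in> H \<rightarrow> M" "y = (\<Oplus>\<sigma>\<in>H. k \<sigma> \<otimes> z \<sigma>)"
      unfolding lin_span_def by blast
    have "k \<sigma> \<otimes> z \<sigma> \<in> cent H" if s: "\<sigma> \<in> H" for \<sigma>
      using subringE(6)[OF subring_cent _ ze[OF s]] funcset_mem[OF k(1) s] M_sub_cent by blast
    then show "y \<in> cent H" unfolding k(2) by (rule subring_finsum_closed[OF subring_cent])
  qed
  show "cent H \<subseteq> lin_span M H z"
  proof
    fix y assume y: "y \<in> cent H"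
    obtain k where k: "\<And>\<sigma>. \<sigma> \<in> carrier \<Gamma> \<Longrightarrow> k \<sigma> \<in> M" "y = (\<Oplus>\<sigma>\<in>carrier \<Gamma>. k \<sigma> \<otimes> z \<sigma>)"
      using decompose[OF z centD(1)[OF y]] by blast
    have k0: "k \<sigma> = \<zero>" if "\<sigma> \<in> carrier \<Gamma>" "\<sigma> \<notin> H" for \<sigma>
      using cent_coeff_zero[OF H z, of k \<sigma>] k that y by simp
    have "y = (\<Oplus>\<sigma>\<in>H. k \<sigma> \<otimes> z \<sigma>)"
      unfolding k(2) using k(1) zc k0 Hc finite_Gal
      by (intro add.finprod_mono_neutral_cong_right) auto
    then show "y \<in> lin_span M H z" unfolding lin_span_def using k(1) Hc by blast
  qed
qed

lemma dimension_M_cent: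
  assumes H: "subgroup H \<Gamma>" shows "dimension (card H) M (cent H)"
proof -
  obtain z where z: "eig_family z" using ex_eig_family by blast
  have Hc: "H \<subseteq> carrier \<Gamma>" using subgroup.subset[OF H] .
  show ?thesis
    using lin_indep_dimension[OF subfield_M finite_H[OF H] _ eig_family_indep[OF z Hc]]
      cent_span[OF H z] eig_family_carrier[OF z] Hc by auto
qed

lemma cent_one: "cent {\<one>\<^bsub>\<Gamma>\<^esub>} = M"
proof -
  have "cent {\<one>\<^bsub>\<Gamma>\<^esub>} \<subseteq> M"
  proof
    fix y assume y: "y \<in> cent {\<one>\<^bsub>\<Gamma>\<^esub>}"
    have "Fx {\<one>\<^bsub>\<Gamma>\<^esub>} = M" by (auto simp: Fix_def gal_one)
    then have "y \<in> eig \<one>\<^bsub>\<Gamma>\<^esub>" using y by (auto simp: cent_def eig_def gal_one)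
    then show "y \<in> M" using eig_Gal_one by simp
  qed
  then show ?thesis using M_sub_cent by blast
qed

lemma cent_Gal: "cent (carrier \<Gamma>) = carrier A"
  using Fix_Gal F_center by (auto simp: cent_def)

text \<open>The projections multiply by elements of M only, and M lies in the centralizer, so they
  map an ideal into itself. A nonzero coefficient of a member of the ideal thus puts the unit
  \<open>k \<sigma> \<otimes> z \<sigma>\<close> into the ideal. Since
  \<open>cent_coeff_zero\<close> places \<sigma> in H, the inverse of this unit lies in the ring as
  well.\<close>

lemma simple_cent:
  assumes H: "subgroup H \<Gamma>" shows "simple_ring (A\<lparr>carrier := cent H\<rparr>)"
proof -
  let ?B = "A\<lparr>carrier := cent H\<rparr>"
  interpret B: ring ?B by (rule subring_is_ring[OF subring_cent])
  have "I = {\<zero>} \<or> I = cent H" if I: "ideal I ?B" for I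
  proof (rule disjCI)
    interpret I: ideal I ?B by (rule I)
    assume "I \<noteq> cent H"
    have IB: "I \<subseteq> cent H" using I.a_subset by simp
    have I_add: "I \<subseteq> carrier A" "\<zero> \<in> I" "\<And>v w. v \<in> I \<Longrightarrow> w \<in> I \<Longrightarrow> v \<oplus> w \<in> I"
      using IB centD(1) additive_subgroup.zero_closed[OF I.is_additive_subgroup] I.a_closed by auto
    have no_unit: "u \<notin> I" if u: "u \<in> Units A" "u \<in> cent H" for u
    proof
      assume uI: "u \<in> I"
      have "\<one> \<in> I" using I.I_l_closed[OF uI, of "inv u"] inv_in_cent[OF u] u(1) by simp
      then have "I = cent H" using I.one_imp_carrier by simp
      then show False using \<open>I \<noteq> cent H\<close> by simp
    qed
    have "y = \<zero>" if yI: "y \<in> I" for y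
    proof -
      have yB: "y \<in> cent H" using yI IB by blast
      obtain z where z: "eig_family z" using ex_eig_family by blast
      obtain k where k: "\<And>\<sigma>. \<sigma> \<in> carrier \<Gamma> \<Longrightarrow> k \<sigma> \<in> M" "y = (\<Oplus>\<sigma>\<in>carrier \<Gamma>. k \<sigma> \<otimes> z \<sigma>)"
        using decompose[OF z centD(1)[OF yB]] by blast
      have "k \<sigma> = \<zero>" if s: "\<sigma> \<in> carrier \<Gamma>" for \<sigma>
      proof (rule ccontr)
        assume ks: "k \<sigma> \<noteq> \<zero>"
        have "(\<Oplus>\<sigma>\<in>carrier \<Gamma>. k \<sigma> \<otimes> z \<sigma>) \<in> cent H" using yB k(2) by simp
        then have sH: "\<sigma> \<in> H"
          using cent_coeff_zero[OF H z, of k \<sigma>] k(1) s ks by blast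
        let ?v = "k \<sigma> \<otimes> z \<sigma>"
        have ze: "z \<rho> \<in> eig \<rho>" "z \<rho> \<noteq> \<zero>" "z \<rho> \<in> carrier A" if "\<rho> \<in> carrier \<Gamma>" for \<rho>
          using z that eig_family_carrier[OF z] by (auto simp: eig_family_def)
        have ve: "k \<rho> \<otimes> z \<rho> \<in> eig \<rho>" if "\<rho> \<in> carrier \<Gamma>" for \<rho>
          using eig_scale[OF ze(1)[OF that] k(1)[OF that] that] .
        have v0: "?v \<noteq> \<zero>" using M_cancel[of "k \<sigma>" "z \<sigma>"] k(1)[OF s] ks ze[OF s] by blast
        have "?v \<in> I"
        proof -
          obtain r a b where p: "is_projection \<sigma> r a b" using ex_projection[OF s] .
          then have "proj r a b y = ?v"
            unfolding k(2) using ve by (simp add: is_projection_def)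
          moreover have "proj r a b y \<in> I"
            unfolding proj_def
          proof (rule finsum_in_additive[OF I_add])
            fix i assume i: "i \<in> {..<r}"
            have "a i \<in> cent H" "b i \<in> cent H" using p i M_sub_cent by (auto simp: is_projection_def)
            then show "a i \<otimes> (y \<otimes> b i) \<in> I"
              using I.I_l_closed[OF I.I_r_closed[OF yI, of "b i"], of "a i"] by simp
          qed
          ultimately show ?thesis by simp
        qed
        then show False
          using no_unit[OF eig_unit[OF s ve[OF s] v0] eig_sub_cent[OF sH ve[OF s]]] by blast
      qed
      then show ?thesis unfolding k(2) using eig_family_carrier[OF z] by (intro add.finprod_one_eqI) simp
    qed
    then show "I = {\<zero>}" using I_add(2) by blast
  qed
  then show ?thesis unfolding simple_ring_def using B.ring_axioms one_neq_zero by simp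
qed

lemma Fx_sub_cent: "Fx H \<subseteq> cent H"
  using Fx_sub_M M_sub_cent by blast

text \<open>Commuting with M places y in the eigenspace of the identity, which is M; commuting with
  a unit eigenvector of \<sigma> in H then says that \<sigma> fixes y.\<close>

lemma center_cent:
  assumes H: "subgroup H \<Gamma>" shows "center (A\<lparr>carrier := cent H\<rparr>) = Fx H"
proof
  show "Fx H \<subseteq> center (A\<lparr>carrier := cent H\<rparr>)"
    using Fx_sub_cent[of H] centD(2) by (auto simp: center_def)
  show "center (A\<lparr>carrier := cent H\<rparr>) \<subseteq> Fx H"
  proof
    fix y assume "y \<in> center (A\<lparr>carrier := cent H\<rparr>)"
    then have y: "y \<in> cent H" "\<And>x. x \<in> cent H \<Longrightarrow> y \<otimes> x = x \<otimes> y" by (auto simp: center_def)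
    have "y \<in> eig \<one>\<^bsub>\<Gamma>\<^esub>" using centD(1)[OF y(1)] y(2) M_sub_cent by (auto simp: eig_def gal_one)
    then have yM: "y \<in> M" using eig_Gal_one by simp
    show "y \<in> Fx H"
    proof (rule FxI[OF yM])
      fix \<sigma> assume s: "\<sigma> \<in> H"
      note sG = in_Gal[OF H s]
      obtain x where x: "x \<in> eig \<sigma>" "x \<noteq> \<zero>" using ex_eig_nonzero[OF sG] by blast
      have "x \<otimes> y = y \<otimes> x" using y(2)[OF eig_sub_cent[OF s x(1)]] by simp
      then have "x \<otimes> y \<otimes> inv x = y"
        using conj_cancel[OF eig_unit[OF sG x], of y y] yM by auto
      then show "\<sigma> y = y" using eig_conj[OF sG x yM] by simp
    qed
  qed
qed

text \<open>The degree comes from the tower of \<open>Fx H\<close>, M and \<open>cent H\<close>,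
  both steps of which have dimension \<open>card H\<close>.\<close>

theorem central_simple_cent:
  assumes H: "subgroup H \<Gamma>"
  shows "central_simple_degree (A\<lparr>carrier := cent H\<rparr>) (Fx H) (card H)"
proof -
  let ?B = "A\<lparr>carrier := cent H\<rparr>"
  interpret B: ring ?B by (rule subring_is_ring[OF subring_cent])
  note Z = subfield_Fx[OF subgroup.subset[OF H]]
  have "dimension (card H * card H) (Fx H) (cent H)"
    using telescopic_base[OF Z subfield_M dimension_over_fixed_field[OF H] dimension_M_cent[OF H]] .
  then have d: "B.dimension ((card H)\<^sup>2) (Fx H) (cent H)"
    using dimension_subring[OF subring_cent Z _ order_refl Fx_sub_cent] by (simp add: power2_eq_square)
  then show ?thesis
    using simple_cent[OF H] center_cent[OF H] subfield_of_subring[OF subring_cent Z Fx_sub_cent]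
      B.finite_dimensionI[OF d]
    by (simp add: central_simple_degree_def central_simple_def)
qed

text \<open>In the tower of \<open>Fx H'\<close>, \<open>Fx H\<close> and M the dimension formula
  applies to the upper step and to the whole; cancelling the order of H leaves q.\<close>

lemma dimension_fixed_fields:
  assumes H: "subgroup H \<Gamma>" and H': "subgroup H' \<Gamma>" and sub: "H \<subseteq> H'"
    and card: "card H' = q * card H"
  shows "dimension q (Fx H') (Fx H)"
proof -
  note Z = subfield_Fx[OF subgroup.subset[OF H]] and Z' = subfield_Fx[OF subgroup.subset[OF H']]
  have le: "Fx H' \<subseteq> Fx H" using sub by (auto simp: Fix_def)
  obtain d where d: "dimension d (Fx H') (Fx H)"
    using subalbegra_incl_imp_finite_dimension[OF Z' finite_dimensionI[OF dimension_over_fixed_field[OF H']]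
        subalgebra_subfield[OF Z' Z le] Fx_sub_M] by blast
  have "d * card H = card H'"
    using dimension_is_inj[OF Z' telescopic_base[OF Z' Z d dimension_over_fixed_field[OF H]]
        dimension_over_fixed_field[OF H']] .
  moreover have "card H \<noteq> 0" using finite_H[OF H] subgroup.one_closed[OF H] by auto
  ultimately have "d = q" using card by simp
  then show ?thesis using d by simp
qed

section \<open>The cyclic step\<close>

lemma Units_nonzero: "u \<in> Units A \<Longrightarrow> u \<noteq> \<zero>"
proof
  assume "u \<in> Units A" "u = \<zero>"
  then have "\<zero> \<otimes> inv \<zero> = \<one>" "inv \<zero> \<in> carrier A" using Units_r_inv[of u] Units_inv_closed[of u] by auto
  then show False using one_neq_zero by simp
qed

lemma eig_pow:
  assumes "\<sigma> \<in> carrier \<Gamma>" "x \<in> eig \<sigma>"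
  shows "x [^] (j::nat) \<in> eig (\<sigma> [^]\<^bsub>\<Gamma>\<^esub> j)"
proof (induction j)
  case 0
  then show ?case using eig_one[of \<one>] by simp
next
  case (Suc j)
  then show ?case using eig_mult[OF Suc assms(2) _ assms(1)] assms(1) by simp
qed

lemma gal_pow_Suc:
  assumes "\<sigma> \<in> carrier \<Gamma>" "m \<in> M"
  shows "(\<sigma> [^]\<^bsub>\<Gamma>\<^esub> Suc j) m = (\<sigma> [^]\<^bsub>\<Gamma>\<^esub> j) (\<sigma> m)"
  using assms by (simp add: gal_mult)

text \<open>Pushing f through the inverse of w turns it into \<tau>^(-1)(f), which again lies in the
  fixed field and so passes y; w turns it back into f. The lemma is applied both to x and to its
  inverse.\<close>

lemma conj_cent:
  assumes t: "\<tau> \<in> carrier \<Gamma>" and w: "w \<in> eig \<tau>" "w \<noteq> \<zero>"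
    and stable: "\<And>f. f \<in> Fx H \<Longrightarrow> (inv\<^bsub>\<Gamma>\<^esub> \<tau>) f \<in> Fx H" and y: "y \<in> cent H"
  shows "w \<otimes> y \<otimes> inv w \<in> cent H"
proof (rule centI)
  have wc: "w \<in> carrier A" "inv w \<in> carrier A" using eig_unit[OF t w] by auto
  note yc = centD(1)[OF y]
  show "w \<otimes> y \<otimes> inv w \<in> carrier A" using wc yc by simp
  fix f assume f: "f \<in> Fx H"
  let ?f = "(inv\<^bsub>\<Gamma>\<^esub> \<tau>) f"
  note f' = stable[OF f]
  have fc: "f \<in> carrier A" "?f \<in> carrier A" using FxD(2) f f' by auto
  have "w \<otimes> y \<otimes> inv w \<otimes> f = w \<otimes> y \<otimes> (inv w \<otimes> f)" using wc yc fc by (simp add: m_assoc)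
  also have "inv w \<otimes> f = ?f \<otimes> inv w" using eigD(2)[OF eig_inv[OF t w] FxD(1)[OF f]] .
  also have "w \<otimes> y \<otimes> (?f \<otimes> inv w) = w \<otimes> (y \<otimes> ?f) \<otimes> inv w" using wc yc fc by (simp add: m_assoc)
  also have "y \<otimes> ?f = ?f \<otimes> y" using centD(2)[OF y f'] .
  also have "w \<otimes> (?f \<otimes> y) \<otimes> inv w = w \<otimes> ?f \<otimes> y \<otimes> inv w" using wc yc fc by (simp add: m_assoc)
  also have "w \<otimes> ?f = f \<otimes> w"
    using eigD(2)[OF w(1) FxD(1)[OF f']] gal_inv(1)[OF t FxD(1)[OF f]] by simp
  finally show "w \<otimes> y \<otimes> inv w \<otimes> f = f \<otimes> (w \<otimes> y \<otimes> inv w)" using wc yc fc by (simp add: m_assoc)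
qed

text \<open>The elementwise content of a cyclic quotient of prime order q generated by the coset of
  s, phrased inside the Galois group, so that no quotient group occurs in this part. The vector x is
  any nonzero eigenvector of s.\<close>

context
  fixes H H' :: "('a \<Rightarrow> 'a) set" and s :: "'a \<Rightarrow> 'a" and q :: nat and x :: 'a
  assumes H: "subgroup H \<Gamma>" and H': "subgroup H' \<Gamma>" and sub: "H \<subseteq> H'" and s: "s \<in> H'"
    and prime_q: "prime q"
    and norm: "\<And>h. h \<in> H \<Longrightarrow> inv\<^bsub>\<Gamma>\<^esub> s \<otimes>\<^bsub>\<Gamma>\<^esub> h \<otimes>\<^bsub>\<Gamma>\<^esub> s \<in> H"
      "\<And>h. h \<in> H \<Longrightarrow> s \<otimes>\<^bsub>\<Gamma>\<^esub> h \<otimes>\<^bsub>\<Gamma>\<^esub> inv\<^bsub>\<Gamma>\<^esub> s \<in> H"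
    and pow_q: "s [^]\<^bsub>\<Gamma>\<^esub> q \<in> H"
    and pow_less: "\<And>j. 0 < j \<Longrightarrow> j < q \<Longrightarrow> s [^]\<^bsub>\<Gamma>\<^esub> j \<notin> H"
    and cover: "\<And>\<sigma>. \<sigma> \<in> H' \<Longrightarrow> \<exists>l<q. \<exists>g\<in>H. \<sigma> = g \<otimes>\<^bsub>\<Gamma>\<^esub> s [^]\<^bsub>\<Gamma>\<^esub> l"
    and x: "x \<in> eig s" "x \<noteq> \<zero>"
begin

abbreviation s_pow where "s_pow j \<equiv> s [^]\<^bsub>\<Gamma>\<^esub> (j::nat)"

lemma s_Gal: "s \<in> carrier \<Gamma>" using in_Gal[OF H' s] .

lemma s_pow_Gal: "s_pow j \<in> carrier \<Gamma>" using s_Gal by simp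

lemma q_gt: "1 < q" using prime_q prime_gt_1_nat by blast

lemma x_unit: "x \<in> Units A" using eig_unit[OF s_Gal x] .

lemma x_closed: "x \<in> carrier A" "inv x \<in> carrier A" using x_unit by auto

lemma x_pow_unit: "x [^] (j::nat) \<in> Units A" using x_unit by (rule Units_pow_closed)

lemma x_pow_eig: "x [^] (j::nat) \<in> eig (s_pow j)" using eig_pow[OF s_Gal x(1)] .

text \<open>Write h s = s (s^(-1) h s): by normality the bracket lies in H and fixes f.\<close>

lemma s_Fx: assumes f: "f \<in> Fx H" shows "s f \<in> Fx H"
proof (rule FxI)
  note fM = FxD(1)[OF f]
  show "s f \<in> M" using fM s_Gal by simp
  fix h assume h: "h \<in> H"
  note hG = in_Gal[OF H h]
  have "h (s f) = s ((inv\<^bsub>\<Gamma>\<^esub> s) (h (s f)))" using gal_inv(1)[OF s_Gal, of "h (s f)"] hG s_Gal fM by simp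
  also have "(inv\<^bsub>\<Gamma>\<^esub> s) (h (s f)) = (inv\<^bsub>\<Gamma>\<^esub> s \<otimes>\<^bsub>\<Gamma>\<^esub> h \<otimes>\<^bsub>\<Gamma>\<^esub> s) f"
    using hG s_Gal fM by (simp add: gal_mult)
  also have "\<dots> = f" using FxD(3)[OF f norm(1)[OF h]] .
  finally show "h (s f) = s f" .
qed

lemma s_inv_Fx: assumes f: "f \<in> Fx H" shows "(inv\<^bsub>\<Gamma>\<^esub> s) f \<in> Fx H"
proof (rule FxI)
  note fM = FxD(1)[OF f]
  let ?f = "(inv\<^bsub>\<Gamma>\<^esub> s) f"
  show fM': "?f \<in> M" using fM s_Gal by simp
  fix h assume h: "h \<in> H"
  note hG = in_Gal[OF H h]
  have "h ?f = (inv\<^bsub>\<Gamma>\<^esub> s) (s (h ?f))" using gal_inv(2)[OF s_Gal, of "h ?f"] hG s_Gal fM by simp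
  also have "s (h ?f) = (s \<otimes>\<^bsub>\<Gamma>\<^esub> h \<otimes>\<^bsub>\<Gamma>\<^esub> inv\<^bsub>\<Gamma>\<^esub> s) f"
    using hG s_Gal fM by (simp add: gal_mult)
  also have "\<dots> = f" using FxD(3)[OF f norm(2)[OF h]] .
  finally show "h ?f = ?f" .
qed

lemma s_pow_Fx: "f \<in> Fx H \<Longrightarrow> (s_pow j) f \<in> Fx H"
proof (induction j arbitrary: f)
  case 0
  then show ?case using FxD(1) by (simp add: gal_one)
next
  case (Suc j)
  then show ?case using Suc.IH[OF s_Fx[OF Suc.prems]] gal_pow_Suc[OF s_Gal FxD(1)[OF Suc.prems]] by metis
qed

text \<open>If s^i and s^j agreed on the fixed field of H, then s^(j-i) would fix it pointwise and
  lie in H, although 0 < j - i < q. So the powers of s below q act as distinct characters of that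
  field.\<close>

lemma s_pow_distinct:
  assumes "i < q" "j < q" "i \<noteq> j"
  shows "\<exists>f\<in>Fx H. (s_pow i) f \<noteq> (s_pow j) f"
proof -
  have wlog: "\<exists>f\<in>Fx H. (s_pow i) f \<noteq> (s_pow j) f" if ij: "i < j" "j < q" for i j :: nat
  proof (rule ccontr)
    assume "\<not> ?thesis"
    then have e: "(s_pow i) f = (s_pow j) f" if "f \<in> Fx H" for f using that by blast
    let ?d = "s_pow (j - i)"
    have "?d f = f" if f: "f \<in> Fx H" for f
    proof -
      note fM = FxD(1)[OF f]
      have "s_pow j = s_pow i \<otimes>\<^bsub>\<Gamma>\<^esub> ?d" using Gal.nat_pow_mult[OF s_Gal, of i "j - i"] ij by simp
      then have "(s_pow i) f = (s_pow i) (?d f)" using e[OF f] gal_mult[OF s_pow_Gal s_pow_Gal fM] by simp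
      then show ?thesis
        using gal_inv(2)[OF s_pow_Gal, of f i] gal_inv(2)[OF s_pow_Gal, of "?d f" i] fM gal_simps(1)[OF s_pow_Gal fM] by metis
    qed
    then have "?d \<in> H" using mem_of_fixing[OF H s_pow_Gal] by blast
    then show False using pow_less[of "j - i"] ij by simp
  qed
  then show ?thesis using assms by (metis linorder_neqE_nat)
qed

section \<open>Conjugation by x on the smaller algebra, its inner order and its order on the
  center\<close>

abbreviation "B \<equiv> cent H"
abbreviation "R \<equiv> A\<lparr>carrier := cent H\<rparr>"
abbreviation "S \<equiv> A\<lparr>carrier := cent H'\<rparr>"

text \<open>Restricted to \<open>B\<close> because elements of \<open>Bij\<close> are
  extensional.\<close>

definition conj_x :: "'a \<Rightarrow> 'a" where "conj_x = (\<lambda>y\<in>B. x \<otimes> y \<otimes> inv x)"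

definition x_q :: 'a where "x_q = x [^] q"

lemma B_closed: "y \<in> B \<Longrightarrow> y \<in> carrier A" using centD(1) .

lemma conj_x_eq: "y \<in> B \<Longrightarrow> conj_x y = x \<otimes> y \<otimes> inv x" by (simp add: conj_x_def)

lemma conj_x_closed: "y \<in> B \<Longrightarrow> conj_x y \<in> B"
  using conj_cent[OF s_Gal x s_inv_Fx] by (simp add: conj_x_eq)

lemma conj_x_inv_closed: "y \<in> B \<Longrightarrow> inv x \<otimes> y \<otimes> x \<in> B"
  using conj_cent[of "inv\<^bsub>\<Gamma>\<^esub> s" "inv x" H y] eig_inv[OF s_Gal x] Units_nonzero[of "inv x"] x_unit s_Gal s_Fx
  by simp

lemma conj_x_comm:
  assumes "y \<in> B" shows "x \<otimes> y = conj_x y \<otimes> x"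
  using iffD1[OF conj_cancel[OF x_unit B_closed[OF assms] B_closed[OF conj_x_closed[OF assms]]]] conj_x_eq[OF assms] by simp

lemma conj_x_hom: "conj_x \<in> ring_hom R R"
proof (rule ring_hom_memI)
  show "conj_x y \<in> carrier R" if "y \<in> carrier R" for y using that conj_x_closed by simp
  show "conj_x (y \<otimes>\<^bsub>R\<^esub> z) = conj_x y \<otimes>\<^bsub>R\<^esub> conj_x z" if "y \<in> carrier R" "z \<in> carrier R" for y z
  proof -
    have yz: "y \<in> B" "z \<in> B" "y \<otimes> z \<in> B" using that subringE(6)[OF subring_cent] by auto
    have "x \<otimes> y \<otimes> inv x \<otimes> (x \<otimes> z \<otimes> inv x) = x \<otimes> y \<otimes> (inv x \<otimes> x) \<otimes> z \<otimes> inv x"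
      using x_closed B_closed yz by (simp add: m_assoc del: Units_l_inv)
    also have "\<dots> = x \<otimes> (y \<otimes> z) \<otimes> inv x" using x_unit x_closed B_closed yz by (simp add: m_assoc)
    finally show ?thesis using yz by (simp add: conj_x_eq)
  qed
  show "conj_x (y \<oplus>\<^bsub>R\<^esub> z) = conj_x y \<oplus>\<^bsub>R\<^esub> conj_x z" if "y \<in> carrier R" "z \<in> carrier R" for y z
  proof -
    have yz: "y \<in> B" "z \<in> B" "y \<oplus> z \<in> B" using that subringE(7)[OF subring_cent] by auto
    then show ?thesis using x_closed B_closed by (simp add: conj_x_eq l_distr r_distr)
  qed
  show "conj_x \<one>\<^bsub>R\<^esub> = \<one>\<^bsub>R\<^esub>"
    using subringE(3)[OF subring_cent] x_unit x_closed by (simp add: conj_x_eq)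
qed

lemma conj_x_Bij: "conj_x \<in> Bij B"
proof -
  have "bij_betw conj_x B B"
  proof (rule bij_betwI[where g = "\<lambda>y. inv x \<otimes> y \<otimes> x"])
    show "inv x \<otimes> conj_x y \<otimes> x = y" if y: "y \<in> B" for y
    proof -
      have "inv x \<otimes> conj_x y \<otimes> x = inv x \<otimes> (x \<otimes> y)"
        using conj_x_comm[OF y] x_closed B_closed[OF conj_x_closed[OF y]] by (simp add: m_assoc)
      also have "\<dots> = inv x \<otimes> x \<otimes> y" using x_closed B_closed[OF y] by (simp add: m_assoc del: Units_l_inv)
      finally show ?thesis using x_unit B_closed[OF y] by simp
    qed
    show "conj_x (inv x \<otimes> y \<otimes> x) = y" if y: "y \<in> B" for y
    proof -
      have "conj_x (inv x \<otimes> y \<otimes> x) = x \<otimes> inv x \<otimes> y \<otimes> (x \<otimes> inv x)"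
        using conj_x_inv_closed[OF y] x_closed B_closed[OF y] by (simp add: conj_x_eq m_assoc del: Units_r_inv)
      then show ?thesis using x_unit B_closed[OF y] by simp
    qed
  qed (use conj_x_closed conj_x_inv_closed in auto)
  then show ?thesis by (simp add: Bij_def conj_x_def)
qed

lemma conj_x_M: "m \<in> M \<Longrightarrow> conj_x m = s m"
  using M_sub_cent[of H] eig_conj[OF s_Gal x] by (auto simp: conj_x_eq)

lemma ring_R: "ring R" and ring_S: "ring S"
  by (rule subring_is_ring[OF subring_cent])+

lemma B_sub: "B \<subseteq> cent H'"
  using sub by (auto simp: cent_def Fix_def)

text \<open>Evaluation at t = x, with the inclusion of the smaller algebra into the larger one as
  \<phi>.\<close>

lemma twisted_eval: "twisted_eval R S conj_x (\<lambda>a. a) x"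
proof -
  have "twisted R conj_x"
    by (intro twisted.intro ring_R twisted_axioms.intro conj_x_hom)
  moreover have "twisted_eval_axioms R S conj_x (\<lambda>a. a) x"
    unfolding twisted_eval_axioms_def
    using B_sub eig_sub_cent[OF s x(1)] conj_x_comm by (auto simp: ring_hom_def)
  ultimately show ?thesis by (intro twisted_eval.intro ring_S)
qed

lemma conj_x_pow:
  assumes y: "y \<in> B"
  shows "(conj_x ^^ j) y \<in> B" "x [^] j \<otimes> y = (conj_x ^^ j) y \<otimes> x [^] j"
    "(conj_x ^^ j) y = x [^] j \<otimes> y \<otimes> inv (x [^] j)"
proof -
  interpret T: twisted_eval R S conj_x "\<lambda>a. a" x by (rule twisted_eval)
  show 1: "(conj_x ^^ j) y \<in> B" using T.tau_pow(1)[of y j] y by simp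
  show 2: "x [^] j \<otimes> y = (conj_x ^^ j) y \<otimes> x [^] j"
    using T.x_pow_comm[of y j] y nat_pow_consistent[of x j "cent H'"] by simp
  show "(conj_x ^^ j) y = x [^] j \<otimes> y \<otimes> inv (x [^] j)"
    using iffD2[OF conj_cancel[OF x_pow_unit B_closed[OF y] B_closed[OF 1]] 2] by simp
qed

text \<open>x^q is an eigenvector of s^q, and s^q lies in H; this is why x^q falls into the smaller
  algebra.\<close>

lemma x_q_unit: "x_q \<in> Units A" "x_q \<in> B" "inv x_q \<in> B" "x_q \<in> Units R"
proof -
  show 1: "x_q \<in> Units A" unfolding x_q_def by (rule x_pow_unit)
  show 2: "x_q \<in> B" unfolding x_q_def using eig_sub_cent[OF pow_q x_pow_eig] .
  show 3: "inv x_q \<in> B" using inv_in_cent[OF 1 2] .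
  show "x_q \<in> Units R" using Units_subringI[OF 1 2 3] .
qed

lemma conj_x_x_q: "conj_x x_q = x_q"
proof -
  have "x \<otimes> x_q = x_q \<otimes> x" unfolding x_q_def using nat_pow_Suc2[OF x_closed(1), of q] by simp
  from iffD2[OF conj_cancel[OF x_unit B_closed[OF x_q_unit(2)] B_closed[OF x_q_unit(2)]] this]
  show ?thesis using x_q_unit(2) by (simp add: conj_x_eq)
qed

text \<open>\<open>gen_cyclic_datum\<close> asks for a unit of the fixed ring of the automorphism,
  so the inverse must be fixed too.\<close>

lemma conj_x_inv_x_q: "conj_x (inv x_q) = inv x_q"
proof -
  interpret T: twisted_eval R S conj_x "\<lambda>a. a" x by (rule twisted_eval)
  have h: "conj_x (inv x_q) \<otimes> conj_x x_q = \<one>"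
    using ring_hom_mult[OF conj_x_hom, of "inv x_q" x_q] ring_hom_one[OF conj_x_hom] x_q_unit by simp
  then have "conj_x (inv x_q) \<otimes> x_q \<otimes> inv x_q = inv x_q" using conj_x_x_q x_q_unit by simp
  then show ?thesis using x_q_unit B_closed[OF conj_x_closed[OF x_q_unit(3)]] Units_closed[OF x_q_unit(1)]
    by (simp add: m_assoc)
qed

text \<open>The q-th power is conjugation by x^q. If the j-th power were conjugation by a unit u of
  \<open>B\<close>, it would be trivial on the fixed field of H, which u centralizes; but there it
  acts as s^j, so s^j would lie in H.\<close>

lemma conj_x_has_inner_order: "has_inner_order R conj_x q"
  unfolding has_inner_order_def
proof (intro conjI allI impI)
  show "0 < q" using q_gt by simp
  show "inner_auto R (conj_x ^^ q)"
    unfolding inner_auto_def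
  proof (intro bexI[of _ x_q] ballI)
    fix z assume "z \<in> carrier R"
    then show "(conj_x ^^ q) z = x_q \<otimes>\<^bsub>R\<^esub> z \<otimes>\<^bsub>R\<^esub> inv\<^bsub>R\<^esub> x_q"
      using conj_x_pow(3)[of z q] Units_subring_inv(3)[OF subring_cent x_q_unit(4)] by (simp add: x_q_def)
  qed (rule x_q_unit)
  fix j assume j: "0 < j \<and> j < q"
  show "\<not> inner_auto R (conj_x ^^ j)"
  proof
    assume "inner_auto R (conj_x ^^ j)"
    then obtain u where u: "u \<in> Units R"
      and e: "\<And>z. z \<in> B \<Longrightarrow> (conj_x ^^ j) z = u \<otimes> z \<otimes> inv u"
      using Units_subring_inv(3)[OF subring_cent] by (auto simp: inner_auto_def)
    have uA: "u \<in> Units A" "u \<in> B" using Units_subring_inv(1)[OF subring_cent u] u by (auto simp: Units_def)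
    have "(s_pow j) f = f" if f: "f \<in> Fx H" for f
    proof -
      have fB: "f \<in> B" using Fx_sub_cent f by blast
      have "(s_pow j) f = x [^] j \<otimes> f \<otimes> inv (x [^] j)"
        using eig_conj[OF s_pow_Gal x_pow_eig Units_nonzero[OF x_pow_unit] FxD(1)[OF f]] by simp
      also have "\<dots> = u \<otimes> f \<otimes> inv u" using conj_x_pow(3)[OF fB] e[OF fB] by simp
      also have "\<dots> = f"
        using iffD2[OF conj_cancel[OF uA(1) B_closed[OF fB] B_closed[OF fB]] centD(2)[OF uA(2) f]] .
      finally show ?thesis .
    qed
    then have "s_pow j \<in> H" using mem_of_fixing[OF H s_pow_Gal] by blast
    then show False using pow_less j by blast
  qed
qed

text \<open>On the center, which is the fixed field of H, conjugation by x is s. Its q-th power is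
  trivial there since s^q lies in H, so the order divides the prime q; it is not 1 because s itself
  is outside H.\<close>

lemma conj_x_center_order:
  "group.ord (BijGroup (center R)) (restrict conj_x (center R)) = q"
proof -
  let ?Z = "Fx H"
  define u where "u = restrict conj_x (Fx H)"
  interpret BG: group "BijGroup ?Z" by (rule group_BijGroup)
  have te: "u f = s f" if "f \<in> ?Z" for f using conj_x_M FxD(1)[OF that] that by (simp add: u_def)
  have t: "u \<in> Bij ?Z"
  proof -
    have "bij_betw u ?Z ?Z"
      by (rule bij_betwI[where g = "inv\<^bsub>\<Gamma>\<^esub> s"])
        (use s_Fx s_inv_Fx te gal_inv[OF s_Gal FxD(1)] in auto)
    then show ?thesis by (simp add: Bij_def u_def)
  qed
  \<comment> \<open>Membership in \<open>Bij\<close> is carried along because multiplication in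
    \<open>BijGroup\<close> is composition only there.\<close>
  have tp: "u [^]\<^bsub>BijGroup ?Z\<^esub> j \<in> Bij ?Z \<and>
      (\<forall>f\<in>?Z. (u [^]\<^bsub>BijGroup ?Z\<^esub> j) f = (s_pow j) f)" for j :: nat
  proof (induction j)
    case 0
    have e: "u [^]\<^bsub>BijGroup ?Z\<^esub> (0::nat) = (\<lambda>f\<in>?Z. f)" by (simp add: BijGroup_def)
    show ?case unfolding e by (intro conjI id_Bij ballI) (simp add: gal_one FxD(1))
  next
    case (Suc j)
    have m: "g \<otimes>\<^bsub>BijGroup ?Z\<^esub> u = compose ?Z g u" if "g \<in> Bij ?Z" for g
      using that t by (simp add: BijGroup_def)
    have "u [^]\<^bsub>BijGroup ?Z\<^esub> Suc j = compose ?Z (u [^]\<^bsub>BijGroup ?Z\<^esub> j) u"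
      using m[OF conjunct1[OF Suc]] by simp
    moreover have "compose ?Z (u [^]\<^bsub>BijGroup ?Z\<^esub> j) u f = (s_pow (Suc j)) f" if f: "f \<in> ?Z" for f
      using Suc f te[OF f] s_Fx[OF f] gal_pow_Suc[OF s_Gal FxD(1)[OF f], of j] by (simp add: compose_eq)
    ultimately show ?case using compose_Bij[of "u [^]\<^bsub>BijGroup ?Z\<^esub> j" ?Z u] Suc t by metis
  qed
  have tc: "u \<in> carrier (BijGroup ?Z)" using t by (simp add: BijGroup_def)
  have one: "\<one>\<^bsub>BijGroup ?Z\<^esub> = (\<lambda>f\<in>?Z. f)" by (simp add: BijGroup_def)
  have "u [^]\<^bsub>BijGroup ?Z\<^esub> q = \<one>\<^bsub>BijGroup ?Z\<^esub>"
    unfolding one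
  proof (rule extensionalityI)
    show "u [^]\<^bsub>BijGroup ?Z\<^esub> q \<in> extensional ?Z" using tp[of q] by (simp add: Bij_def)
    show "(u [^]\<^bsub>BijGroup ?Z\<^esub> q) f = (\<lambda>f\<in>?Z. f) f" if "f \<in> ?Z" for f
      using tp[of q] that FxD(3)[OF that pow_q] by simp
  qed simp
  then have "BG.ord u dvd q" using BG.pow_eq_id[OF tc] by simp
  moreover have "BG.ord u \<noteq> 1"
  proof
    assume "BG.ord u = 1"
    then have "u [^]\<^bsub>BijGroup ?Z\<^esub> (1::nat) = \<one>\<^bsub>BijGroup ?Z\<^esub>"
      using BG.pow_eq_id[OF tc, of 1] by (simp only: dvd_refl)
    then have "(s_pow 1) f = f" if "f \<in> ?Z" for f
      using tp[of 1] that one by (metis restrict_apply')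
    then have "s_pow 1 \<in> H" using mem_of_fixing[OF H s_pow_Gal] by blast
    then show False using pow_less[of 1] q_gt by simp
  qed
  ultimately have "BG.ord u = q" using prime_q prime_nat_iff by blast
  then show ?thesis using center_cent[OF H] by (simp add: u_def)
qed

text \<open>Elements of \<open>B\<close> commute with the fixed field of H, so
  \<open>a l \<otimes> x [^] l\<close> is an eigenvector for the character s^l of that field. These
  characters are distinct for l < q, so every term vanishes, and x^l is a unit.\<close>

lemma unique_decomposition:
  assumes a: "\<And>l. l < q \<Longrightarrow> a l \<in> B" and z: "(\<Oplus>l\<in>{..<q}. a l \<otimes> x [^] l) = \<zero>" and l: "l < q"
  shows "a l = \<zero>"
proof -
  note Z = subfield_Fx[OF subgroup.subset[OF H]]
  have xpc: "x [^] (j::nat) \<in> carrier A" for j using x_closed by simp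
  have "a l \<otimes> x [^] l = \<zero>"
  proof (rule eigenvectors_independent[OF Z, of "{..<q}" "\<lambda>l. s_pow l" "\<lambda>l. a l \<otimes> x [^] l"])
    show "(s_pow i) f \<in> Fx H" if "f \<in> Fx H" for i :: nat and f using s_pow_Fx[OF that] .
    show "\<exists>k\<in>Fx H. (s_pow i) k \<noteq> (s_pow j) k" if "i \<in> {..<q}" "j \<in> {..<q}" "i \<noteq> j" for i j
      using s_pow_distinct that by simp
    show "a i \<otimes> x [^] i \<in> carrier A" if "i \<in> {..<q}" for i using B_closed[OF a] xpc that by simp
    show "a i \<otimes> x [^] i \<otimes> f = (s_pow i) f \<otimes> (a i \<otimes> x [^] i)" if "i \<in> {..<q}" "f \<in> Fx H" for i f
    proof -
      have ai: "a i \<in> B" "a i \<in> carrier A" using a that B_closed by auto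
      note f' = s_pow_Fx[OF that(2), of i]
      have "a i \<otimes> x [^] i \<otimes> f = a i \<otimes> (x [^] i \<otimes> f)" using ai xpc FxD(2)[OF that(2)] by (simp add: m_assoc)
      also have "\<dots> = a i \<otimes> ((s_pow i) f \<otimes> x [^] i)" using eigD(2)[OF x_pow_eig FxD(1)[OF that(2)]] by simp
      also have "\<dots> = a i \<otimes> (s_pow i) f \<otimes> x [^] i" using ai xpc FxD(2)[OF f'] by (simp add: m_assoc)
      also have "\<dots> = (s_pow i) f \<otimes> a i \<otimes> x [^] i" using centD(2)[OF ai(1) f'] by simp
      finally show ?thesis using ai xpc FxD(2)[OF f'] by (simp add: m_assoc)
    qed
  qed (use z l in auto)
  then have "a l \<otimes> x [^] l \<otimes> inv (x [^] l) = \<zero>" using x_pow_unit[of l] by simp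
  then show ?thesis using x_pow_unit[of l] B_closed[OF a[OF l]] xpc by (simp add: m_assoc)
qed

text \<open>Write \<sigma> = g s^l with g in H. An eigenvector of \<sigma> times x^(-l) is an
  eigenvector of g and so lies in \<open>B\<close>. Hence each term of an expansion of y over H'
  already has the required form.\<close>

lemma ex_decomposition:
  assumes y: "y \<in> cent H'"
  obtains a where "\<And>l. l < q \<Longrightarrow> a l \<in> B" "y = (\<Oplus>l\<in>{..<q}. a l \<otimes> x [^] l)"
proof -
  let ?V = "lin_span B {..<q} (\<lambda>l. x [^] l)"
  have xpc: "x [^] (j::nat) \<in> carrier A" for j using x_closed by simp
  note Bs = subringE[OF subring_cent[of H]]
  have V: "?V \<subseteq> carrier A"
    unfolding lin_span_def using xpc B_closed by (auto intro!: finsum_closed)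
  have V_zero: "\<zero> \<in> ?V"
    unfolding lin_span_def using Bs(2) xpc
    by (intro CollectI exI[of _ "\<lambda>_. \<zero>"]) (auto intro!: add.finprod_one_eqI[symmetric])
  have V_add: "v \<oplus> w \<in> ?V" if v: "v \<in> ?V" and w: "w \<in> ?V" for v w
  proof -
    obtain k where k: "k \<in> {..<q} \<rightarrow> B" "v = (\<Oplus>l\<in>{..<q}. k l \<otimes> x [^] l)"
      using v unfolding lin_span_def by blast
    obtain k' where k': "k' \<in> {..<q} \<rightarrow> B" "w = (\<Oplus>l\<in>{..<q}. k' l \<otimes> x [^] l)"
      using w unfolding lin_span_def by blast
    have kc: "k l \<in> carrier A" "k' l \<in> carrier A" if "l < q" for l using k(1) k'(1) that B_closed by auto
    have "v \<oplus> w = (\<Oplus>l\<in>{..<q}. k l \<otimes> x [^] l \<oplus> k' l \<otimes> x [^] l)"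
      unfolding k(2) k'(2) using kc xpc by (intro finsum_addf[symmetric]) auto
    also have "\<dots> = (\<Oplus>l\<in>{..<q}. (k l \<oplus> k' l) \<otimes> x [^] l)"
      using kc xpc by (intro finsum_cong') (auto simp: l_distr)
    finally show ?thesis unfolding lin_span_def using k(1) k'(1) Bs(7)
      by (intro CollectI exI[of _ "\<lambda>l. k l \<oplus> k' l"]) auto
  qed
  obtain z where z: "eig_family z" using ex_eig_family by blast
  obtain k where k: "k \<in> H' \<rightarrow> M" "y = (\<Oplus>\<sigma>\<in>H'. k \<sigma> \<otimes> z \<sigma>)"
    using y cent_span[OF H' z] unfolding lin_span_def by blast
  have "k \<sigma> \<otimes> z \<sigma> \<in> ?V" if s': "\<sigma> \<in> H'" for \<sigma>
  proof -
    obtain l g where lg: "l < q" "g \<in> H" "\<sigma> = g \<otimes>\<^bsub>\<Gamma>\<^esub> s_pow l" using cover[OF s'] by blast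
    have sg: "\<sigma> \<in> carrier \<Gamma>" "g \<in> carrier \<Gamma>" using in_Gal[OF H' s'] in_Gal[OF H lg(2)] .
    let ?p = "x [^] l"
    have v: "k \<sigma> \<otimes> z \<sigma> \<in> eig \<sigma>"
      using eig_scale[of "z \<sigma>" \<sigma> "k \<sigma>"] z sg k(1) s' by (auto simp: eig_family_def)
    have "inv ?p \<in> eig (inv\<^bsub>\<Gamma>\<^esub> (s_pow l))"
      using eig_inv[OF s_pow_Gal x_pow_eig Units_nonzero[OF x_pow_unit]] .
    from eig_mult[OF v this sg(1)]
    have "k \<sigma> \<otimes> z \<sigma> \<otimes> inv ?p \<in> eig (\<sigma> \<otimes>\<^bsub>\<Gamma>\<^esub> inv\<^bsub>\<Gamma>\<^esub> (s_pow l))" using s_pow_Gal by simp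
    moreover have "\<sigma> \<otimes>\<^bsub>\<Gamma>\<^esub> inv\<^bsub>\<Gamma>\<^esub> (s_pow l) = g" unfolding lg(3) using sg s_pow_Gal by (simp add: Gal.m_assoc)
    ultimately have wB: "k \<sigma> \<otimes> z \<sigma> \<otimes> inv ?p \<in> B" using eig_sub_cent[OF lg(2)] by simp
    let ?w = "k \<sigma> \<otimes> z \<sigma> \<otimes> inv ?p"
    have "?w \<otimes> ?p = k \<sigma> \<otimes> z \<sigma>" using x_pow_unit[of l] eigD(1)[OF v] xpc by (simp add: m_assoc)
    moreover have "(\<Oplus>j\<in>{..<q}. (if j = l then ?w else \<zero>) \<otimes> x [^] j) = ?w \<otimes> ?p"
      using lg(1) B_closed[OF wB] xpc by (subst finsum_eq_single[of _ l]) auto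
    ultimately show ?thesis unfolding lin_span_def using wB Bs(2)
      by (intro CollectI exI[of _ "\<lambda>j. if j = l then ?w else \<zero>"]) auto
  qed
  from finsum_in_additive[OF V V_zero V_add this] have "y \<in> ?V" unfolding k(2) .
  then show ?thesis using that unfolding lin_span_def by blast
qed

abbreviation "poly_x \<equiv> tp_binomial R conj_x q x_q"

text \<open>Existence and uniqueness of the expansion in powers of x say that evaluation at x is
  bijective on reduced polynomials. As it kills t^q - x^q, the same evaluation yields the
  isomorphism and the invariance of that polynomial.\<close>

theorem cyclic_algebra:
  shows "gen_cyclic_datum R conj_x q x_q"
    and "\<exists>h\<in>ring_iso S (gen_cyclic_algebra R conj_x q x_q). \<forall>z\<in>Fx H'. h z = tp_const R z"
proof -
  interpret T: twisted_eval R S conj_x "\<lambda>a. a" x by (rule twisted_eval)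
  have ccR: "x_q \<in> carrier R" using x_q_unit by simp
  have xpS: "x [^]\<^bsub>S\<^esub> (j::nat) = x [^] j" for j using nat_pow_consistent[of x j "cent H'"] by simp
  have poly_x: "poly_x = (\<lambda>n. if n = q then \<one> else if n = 0 then \<ominus>\<^bsub>R\<^esub> x_q else \<zero>)"
    using T.tp_binomial_eq[OF ccR, of q] q_gt by (simp add: fun_eq_iff)
  have f_up: "poly_x \<in> up R" unfolding poly_x
  proof (rule mem_upI)
    show "\<exists>n. bound \<zero>\<^bsub>R\<^esub> n (\<lambda>n. if n = q then \<one> else if n = 0 then \<ominus>\<^bsub>R\<^esub> x_q else \<zero>)"
      by (rule exI[of _ q]) (auto simp: bound_def)
  qed (use ccR T.a_inv_closed[OF ccR] T.one_closed T.zero_closed in auto)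
  have f_props: "poly_x q = \<one>\<^bsub>R\<^esub>" "\<forall>n>q. poly_x n = \<zero>\<^bsub>R\<^esub>" "0 < q" "\<one>\<^bsub>R\<^esub> \<noteq> \<zero>\<^bsub>R\<^esub>"
    using q_gt one_neq_zero by (auto simp: poly_x)
  have ev_sum: "T.ev r = (\<Oplus>l\<in>I. r l \<otimes> x [^] l)"
    if "r \<in> up R" "finite I" "\<And>i. i \<notin> I \<Longrightarrow> r i = \<zero>" for r I
  proof -
    have "r l \<otimes> x [^] l \<in> cent H'" for l
    proof (rule subringE(6)[OF subring_cent])
      show "r l \<in> cent H'" using mem_upD[OF that(1), of l] B_sub by auto
      show "x [^] l \<in> cent H'" using T.S.nat_pow_closed[OF T.x_closed, of l] xpS by simp
    qed
    then show ?thesis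
      using T.ev_eq[OF that(1,2)] that(3) finsum_subring[OF subring_cent that(2)] xpS by simp
  qed
  have ev_ff: "T.ev poly_x = \<zero>\<^bsub>S\<^esub>"
  proof -
    have mc: "\<ominus>\<^bsub>R\<^esub> x_q \<in> B" using T.a_inv_closed[OF ccR] by simp
    \<comment> \<open>The additive inverse is taken in the ring on \<open>B\<close>; its sum with
      \<open>x_q\<close> vanishes in A because both rings share addition and zero.\<close>
    have z: "\<ominus>\<^bsub>R\<^esub> x_q \<oplus> x_q = \<zero>" using T.l_neg[OF ccR] by simp
    have "T.ev poly_x = (\<Oplus>l\<in>{0, q}. poly_x l \<otimes> x [^] l)" by (rule ev_sum[OF f_up]) (auto simp: poly_x)
    also have "\<dots> = \<ominus>\<^bsub>R\<^esub> x_q \<oplus> x [^] q"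
      using q_gt mc B_closed[OF mc] x_closed by (subst finsum_insert) (auto simp: poly_x)
    finally show ?thesis using z by (simp add: x_q_def)
  qed
  have red: "r \<in> tp_reduced R poly_x \<longleftrightarrow> r \<in> up R \<and> (\<forall>n\<ge>q. r n = \<zero>)" for r
    unfolding tp_reduced_def T.deg_monic[OF f_up f_props(1,2,4)] by simp
  have ev_red: "T.ev r = (\<Oplus>l\<in>{..<q}. r l \<otimes> x [^] l)" if "r \<in> tp_reduced R poly_x" for r
    using that red by (intro ev_sum) auto
  have bij: "bij_betw T.ev (tp_reduced R poly_x) (carrier S)"
  proof (rule bij_betw_imageI)
    show "inj_on T.ev (tp_reduced R poly_x)"
    proof (rule inj_onI)
      fix r r' assume r: "r \<in> tp_reduced R poly_x" "r' \<in> tp_reduced R poly_x" and e: "T.ev r = T.ev r'"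
      have rB: "r l \<in> B" "r' l \<in> B" for l using r red mem_upD[of _ R] by auto
      have rc: "r l \<in> carrier A" "r' l \<in> carrier A" for l using rB B_closed by auto
      have xpc: "x [^] (j::nat) \<in> carrier A" for j using x_closed by simp
      have "(\<Oplus>l\<in>{..<q}. (r l \<ominus> r' l) \<otimes> x [^] l) = (\<Oplus>l\<in>{..<q}. r l \<otimes> x [^] l \<ominus> r' l \<otimes> x [^] l)"
        using rc xpc by (intro finsum_cong') (auto simp: a_minus_def l_distr l_minus)
      also have "\<dots> = T.ev r \<ominus> T.ev r'"
        unfolding ev_red[OF r(1)] ev_red[OF r(2)] using rc xpc by (intro finsum_minus) auto
      also have "\<dots> = \<zero>" using e T.ev_closed[of r] r(1) red centD(1) by (simp add: a_minus_def r_neg)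
      finally have z: "(\<Oplus>l\<in>{..<q}. (r l \<ominus> r' l) \<otimes> x [^] l) = \<zero>" .
      have "r l \<ominus> r' l = \<zero>" if "l < q" for l
        using unique_decomposition[of "\<lambda>l. r l \<ominus> r' l", OF _ z that] rB
          subringE(5,7)[OF subring_cent[of H]] by (simp add: a_minus_def)
      then have "r l = r' l" if "l < q" for l using rc that by simp
      moreover have "r l = r' l" if "l \<ge> q" for l using r red that by simp
      ultimately show "r = r'" by (metis not_less ext)
    qed
    show "T.ev ` tp_reduced R poly_x = carrier S"
    proof
      show "T.ev ` tp_reduced R poly_x \<subseteq> carrier S" using T.ev_closed red by blast
      show "carrier S \<subseteq> T.ev ` tp_reduced R poly_x"
      proof
        fix y assume "y \<in> carrier S"
        then have "y \<in> cent H'" by simp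
        then obtain a where a: "\<And>l. l < q \<Longrightarrow> a l \<in> B" "y = (\<Oplus>l\<in>{..<q}. a l \<otimes> x [^] l)"
          using ex_decomposition by blast
        define r where "r l = (if l < q then a l else \<zero>)" for l
        have "r \<in> up R"
        proof (rule mem_upI)
          show "r l \<in> carrier R" for l using a(1) T.zero_closed by (simp add: r_def)
          show "\<exists>n. bound \<zero>\<^bsub>R\<^esub> n r" by (rule exI[of _ q]) (auto simp: bound_def r_def)
        qed
        then have rr: "r \<in> tp_reduced R poly_x" by (simp add: red r_def)
        have "T.ev r = y" unfolding ev_red[OF rr] a(2)
          using a(1) B_closed x_closed by (intro finsum_cong') (auto simp: r_def)
        then show "y \<in> T.ev ` tp_reduced R poly_x" using rr by blast
      qed
    qed
  qed
  show "\<exists>h\<in>ring_iso S (gen_cyclic_algebra R conj_x q x_q). \<forall>z\<in>Fx H'. h z = tp_const R z"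
    unfolding gen_cyclic_algebra_def
  proof (rule bexI[OF _ T.inv_ev_ring_iso[OF f_up f_props ev_ff bij]], rule ballI)
    fix z assume "z \<in> Fx H'"
    then have "z \<in> carrier R" using Fx_sub_cent[of H] sub by (auto simp: Fix_def)
    then show "inv_into (tp_reduced R poly_x) T.ev z = tp_const R z"
      using T.inv_ev_const[OF f_up f_props ev_ff bij] by simp
  qed
  have inv: "tp_invariant R conj_x poly_x" by (rule T.tp_invariant_kernel[OF f_up f_props ev_ff bij])
  have "x_q \<in> Units (R\<lparr>carrier := Fix {conj_x} (carrier R)\<rparr>)"
    using Units_subringI[OF x_q_unit(1), of "Fix {conj_x} B"] x_q_unit conj_x_x_q conj_x_inv_x_q by (simp add: Fix_def)
  then show "gen_cyclic_datum R conj_x q x_q"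
    using central_simple_cent[OF H] center_cent[OF H] conj_x_hom conj_x_Bij q_gt conj_x_center_order inv
    by (simp add: gen_cyclic_datum_def central_simple_degree_def ring_auto_def)
qed

end
end

section \<open>Prime cyclic quotients\<close>

text \<open>A generator of a group of order q has order q, so s^j lies in H exactly when q divides
  j. This turns the hypothesis on the quotient group into the elementwise conditions of the cyclic
  step.\<close>

lemma (in normal) prime_cyclic_quotient:
  assumes order: "order (G Mod H) = q" and prime: "prime q" and s: "s \<in> carrier G"
    and gen: "generate (G Mod H) {H #> s} = carrier (G Mod H)"
  shows "s [^] q \<in> H" "\<And>j. 0 < j \<Longrightarrow> j < q \<Longrightarrow> s [^] j \<notin> H"
    and "\<And>x. x \<in> carrier G \<Longrightarrow> \<exists>l<q. \<exists>g\<in>H. x = g \<otimes> s [^] l"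
    and "order G = q * card H"
proof -
  interpret Q: group "G Mod H" by (rule factorgroup_is_group)
  let ?a = "H #> s"
  have q: "0 < q" using prime prime_gt_0_nat by blast
  have a: "?a \<in> carrier (G Mod H)" using s by (auto simp: carrier_FactGroup)
  have ord: "Q.ord ?a = q"
    using Q.generate_pow_card[OF a] gen order by (simp add: order_def)
  have pow: "?a [^]\<^bsub>G Mod H\<^esub> j = H #> s [^] j" for j :: nat
    using FactGroup_pow[OF s] .
  have mem: "s [^] j \<in> H \<longleftrightarrow> q dvd j" for j :: nat
  proof -
    have "s [^] j \<in> H \<longleftrightarrow> H #> s [^] j = H"
      using coset_join1[of H "s [^] j"] coset_join2[of "s [^] j" H] s subgroup_axioms by auto
    then show ?thesis using Q.pow_eq_id[OF a, of j] ord pow[of j] by simp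
  qed
  show "s [^] q \<in> H" using mem[of q] by simp
  show "s [^] j \<notin> H" if "0 < j" "j < q" for j
    using mem[of j] that by (auto dest: dvd_imp_le)
  show "\<exists>l<q. \<exists>g\<in>H. x = g \<otimes> s [^] l" if x: "x \<in> carrier G" for x
  proof -
    have "H #> x \<in> generate (G Mod H) {?a}" using x gen by (auto simp: carrier_FactGroup)
    then obtain k :: nat where k: "H #> x = H #> s [^] k"
      using Q.generate_pow_nat[OF a] ord q pow by auto
    \<comment> \<open>The exponent k is an arbitrary natural number; it is reduced modulo q to reach
      l < q.\<close>
    have "(?a [^]\<^bsub>G Mod H\<^esub> q) [^]\<^bsub>G Mod H\<^esub> (k div q) = \<one>\<^bsub>G Mod H\<^esub>"
      using Q.pow_eq_id[OF a, of q] ord by (simp del: one_FactGroup)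
    then have "?a [^]\<^bsub>G Mod H\<^esub> (q * (k div q)) = \<one>\<^bsub>G Mod H\<^esub>" using Q.nat_pow_pow[OF a] by simp
    then have "?a [^]\<^bsub>G Mod H\<^esub> (q * (k div q) + k mod q) = ?a [^]\<^bsub>G Mod H\<^esub> (k mod q)"
      using Q.nat_pow_mult[OF a, of "q * (k div q)" "k mod q"] Q.l_one[OF Q.nat_pow_closed[OF a]]
      by metis
    then have "H #> x = H #> s [^] (k mod q)" using k pow by simp
    moreover have "x \<in> H #> x" using rcos_self[OF x subgroup_axioms] .
    ultimately obtain g where "g \<in> H" "x = g \<otimes> s [^] (k mod q)" by (auto simp: r_coset_def)
    then show ?thesis using q by (intro exI[of _ "k mod q"]) auto
  qed
  show "order G = q * card H"
    using lagrange[OF subgroup_axioms] order by (simp add: order_def FactGroup_def)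
qed

section \<open>Assembly of the chain of generalized cyclic algebras\<close>

theorem theorem14:
  fixes A :: "('a, 'b) ring_scheme"
    and F M :: "'a set"
    and n k :: nat
    and G :: "nat \<Rightarrow> ('a \<Rightarrow> 'a) set"
    and \<sigma> :: "nat \<Rightarrow> 'a \<Rightarrow> 'a"
    and q :: "nat \<Rightarrow> nat"
  assumes "galois_ext A F M"
    and "ring.dimension A n F M"
    and "carrier (Gal A F M) \<noteq> {\<one>\<^bsub>Gal A F M\<^esub>}"
    and "solvable (Gal A F M)"
    and "central_simple_degree A F n"
    and "maximal_subfield A F M"
    and "\<And>j. j \<le> k \<Longrightarrow> subgroup (G j) (Gal A F M)"
    and "G 0 = {\<one>\<^bsub>Gal A F M\<^esub>}"
    and "G k = carrier (Gal A F M)"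
    and "\<And>j. j < k \<Longrightarrow> G j \<lhd> (Gal A F M)\<lparr>carrier := G (Suc j)\<rparr>"
    and "\<And>j. j < k \<Longrightarrow> order ((Gal A F M)\<lparr>carrier := G (Suc j)\<rparr> Mod G j) = q j"
    and "\<And>j. j < k \<Longrightarrow> prime (q j)"
    and "\<And>j. j < k \<Longrightarrow> \<sigma> (Suc j) \<in> G (Suc j)"
    and "\<And>j. j < k \<Longrightarrow>
      generate ((Gal A F M)\<lparr>carrier := G (Suc j)\<rparr> Mod G j) {G j #>\<^bsub>Gal A F M\<^esub> \<sigma> (Suc j)}
        = carrier ((Gal A F M)\<lparr>carrier := G (Suc j)\<rparr> Mod G j)"
  shows "crossed_product (Gal A F M) A F \<and>
    (\<exists>(B :: nat \<Rightarrow> 'a set) (\<tau> :: nat \<Rightarrow> 'a \<Rightarrow> 'a) (c :: nat \<Rightarrow> 'a).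
      B 0 = M \<and>
      (\<forall>i < k. B i \<subset> B (Suc i)) \<and>
      B k = conj_span A M (carrier (Gal A F M)) \<and>
      conj_span A M (carrier (Gal A F M)) = carrier A \<and>
      (\<forall>i \<le> k. subring (B i) A \<and> subalgebra F (B i) A) \<and>
      (\<forall>i \<le> k. central_simple_degree (A\<lparr>carrier := B i\<rparr>) (Fix (G i) M) (\<Prod>l<i. q l)) \<and>
      (\<forall>i < k.
        gen_cyclic_datum (A\<lparr>carrier := B i\<rparr>) (\<tau> i) (q i) (c i) \<and>
        (\<exists>h \<in> ring_iso (A\<lparr>carrier := B (Suc i)\<rparr>)
                (gen_cyclic_algebra (A\<lparr>carrier := B i\<rparr>) (\<tau> i) (q i) (c i)).
          \<forall>z \<in> Fix (G (Suc i)) M. h z = tp_const (A\<lparr>carrier := B i\<rparr>) z) \<and>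
        prime (q i) \<and> q i = order ((Gal A F M)\<lparr>carrier := G (Suc i)\<rparr> Mod G i) \<and>
        \<tau> i \<in> alg_auto F (A\<lparr>carrier := B i\<rparr>) \<and>
        has_inner_order (A\<lparr>carrier := B i\<rparr>) (\<tau> i) (q i) \<and>
        (\<forall>x \<in> M. \<tau> i x = \<sigma> (Suc i) x) \<and>
        c i \<in> Fix {\<tau> i} (B i) \<and> c i \<in> Units (A\<lparr>carrier := B i\<rparr>))) \<and>
    (\<forall>i \<in> {1..k}.
      field_ext A (Fix (G i) M) (Fix (G (i - 1)) M) \<and>
      prime (q (i - 1)) \<and>
      ring.dimension A (q (i - 1)) (Fix (G i) M) (Fix (G (i - 1)) M))"
proof -
  let ?\<Gamma> = "Gal A F M"
  have ring: "ring A" using assms(5) by (simp add: central_simple_degree_def central_simple_def simple_ring_def)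
  \<comment> \<open>For k = 0 the conditions on \<open>G 0\<close> and \<open>G k\<close> would make
    the Galois group trivial.\<close>
  have k: "0 < k" using assms(3,8,9) by (cases k) auto
  \<comment> \<open>The group structure is read off the top step of the chain: normality in
    \<open>G k\<close> contains the statement that the structure on \<open>G k\<close> is a group,
    and \<open>G k\<close> is the whole carrier.\<close>
  have grp: "group ?\<Gamma>"
  proof -
    obtain j where j: "k = Suc j" "j < k" using k by (cases k) auto
    have "group (?\<Gamma>\<lparr>carrier := G (Suc j)\<rparr>)" using normal.axioms(2)[OF assms(10)[OF j(2)]] .
    then show ?thesis using assms(9) j(1) by simp
  qed
  interpret \<Gamma>: group ?\<Gamma> by (rule grp)
  note sg = assms(7)
  have step: "\<sigma> (Suc j) [^]\<^bsub>?\<Gamma>\<^esub> q j \<in> G j"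
    "0 < i \<Longrightarrow> i < q j \<Longrightarrow> \<sigma> (Suc j) [^]\<^bsub>?\<Gamma>\<^esub> i \<notin> G j"
    "x \<in> G (Suc j) \<Longrightarrow> \<exists>l<q j. \<exists>g\<in>G j. x = g \<otimes>\<^bsub>?\<Gamma>\<^esub> \<sigma> (Suc j) [^]\<^bsub>?\<Gamma>\<^esub> l"
    "card (G (Suc j)) = q j * card (G j)"
    "G j \<subseteq> G (Suc j)"
    "h \<in> G j \<Longrightarrow> inv\<^bsub>?\<Gamma>\<^esub> \<sigma> (Suc j) \<otimes>\<^bsub>?\<Gamma>\<^esub> h \<otimes>\<^bsub>?\<Gamma>\<^esub> \<sigma> (Suc j) \<in> G j"
    "h \<in> G j \<Longrightarrow> \<sigma> (Suc j) \<otimes>\<^bsub>?\<Gamma>\<^esub> h \<otimes>\<^bsub>?\<Gamma>\<^esub> inv\<^bsub>?\<Gamma>\<^esub> \<sigma> (Suc j) \<in> G j"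
    if j: "j < k" for j i x h
  proof -
    let ?K = "?\<Gamma>\<lparr>carrier := G (Suc j)\<rparr>"
    interpret N: normal "G j" ?K using assms(10)[OF j] .
    have sK: "\<sigma> (Suc j) \<in> carrier ?K" using assms(13)[OF j] by simp
    have gen: "generate (?K Mod G j) {G j #>\<^bsub>?K\<^esub> \<sigma> (Suc j)} = carrier (?K Mod G j)"
      using assms(14)[OF j] by simp
    note c = N.prime_cyclic_quotient[OF assms(11)[OF j] assms(12)[OF j] sK gen]
    have p: "y [^]\<^bsub>?K\<^esub> i = y [^]\<^bsub>?\<Gamma>\<^esub> i" for y and i :: nat
      using \<Gamma>.nat_pow_consistent[of y i "G (Suc j)"] by simp
    have iv: "inv\<^bsub>?K\<^esub> \<sigma> (Suc j) = inv\<^bsub>?\<Gamma>\<^esub> \<sigma> (Suc j)"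
      using \<Gamma>.m_inv_consistent[OF sg[of "Suc j"]] j sK by simp
    show "\<sigma> (Suc j) [^]\<^bsub>?\<Gamma>\<^esub> q j \<in> G j" using c(1) p by simp
    show "0 < i \<Longrightarrow> i < q j \<Longrightarrow> \<sigma> (Suc j) [^]\<^bsub>?\<Gamma>\<^esub> i \<notin> G j" using c(2)[of i] p by simp
    show "x \<in> G (Suc j) \<Longrightarrow> \<exists>l<q j. \<exists>g\<in>G j. x = g \<otimes>\<^bsub>?\<Gamma>\<^esub> \<sigma> (Suc j) [^]\<^bsub>?\<Gamma>\<^esub> l"
      using c(3)[of x] p by simp
    show "card (G (Suc j)) = q j * card (G j)" using c(4) by (simp add: order_def)
    show "G j \<subseteq> G (Suc j)" using N.subset by simp
    show "h \<in> G j \<Longrightarrow> inv\<^bsub>?\<Gamma>\<^esub> \<sigma> (Suc j) \<otimes>\<^bsub>?\<Gamma>\<^esub> h \<otimes>\<^bsub>?\<Gamma>\<^esub> \<sigma> (Suc j) \<in> G j"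
      using N.inv_op_closed1[OF sK, of h] iv by simp
    show "h \<in> G j \<Longrightarrow> \<sigma> (Suc j) \<otimes>\<^bsub>?\<Gamma>\<^esub> h \<otimes>\<^bsub>?\<Gamma>\<^esub> inv\<^bsub>?\<Gamma>\<^esub> \<sigma> (Suc j) \<in> G j"
      using N.inv_op_closed2[OF sK, of h] iv by simp
  qed
  have card_G: "card (G i) = (\<Prod>l<i. q l)" if "i \<le> k" for i
    using that
  proof (induction i)
    case 0
    then show ?case using assms(8) by simp
  next
    case (Suc i)
    then show ?case using step(4)[of i] by simp
  qed
  \<comment> \<open>Finiteness comes from the chain as well: an infinite set has \<open>card\<close>
    equal to 0, whereas \<open>card (G k)\<close> is a product of primes.\<close>
  have fin: "finite (carrier ?\<Gamma>)"
  proof -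
    have "q l \<noteq> 0" if "l < k" for l using prime_gt_0_nat[OF assms(12)[OF that]] by simp
    then have "card (G k) \<noteq> 0" using card_G[of k] by simp
    then show ?thesis using assms(9) card.infinite by fastforce
  qed
  interpret C: galois_csa A F M n
    using ring assms(1,2,5) grp fin by (intro galois_csa.intro galois_csa_axioms.intro)
  have "crossed_product ?\<Gamma> A F"
    unfolding crossed_product_def
    using assms(1,5,6) iso_refl[of ?\<Gamma>] by (auto simp: central_simple_degree_def)
  define B where "B i = C.cent (G i)" for i
  let ?R = "\<lambda>i. A\<lparr>carrier := B i\<rparr>"
  \<comment> \<open>All conditions on one step are collected so that \<tau> and c can be chosen for
    every i at once.\<close>
  let ?P = "\<lambda>i t c. gen_cyclic_datum (?R i) t (q i) c \<and>
        (\<exists>h \<in> ring_iso (?R (Suc i)) (gen_cyclic_algebra (?R i) t (q i) c).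
          \<forall>z \<in> Fix (G (Suc i)) M. h z = tp_const (?R i) z) \<and>
        t \<in> alg_auto F (?R i) \<and> has_inner_order (?R i) t (q i) \<and>
        (\<forall>x \<in> M. t x = \<sigma> (Suc i) x) \<and> c \<in> Fix {t} (B i) \<and> c \<in> Units (?R i)"
  have ex: "\<exists>t c. ?P i t c" if i: "i < k" for i
  proof -
    have s_Gal: "\<sigma> (Suc i) \<in> carrier ?\<Gamma>"
      using C.in_Gal[OF sg[of "Suc i"] assms(13)[OF i]] i by simp
    obtain x where x: "x \<in> C.eig (\<sigma> (Suc i))" "x \<noteq> \<zero>\<^bsub>A\<^esub>" using C.ex_eig_nonzero[OF s_Gal] by blast
    have H: "subgroup (G i) ?\<Gamma>" "subgroup (G (Suc i)) ?\<Gamma>" using sg i by simp_all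
    \<comment> \<open>These follow the order of the assumptions of the cyclic step, with
      \<open>G i\<close> for H, \<open>G (Suc i)\<close> for H' and \<open>\<sigma> (Suc i)\<close>
      for s.\<close>
    note hyps = H step(5)[OF i] assms(13)[OF i] assms(12)[OF i] step(6)[OF i] step(7)[OF i]
      step(1)[OF i] step(2)[OF i] step(3)[OF i] x
    let ?t = "C.conj_x (G i) x" and ?c = "C.x_q (q i) x"
    have "?t \<in> alg_auto F (?R i)"
      using C.conj_x_hom[OF hyps] C.conj_x_Bij[OF hyps] C.conj_x_M[OF hyps] C.F_sub_M C.gal_F[OF s_Gal]
      by (auto simp: alg_auto_def ring_auto_def B_def)
    moreover have "?c \<in> Fix {?t} (B i)"
      using C.conj_x_x_q[OF hyps] C.x_q_unit(2)[OF hyps] by (simp add: Fix_def B_def)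
    ultimately show ?thesis
      using C.cyclic_algebra[OF hyps] C.conj_x_has_inner_order[OF hyps] C.conj_x_M[OF hyps]
        C.x_q_unit(4)[OF hyps] unfolding B_def by blast
  qed
  obtain \<tau> c where tc: "\<And>i. i < k \<Longrightarrow> ?P i (\<tau> i) (c i)"
    using ex by metis
  \<comment> \<open>Strictness is seen from dimensions over M: \<open>card (G i)\<close> and
    \<open>card (G (Suc i))\<close> differ by the factor \<open>q i\<close>, which exceeds
    1.\<close>
  have "B i \<subset> B (Suc i)" if i: "i < k" for i
  proof -
    have H: "subgroup (G i) ?\<Gamma>" "subgroup (G (Suc i)) ?\<Gamma>" using sg i by simp_all
    have "B i \<subseteq> B (Suc i)" using step(5)[OF i] unfolding B_def C.cent_def Fix_def by blast
    moreover have "card (G i) \<noteq> card (G (Suc i))"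
    proof -
      have "1 < q i" using prime_gt_1_nat[OF assms(12)[OF i]] .
      moreover have "0 < card (G i)"
        using C.finite_H[OF H(1)] subgroup.one_closed[OF H(1)] card_gt_0_iff by blast
      ultimately show ?thesis using step(4)[OF i] by simp
    qed
    then have "B i \<noteq> B (Suc i)"
      using C.dimension_is_inj[OF C.subfield_M C.dimension_M_cent[OF H(1)], of "card (G (Suc i))"]
        C.dimension_M_cent[OF H(2)] unfolding B_def by auto
    ultimately show ?thesis by blast
  qed
  moreover have "B 0 = M" using assms(8) C.cent_one by (simp add: B_def)
  moreover have "B k = conj_span A M (carrier ?\<Gamma>)" "conj_span A M (carrier ?\<Gamma>) = carrier A"
    using assms(9) C.cent_Gal C.conj_span_eq by (simp_all add: B_def)
  moreover have "subring (B i) A \<and> subalgebra F (B i) A" for i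
  proof -
    have s: "subring (B i) A" unfolding B_def by (rule C.subring_cent)
    have "F \<subseteq> B i" unfolding B_def using C.F_sub_M C.M_sub_cent by blast
    then show ?thesis
      using s C.subring_add_subgroup[OF s] subringE(6)[OF s]
      by (auto simp: subalgebra_def subalgebra_axioms_def)
  qed
  moreover have "central_simple_degree (?R i) (Fix (G i) M) (\<Prod>l<i. q l)" if "i \<le> k" for i
    using C.central_simple_cent[OF sg[OF that]] card_G[OF that] by (simp add: B_def)
  moreover have "field_ext A (Fix (G i) M) (Fix (G (i - 1)) M) \<and> prime (q (i - 1)) \<and>
      ring.dimension A (q (i - 1)) (Fix (G i) M) (Fix (G (i - 1)) M)" if i: "i \<in> {1..k}" for i
  proof -
    obtain j where j: "i = Suc j" "j < k" using i by (cases i) auto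
    have H: "subgroup (G j) ?\<Gamma>" "subgroup (G (Suc j)) ?\<Gamma>" using sg j by simp_all
    have "Fix (G (Suc j)) M \<subseteq> Fix (G j) M" using step(5)[OF j(2)] by (auto simp: Fix_def)
    then have "field_ext A (Fix (G (Suc j)) M) (Fix (G j) M)"
      using C.subfield_Fx subgroup.subset[OF H(1)] subgroup.subset[OF H(2)] by (simp add: field_ext_def)
    then show ?thesis
      using C.dimension_fixed_fields[OF H step(5)[OF j(2)] step(4)[OF j(2)]] assms(12)[OF j(2)] j(1) by simp
  qed
  ultimately show ?thesis
    using \<open>crossed_product ?\<Gamma> A F\<close> tc assms(11,12)
    by (intro conjI exI[of _ B] exI[of _ \<tau>] exI[of _ c]) auto
qed

end
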